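(* Let $(W,S)$ be a Coxeter system of finite rank with a fixed symmetrizable generalized Cartan matrix, and let $c$ be a Coxeter element. An element $w\in W$ is $c$-sortable if and only if it is $c$-aligned. In this case, $w$ is also $c$-aligned with respect to every noncommutative generalized rank two parabolic subgroup of $W$.
   Context: $S$ finite, $m(s,s')$ the order of $ss'$; $T$ = reflections (conjugates of elements of $S$); $\ell$ length; $\mathrm{inv}(w)=\{t\in T:\ell(tw)<\ell(w)\}$. $c$-sortable: a Coxeter element is $c=s_1\cdots s_n$ (all of $S$ in some order). With $s_1\cdots s_n$ a reduced word for $c$, the $c$-sorting word of $w$ is the lexicographically first (by positions) subword of $(s_1\cdots s_n)^\infty$ that is a reduced word for $w$; $w$ is $c$-sortable if the sets of letters of this word in successive copies of $s_1\cdots s_n$ are weakly decreasing under inclusion. Root data: a symmetrizable generalized Cartan matrix $A=(a_{ss'})$ has $a_{ss}=2$; for $s\neq s'$, $a_{ss'}\le0$, $a_{ss'}a_{s's}=4\cos^2(\pi/m(s,s'))$ if $m(s,s')<\infty$, $\ge4$ if $m(s,s')=\infty$, $a_{ss'}=0\iff a_{s's}=0$; and $\delta:S\to\mathbb{R}_{>0}$ with $\delta(s)a_{ss'}=\delta(s')a_{s's}$, $\delta$ constant on conjugate simple reflections. $V$ has basis $\alpha_s$, $s(\alpha_{s'})=\alpha_{s'}-a_{ss'}\alpha_s$; positive roots are the roots $w\alpha_s$ in the nonnegative span of the $\alpha_s$; $t\mapsto\beta_t$ is the bijection $T\to$ positive roots. $K(\alpha_s,\alpha_{s'})=\delta(s)a_{ss'}$.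 For $c=s_1\cdots s_n$, $\omega_c$ is bilinear with $\omega_c(\alpha_{s_i},\alpha_{s_j})=K(\alpha_{s_i},\alpha_{s_j})$ if $i>j$, $0$ if $i=j$, $-K(\alpha_{s_i},\alpha_{s_j})$ if $i<j$. Rank two subgroups: a rank two parabolic subgroup is a conjugate $xW_{\{r,s\}}x^{-1}$ with $r\ne s\in S$. For distinct reflections $t_1,t_2$, the generalized rank two parabolic subgroup containing them is the subgroup $W'$ generated by all $t\in T$ with $\beta_t$ in the span of $\beta_{t_1},\beta_{t_2}$; every rank two parabolic subgroup is one. Such $W'$ has exactly two canonical generators $r_1,r_2$ (the reflections in $W'$ whose roots span the extreme rays of the cone spanned by $\{\beta_t:t\in W'\cap T\}$), and $W'\cap T=\{u_1=r_1,u_2=r_1r_2r_1,u_3=r_1r_2r_1r_2r_1,\dots,u_{m-1}=r_2r_1r_2,u_m=r_2\}$ where $m$ is the order of $r_1r_2$; if $m=\infty$ the index set is the positive integers followed by formal symbols $\infty-k$ ($k\ge0$), totally ordered with $i<\infty-k$ and $\infty-k<\infty-k'$ when $k>k'$. $W'$ is noncommutative if $r_1r_2\ne r_2r_1$. Alignment: $w$ is $c$-aligned with respect to a noncommutative generalized rank two parabolic subgroup $W'$ if either (1) for some labeling $r_1,r_2$ of its canonical generators, $\omega_c(\beta_{u_i},\beta_{u_j})>0$ for all indices $i<j$, and $\mathrm{inv}(w)\cap W'$ is either empty, the singleton $\{u_m\}$, or a finite initial segment $\{u_1,\dots,u_k\}$; or (2) $\omega_c(\beta_{u_i},\beta_{u_j})=0$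 for all indices $i,j$, and $\mathrm{inv}(w)\cap W'$ is empty or a singleton. $w$ is $c$-aligned if it is $c$-aligned with respect to every noncommutative rank two parabolic subgroup of $W$. *)

theory Defs
  imports "HOL-Algebra.Generated_Groups" "HOL-Algebra.Multiplicative_Group"
    "HOL-Analysis.Analysis" "HOL-Analysis.Finite_Function_Topology"
begin

section \<open>Coxeter systems\<close>

definition word_prod :: "('a, 'b) monoid_scheme \<Rightarrow> 'a list \<Rightarrow> 'a"
  where "word_prod W ws = foldr (\<lambda>x y. x \<otimes>\<^bsub>W\<^esub> y) ws \<one>\<^bsub>W\<^esub>"

text \<open>
  The congruence on words generated by \<open>(s t)\<^sup>m = 1\<close>, where \<open>m\<close> is the order of \<open>s t\<close> in \<open>W\<close>.
  \<open>group.ord\<close> is \<open>0\<close> for elements of infinite order, so that such pairs contribute nothing, and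
  the case \<open>s = t\<close> gives \<open>s s = 1\<close> (whence the monoid and the group presentation agree).
\<close>

inductive coxeter_equiv :: "('a, 'b) monoid_scheme \<Rightarrow> 'a set \<Rightarrow> 'a list \<Rightarrow> 'a list \<Rightarrow> bool"
  for W S where
  rel: "s \<in> S \<Longrightarrow> t \<in> S \<Longrightarrow>
    coxeter_equiv W S (xs @ concat (replicate (group.ord W (s \<otimes>\<^bsub>W\<^esub> t)) [s, t]) @ ys) (xs @ ys)"
| refl: "coxeter_equiv W S xs xs"
| sym: "coxeter_equiv W S xs ys \<Longrightarrow> coxeter_equiv W S ys xs"
| trans: "coxeter_equiv W S xs ys \<Longrightarrow> coxeter_equiv W S ys zs \<Longrightarrow> coxeter_equiv W S xs zs"

text \<open>
  The last assumption says that \<open>W\<close> is presented by the generators \<open>S\<close> and the relations above.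
\<close>

locale coxeter_system = group W for W (structure) +
  fixes S :: "'a set"
  assumes finite_S: "finite S"
    and S_subset: "S \<subseteq> carrier W"
    and involution: "s \<in> S \<Longrightarrow> s \<noteq> \<one> \<and> s \<otimes> s = \<one>"
    and generated: "generate W S = carrier W"
    and presented: "\<lbrakk>xs \<in> lists S; ys \<in> lists S; word_prod W xs = word_prod W ys\<rbrakk>
      \<Longrightarrow> coxeter_equiv W S xs ys"
begin

definition reflections :: "'a set"
  where "reflections = {x \<otimes> s \<otimes> inv x | x s. x \<in> carrier W \<and> s \<in> S}"

definition cox_length :: "'a \<Rightarrow> nat"
  where "cox_length w = (LEAST n. \<exists>ws \<in> lists S. length ws = n \<and> word_prod W ws = w)"

definition reduced_word :: "'a \<Rightarrow> 'a list \<Rightarrow> bool"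
  where "reduced_word w ws \<longleftrightarrow> ws \<in> lists S \<and> word_prod W ws = w \<and> length ws = cox_length w"

definition inversions :: "'a \<Rightarrow> 'a set"
  where "inversions w = {t \<in> reflections. cox_length (t \<otimes> w) < cox_length w}"

subsection \<open>Coxeter elements and sortability\<close>

definition coxeter_element_word :: "'a \<Rightarrow> 'a list \<Rightarrow> bool"
  where "coxeter_element_word c cs \<longleftrightarrow> distinct cs \<and> set cs = S \<and> c = word_prod W cs"

text \<open>
  A finite subword of \<open>(s\<^sub>1 \<dots> s\<^sub>n)\<^sup>\<infinity>\<close> is given by the strictly increasing list of its positions,
  counted from \<open>0\<close>. Position \<open>p\<close> lies in copy \<open>p div n\<close> and carries letter \<open>cs ! (p mod n)\<close>.
\<close>

definition letter_at :: "'a list \<Rightarrow> nat \<Rightarrow> 'a"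
  where "letter_at cs p = cs ! (p mod length cs)"

definition reduced_subword :: "'a list \<Rightarrow> 'a \<Rightarrow> nat list \<Rightarrow> bool"
  where "reduced_subword cs w ps \<longleftrightarrow> sorted_wrt (<) ps \<and> reduced_word w (map (letter_at cs) ps)"

definition sorting_positions :: "'a list \<Rightarrow> 'a \<Rightarrow> nat list \<Rightarrow> bool"
  where "sorting_positions cs w ps \<longleftrightarrow> reduced_subword cs w ps \<and>
    (\<forall>qs. reduced_subword cs w qs \<longrightarrow> ps = qs \<or> (ps, qs) \<in> lexord less_than)"

definition block :: "'a list \<Rightarrow> nat list \<Rightarrow> nat \<Rightarrow> 'a set"
  where "block cs ps j = letter_at cs ` {p \<in> set ps. p div length cs = j}"

definition c_sortable :: "'a list \<Rightarrow> 'a \<Rightarrow> bool"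
  where "c_sortable cs w \<longleftrightarrow>
    (\<exists>ps. sorting_positions cs w ps \<and> (\<forall>j. block cs ps (Suc j) \<subseteq> block cs ps j))"

definition rank_two_parabolic :: "'a set \<Rightarrow> bool"
  where "rank_two_parabolic P \<longleftrightarrow> (\<exists>x \<in> carrier W. \<exists>r \<in> S. \<exists>s \<in> S. r \<noteq> s \<and>
    P = (\<lambda>y. x \<otimes> y \<otimes> inv x) ` generate W {r, s})"

end


section \<open>Indexing the reflections of a dihedral group\<close>

text \<open>
  \<open>Fin i\<close> is the index \<open>i\<close>, and \<open>Inf_minus k\<close> is the formal symbol \<open>\<infinity> - k\<close>.
  The order \<open>m\<close> of a product is \<open>0\<close> when infinite.
\<close>

datatype dihedral_index = Fin nat | Inf_minus nat

fun index_less :: "dihedral_index \<Rightarrow> dihedral_index \<Rightarrow> bool" where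
  "index_less (Fin i) (Fin j) \<longleftrightarrow> i < j"
| "index_less (Fin i) (Inf_minus k) \<longleftrightarrow> True"
| "index_less (Inf_minus k) (Fin i) \<longleftrightarrow> False"
| "index_less (Inf_minus k) (Inf_minus k') \<longleftrightarrow> k > k'"

definition index_set :: "nat \<Rightarrow> dihedral_index set"
  where "index_set m = (if m = 0 then Fin ` {1..} \<union> range Inf_minus else Fin ` {1..m})"

text \<open>\<open>u\<^sub>i = r\<^sub>1 r\<^sub>2 r\<^sub>1 \<dots>\<close> with \<open>2 i - 1\<close> letters, and \<open>u\<^bsub>\<infinity>-k\<^esub> = r\<^sub>2 r\<^sub>1 r\<^sub>2 \<dots>\<close> with \<open>2 k + 1\<close>.\<close>

fun dihedral_refl :: "('a, 'b) monoid_scheme \<Rightarrow> 'a \<Rightarrow> 'a \<Rightarrow> dihedral_index \<Rightarrow> 'a" where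
  "dihedral_refl W r1 r2 (Fin i) = (r1 \<otimes>\<^bsub>W\<^esub> r2) [^]\<^bsub>W\<^esub> (i - 1) \<otimes>\<^bsub>W\<^esub> r1"
| "dihedral_refl W r1 r2 (Inf_minus k) = (r2 \<otimes>\<^bsub>W\<^esub> r1) [^]\<^bsub>W\<^esub> k \<otimes>\<^bsub>W\<^esub> r2"


section \<open>Root data and alignment\<close>

locale coxeter_root_datum = coxeter_system W S for W (structure) and S +
  fixes A :: "'a \<Rightarrow> 'a \<Rightarrow> real" and \<delta> :: "'a \<Rightarrow> real"
  assumes A_diag: "s \<in> S \<Longrightarrow> A s s = 2"
    and A_nonpos: "\<lbrakk>s \<in> S; s' \<in> S; s \<noteq> s'\<rbrakk> \<Longrightarrow> A s s' \<le> 0"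
    and A_finite: "\<lbrakk>s \<in> S; s' \<in> S; s \<noteq> s'; ord (s \<otimes> s') \<noteq> 0\<rbrakk>
      \<Longrightarrow> A s s' * A s' s = 4 * (cos (pi / real (ord (s \<otimes> s'))))\<^sup>2"
    and A_infinite: "\<lbrakk>s \<in> S; s' \<in> S; s \<noteq> s'; ord (s \<otimes> s') = 0\<rbrakk> \<Longrightarrow> A s s' * A s' s \<ge> 4"
    and A_zero: "\<lbrakk>s \<in> S; s' \<in> S; s \<noteq> s'\<rbrakk> \<Longrightarrow> A s s' = 0 \<longleftrightarrow> A s' s = 0"
    and \<delta>_pos: "s \<in> S \<Longrightarrow> \<delta> s > 0"
    and symmetrizable: "\<lbrakk>s \<in> S; s' \<in> S\<rbrakk> \<Longrightarrow> \<delta> s * A s s' = \<delta> s' * A s' s"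
    and \<delta>_conj: "\<lbrakk>s \<in> S; s' \<in> S; x \<in> carrier W; s' = x \<otimes> s \<otimes> inv x\<rbrakk> \<Longrightarrow> \<delta> s = \<delta> s'"
begin

text \<open>
  \<open>V\<close> is realized inside the free real vector space on the type of \<open>W\<close>, as the span of the basis
  vectors \<open>\<alpha>\<^sub>s\<close> with \<open>s \<in> S\<close>; all roots lie there.
\<close>

definition simple_root :: "'a \<Rightarrow> ('a \<Rightarrow>\<^sub>0 real)"
  where "simple_root s = Poly_Mapping.single s 1"

definition simple_act :: "'a \<Rightarrow> ('a \<Rightarrow>\<^sub>0 real) \<Rightarrow> ('a \<Rightarrow>\<^sub>0 real)"
  where "simple_act s v = v - (\<Sum>s'\<in>S. A s s' * Poly_Mapping.lookup v s') *\<^sub>R simple_root s"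

definition word_act :: "'a list \<Rightarrow> ('a \<Rightarrow>\<^sub>0 real) \<Rightarrow> ('a \<Rightarrow>\<^sub>0 real)"
  where "word_act ws v = foldr simple_act ws v"

text \<open>
  \<open>\<beta>\<^sub>t\<close> is the positive root of the form \<open>w \<alpha>\<^sub>s\<close> with \<open>t = w s w\<^sup>-\<^sup>1\<close>. It is unique because \<open>\<delta>\<close> is
  constant on conjugate simple reflections.
\<close>

definition root_of :: "'a \<Rightarrow> ('a \<Rightarrow>\<^sub>0 real)"
  where "root_of t = (THE \<beta>. (\<exists>ws \<in> lists S. \<exists>s \<in> S.
      t = word_prod W ws \<otimes> s \<otimes> inv (word_prod W ws) \<and> \<beta> = word_act ws (simple_root s)) \<and>
    (\<forall>s \<in> S. Poly_Mapping.lookup \<beta> s \<ge> 0))"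

definition K_simple :: "'a \<Rightarrow> 'a \<Rightarrow> real"
  where "K_simple s s' = \<delta> s * A s s'"

definition omega :: "'a list \<Rightarrow> ('a \<Rightarrow>\<^sub>0 real) \<Rightarrow> ('a \<Rightarrow>\<^sub>0 real) \<Rightarrow> real"
  where "omega cs u v = (\<Sum>i<length cs. \<Sum>j<length cs.
    Poly_Mapping.lookup u (cs ! i) * Poly_Mapping.lookup v (cs ! j) *
    (if i > j then K_simple (cs ! i) (cs ! j)
     else if i = j then 0
     else - K_simple (cs ! i) (cs ! j)))"

definition gen_rank_two_parabolic :: "'a set \<Rightarrow> bool"
  where "gen_rank_two_parabolic P \<longleftrightarrow> (\<exists>t1 \<in> reflections. \<exists>t2 \<in> reflections. t1 \<noteq> t2 \<and>
    P = generate W {t \<in> reflections. root_of t \<in> span {root_of t1, root_of t2}})"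

text \<open>Extreme rays are the one-dimensional faces of the cone of the positive roots of \<open>P\<close>.\<close>

definition canonical_generators :: "'a set \<Rightarrow> 'a set"
  where "canonical_generators P = {r \<in> P \<inter> reflections.
    (conic hull {root_of r}) face_of (convex_cone hull (root_of ` (P \<inter> reflections)))}"

definition canonical_labeling :: "'a set \<Rightarrow> 'a \<Rightarrow> 'a \<Rightarrow> bool"
  where "canonical_labeling P r1 r2 \<longleftrightarrow> r1 \<noteq> r2 \<and> canonical_generators P = {r1, r2}"

definition noncommutative :: "'a set \<Rightarrow> bool"
  where "noncommutative P \<longleftrightarrow> (\<exists>r1 r2. canonical_labeling P r1 r2 \<and> r1 \<otimes> r2 \<noteq> r2 \<otimes> r1)"

text \<open>The last reflection \<open>u\<^sub>m\<close> is \<open>r2\<close>, also for \<open>m = \<infinity>\<close>.\<close>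

definition aligned_wrt :: "'a list \<Rightarrow> 'a \<Rightarrow> 'a set \<Rightarrow> bool"
  where "aligned_wrt cs w P \<longleftrightarrow> (\<exists>r1 r2. canonical_labeling P r1 r2 \<and>
    (let I = index_set (ord (r1 \<otimes> r2)); u = dihedral_refl W r1 r2; D = inversions w \<inter> P in
      (\<forall>i\<in>I. \<forall>j\<in>I. index_less i j \<longrightarrow> omega cs (root_of (u i)) (root_of (u j)) > 0) \<and>
        (D = {} \<or> D = {r2} \<or> (\<exists>k. Fin k \<in> I \<and> D = (u \<circ> Fin) ` {1..k}))
      \<or>
      (\<forall>i\<in>I. \<forall>j\<in>I. omega cs (root_of (u i)) (root_of (u j)) = 0) \<and>
        (D = {} \<or> is_singleton D)))"

definition c_aligned :: "'a list \<Rightarrow> 'a \<Rightarrow> bool"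
  where "c_aligned cs w \<longleftrightarrow>
    (\<forall>P. rank_two_parabolic P \<and> noncommutative P \<longrightarrow> aligned_wrt cs w P)"

end

end

theory Submission
  imports Defs
begin

text \<open>
  Both directions run along the recursion of sortability: for \<open>s\<close> initial in \<open>c\<close>, an element \<open>w\<close>
  with \<open>s w < w\<close> is \<open>c\<close>-sortable iff \<open>s w\<close> is \<open>s c s\<close>-sortable, and otherwise iff \<open>w\<close> lies in the
  parabolic subgroup omitting \<open>s\<close> and is sortable for the restriction of \<open>c\<close>. To avoid passing to
  parabolic subgroups as Coxeter systems of their own, words \<open>cs\<close> on subsets of \<open>S\<close> are allowed
  throughout. Alignment obeys the same recursion because \<open>\<omega>\<^sub>c(\<beta>, \<beta>') = \<omega>\<^bsub>scs\<^esub>(s \<beta>, s \<beta>')\<close>, while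
  \<open>\<omega>\<^sub>c(\<alpha>\<^sub>s, \<beta>) \<ge> 0\<close> forces \<open>s\<close> to be the first reflection of any \<open>W'\<close> that contains it. The delicate
  point is that an aligned \<open>w\<close> with \<open>s w > w\<close> omits \<open>s\<close>: the reflections of the sorting word of its
  maximal prefix omitting \<open>s\<close> are ordered compatibly with \<open>\<omega>\<^sub>c\<close>, and following the image of \<open>\<alpha>\<^sub>s\<close>
  along this word shows that \<open>s\<close> cannot come next.

  In a generalized rank two parabolic subgroup with canonical roots \<open>\<beta>\<^sub>1, \<beta>\<^sub>2\<close> the coordinates of the
  other roots are values of Chebyshev polynomials. As every root is positive or negative, these values
  stay positive up to the order of \<open>r\<^sub>1 r\<^sub>2\<close>, so that all signs of \<open>\<omega>\<^sub>c\<close> on such a subgroup are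
  determined by the sign of \<open>\<omega>\<^sub>c(\<beta>\<^sub>1, \<beta>\<^sub>2)\<close>.
\<close>

text \<open>The two directions have different scope. Sortable implies aligned is proved for all flat
  subgroups at once, since conjugation by \<open>s\<close> and dropping a letter never leave that
  class; the claim on generalized subgroups is then included. The converse may test \<open>w\<close>
  only on rank two parabolic subgroups, so each subgroup it uses must be a conjugate of a standard
  one. This is why it follows \<alpha>_s through prefixes \<open>x\<close> of a reduced word:
  \<open>x\<close> keeps \<alpha>_a (for the next letter \<open>a\<close>) and \<alpha>_s positive,
  so their images are canonical. It also needs the root order of a sortable element, but only for
  the prefix omitting \<open>s\<close>, which is sortable by induction. The three inductions on
  sortability use \<open>cox_length w + length cs\<close>: a descent shortens \<open>w\<close> and
  rotates \<open>cs\<close>, any other step loses a letter of \<open>cs\<close>. As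
  \<open>cs\<close> may miss letters of \<open>S\<close>, alignment is tested only on subgroups
  whose canonical roots are supported on \<open>set cs\<close>. That roots have a sign and that the
  action is faithful is not part of a root datum; both are derived from the presentation by letting
  words act and checking the relators.\<close>

abbreviation coord :: "('a \<Rightarrow>\<^sub>0 real) \<Rightarrow> 'a \<Rightarrow> real"
  where "coord \<equiv> Poly_Mapping.lookup"

lemma lookup_scaleR [simp]:
  "coord (r *\<^sub>R x) i = r * coord x i" for x :: "'a \<Rightarrow>\<^sub>0 real"
proof -
  have "finite {i. r *\<^sub>R coord x i \<noteq> 0}"
    by (rule finite_subset[OF _ finite_lookup[of x]]) auto
  then show ?thesis
    by (simp add: scaleR_poly_mapping_def Abs_poly_mapping_inverse)
qed

section \<open>Words and length\<close>

lemma word_prod_Nil [simp]: "word_prod W [] = \<one>\<^bsub>W\<^esub>"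
  by (simp add: word_prod_def)

lemma word_prod_Cons [simp]: "word_prod W (x # xs) = x \<otimes>\<^bsub>W\<^esub> word_prod W xs"
  by (simp add: word_prod_def)

text \<open>Indexed by the last letter, because these words are peeled off from the right end of a
  group element; the first letter then depends on the parity of the length.\<close>

fun alternating :: "'a \<Rightarrow> 'a \<Rightarrow> nat \<Rightarrow> 'a list" where
  "alternating r s 0 = []"
| "alternating r s (Suc k) = alternating s r k @ [r]"

lemma alternating_Suc_Cons:
  "alternating r s (Suc k) = (if even k then r else s) # alternating r s k"
proof (induction k arbitrary: r s)
  case (Suc k)
  have "alternating r s (Suc (Suc k)) = alternating s r (Suc k) @ [r]"
    by simp
  also have "alternating s r (Suc k) = (if even k then s else r) # alternating s r k"
    by (rule Suc)
  finally show ?case by simp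
qed simp

lemma length_alternating [simp]: "length (alternating r s k) = k"
  by (induction k arbitrary: r s) auto

lemma set_alternating: "set (alternating r s k) \<subseteq> {r, s}"
  by (induction k arbitrary: r s) auto

lemma alternating_double: "alternating s r (2 * m) = concat (replicate m [r, s])"
  by (induction m) (auto simp: alternating_Suc_Cons simp del: alternating.simps(2))

lemma rev_alternating:
  "rev (alternating r s k) = (if odd k then alternating r s k else alternating s r k)"
proof (induction k arbitrary: r s)
  case (Suc k)
  have "rev (alternating r s (Suc k)) = r # rev (alternating s r k)"
    by simp
  then show ?case
    unfolding Suc alternating_Suc_Cons by simp
qed simp

lemma alternating_add:
  "alternating r s (i + j) = (if even j then alternating r s i else alternating s r i) @ alternating r s j"
  by (induction j arbitrary: r s) auto


text \<open>The Chebyshev polynomials of the second kind \<open>U\<^bsub>k-1\<^esub> (\<kappa>/2)\<close>.\<close>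

fun cheb :: "real \<Rightarrow> nat \<Rightarrow> real" where
  "cheb \<kappa> 0 = 0"
| "cheb \<kappa> (Suc 0) = 1"
| "cheb \<kappa> (Suc (Suc k)) = \<kappa> * cheb \<kappa> (Suc k) - cheb \<kappa> k"

text \<open>An addition theorem, needed to compare a root counted from one end of an infinite
  dihedral subgroup with a root counted from the other end.\<close>

lemma cheb_add: "cheb \<kappa> (Suc (i + j)) = cheb \<kappa> (Suc i) * cheb \<kappa> (Suc j) - cheb \<kappa> i * cheb \<kappa> j"
proof (induction i rule: induct_nat_012)
  case (ge2 n)
  have "cheb \<kappa> (Suc (Suc (Suc n) + j)) = \<kappa> * cheb \<kappa> (Suc (Suc n + j)) - cheb \<kappa> (Suc (n + j))"
    by simp
  also have "\<dots> = \<kappa> * (cheb \<kappa> (Suc (Suc n)) * cheb \<kappa> (Suc j) - cheb \<kappa> (Suc n) * cheb \<kappa> j) -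
      (cheb \<kappa> (Suc n) * cheb \<kappa> (Suc j) - cheb \<kappa> n * cheb \<kappa> j)"
    unfolding ge2 ..
  finally show ?case by (simp add: algebra_simps)
qed simp_all

text \<open>The recursion has a transfer matrix of determinant 1, so this determinant of two shifted
  solutions is independent of \<open>i\<close>; its value is read off at
  \<open>i = 0\<close>.\<close>

lemma cheb_det: "cheb \<kappa> (Suc i) * cheb \<kappa> (i + d) - cheb \<kappa> (Suc (i + d)) * cheb \<kappa> i = cheb \<kappa> d"
proof (induction i)
  case (Suc i)
  then show ?case by (simp add: algebra_simps)
qed simp

text \<open>Multiplied out, so that no case is lost where the sine vanishes. At
  \<open>x = pi / m\<close> with \<open>m \<ge> 2\<close> it shows that the values are nonnegative
  up to index \<open>m\<close> and vanish there.\<close>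

lemma cheb_cos: "sin x * cheb (2 * cos x) k = sin (real k * x)"
proof (induction k rule: induct_nat_012)
  case (ge2 n)
  have "sin (real (Suc (Suc n)) * x) = 2 * cos x * sin (real (Suc n) * x) - sin (real n * x)"
  proof -
    have a: "real (Suc (Suc n)) * x = real (Suc n) * x + x" "real n * x = real (Suc n) * x - x"
      by (simp_all add: algebra_simps)
    show ?thesis unfolding a sin_add sin_diff by simp
  qed
  moreover have "sin x * cheb (2 * cos x) (Suc (Suc n)) =
      2 * cos x * (sin x * cheb (2 * cos x) (Suc n)) - sin x * cheb (2 * cos x) n"
    by (simp add: algebra_simps)
  ultimately show ?case using ge2 by simp
qed simp_all

text \<open>Serves the pairs of infinite order, for which \<open>kappa\<close> is at least
  2.\<close>

lemma cheb_mono: "\<kappa> \<ge> 2 \<Longrightarrow> 0 \<le> cheb \<kappa> k \<and> cheb \<kappa> k \<le> cheb \<kappa> (Suc k)"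
proof (induction k)
  case (Suc k)
  then have "2 * cheb \<kappa> (Suc k) \<le> \<kappa> * cheb \<kappa> (Suc k)"
    by (intro mult_right_mono) auto
  then show ?case using Suc by simp
qed simp

section \<open>Words, length and parity in a Coxeter group\<close>

context coxeter_system
begin

lemma S_closed: "s \<in> S \<Longrightarrow> s \<in> carrier W"
  using S_subset by blast

lemma simple_sq: "s \<in> S \<Longrightarrow> s \<otimes> s = \<one>"
  using involution by blast

lemma inv_simple: "s \<in> S \<Longrightarrow> inv s = s"
  by (simp add: S_closed inv_equality simple_sq)

lemma lists_S_closed: "xs \<in> lists S \<Longrightarrow> set xs \<subseteq> carrier W"
  using S_closed by auto

lemma word_prod_closed: "set xs \<subseteq> carrier W \<Longrightarrow> word_prod W xs \<in> carrier W"
  by (induction xs) auto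

lemma word_prod_S_closed [simp]: "xs \<in> lists S \<Longrightarrow> word_prod W xs \<in> carrier W"
  using word_prod_closed lists_S_closed by blast

lemma word_prod_append:
  "set xs \<subseteq> carrier W \<Longrightarrow> set ys \<subseteq> carrier W \<Longrightarrow>
    word_prod W (xs @ ys) = word_prod W xs \<otimes> word_prod W ys"
  by (induction xs) (auto simp: m_assoc word_prod_closed)

lemma word_prod_append_S:
  "xs \<in> lists S \<Longrightarrow> ys \<in> lists S \<Longrightarrow>
    word_prod W (xs @ ys) = word_prod W xs \<otimes> word_prod W ys"
  by (simp add: word_prod_append lists_S_closed)

lemma inv_word_prod: "xs \<in> lists S \<Longrightarrow> inv (word_prod W xs) = word_prod W (rev xs)"
proof (induction xs)
  case (Cons a xs)
  then have "word_prod W (rev xs @ [a]) = word_prod W (rev xs) \<otimes> a"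
    using word_prod_append_S[of "rev xs" "[a]"] S_closed by (auto simp: in_lists_conv_set)
  then show ?case
    using Cons by (simp add: inv_mult_group S_closed inv_simple)
qed simp

lemma simple_cancel [simp]:
  "s \<in> S \<Longrightarrow> x \<in> carrier W \<Longrightarrow> s \<otimes> (s \<otimes> x) = x"
  "s \<in> S \<Longrightarrow> x \<in> carrier W \<Longrightarrow> x \<otimes> s \<otimes> s = x"
  by (metis S_closed l_one m_assoc simple_sq) (simp add: S_closed simple_sq m_assoc)

lemma exists_word:
  assumes "w \<in> carrier W" shows "\<exists>xs \<in> lists S. word_prod W xs = w"
proof -
  have "w \<in> generate W S" using assms generated by simp
  then show ?thesis
  proof induction
    case one show ?case by (rule bexI[of _ "[]"]) auto
  next
    case (incl h) then show ?case using S_closed by (intro bexI[of _ "[h]"]) auto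
  next
    case (inv h) then show ?case using S_closed inv_simple by (intro bexI[of _ "[h]"]) auto
  next
    case (eng h1 h2)
    then obtain xs ys where "xs \<in> lists S" "word_prod W xs = h1" "ys \<in> lists S" "word_prod W ys = h2"
      by blast
    then show ?case by (intro bexI[of _ "xs @ ys"]) (auto simp: word_prod_append_S)
  qed
qed

lemma cox_length_le: "xs \<in> lists S \<Longrightarrow> cox_length (word_prod W xs) \<le> length xs"
  unfolding cox_length_def by (rule Least_le) blast

lemma exists_reduced:
  assumes "w \<in> carrier W" shows "\<exists>xs. reduced_word w xs"
proof -
  have "\<exists>n. \<exists>ws \<in> lists S. length ws = n \<and> word_prod W ws = w"
    using exists_word[OF assms] by blast
  from LeastI_ex[OF this] show ?thesis
    unfolding reduced_word_def cox_length_def by blast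
qed

text \<open>All relators have even length, so the presentation yields a sign character. It prevents
  multiplication by a simple reflection from preserving the length.\<close>

lemma coxeter_equiv_parity: "coxeter_equiv W S xs ys \<Longrightarrow> even (length xs) \<longleftrightarrow> even (length ys)"
proof (induction rule: coxeter_equiv.induct)
  case (rel s t xs ys)
  have "length (concat (replicate n [s, t])) = 2 * n" for n
    by (induction n) auto
  then show ?case by simp
qed auto

lemma length_parity:
  assumes "xs \<in> lists S" shows "even (cox_length (word_prod W xs)) \<longleftrightarrow> even (length xs)"
proof -
  obtain ys where "reduced_word (word_prod W xs) ys"
    using exists_reduced[OF word_prod_S_closed[OF assms]] by blast
  then have "ys \<in> lists S" "word_prod W xs = word_prod W ys" "length ys = cox_length (word_prod W xs)"
    by (simp_all add: reduced_word_def)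
  then show ?thesis
    using coxeter_equiv_parity[OF presented[OF assms]] by metis
qed

lemma cox_length_mult:
  assumes "x \<in> carrier W" "y \<in> carrier W"
  shows "cox_length (x \<otimes> y) \<le> cox_length x + cox_length y"
proof -
  obtain xs ys where "reduced_word x xs" "reduced_word y ys"
    using exists_reduced assms by blast
  then show ?thesis
    using cox_length_le[of "xs @ ys"] by (auto simp: reduced_word_def word_prod_append_S)
qed

lemma cox_length_one [simp]: "cox_length \<one> = 0"
  using cox_length_le[of "[]"] by simp

lemma cox_length_simple_le: "s \<in> S \<Longrightarrow> cox_length s \<le> 1"
  using cox_length_le[of "[s]"] by (simp add: S_closed)

lemma parity_mult_simple:
  assumes "w \<in> carrier W" "s \<in> S"
  shows "even (cox_length (w \<otimes> s)) \<longleftrightarrow> odd (cox_length w)"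
    and "even (cox_length (s \<otimes> w)) \<longleftrightarrow> odd (cox_length w)"
proof -
  obtain xs where xs: "xs \<in> lists S" "word_prod W xs = w"
    using exists_word assms by blast
  show "even (cox_length (w \<otimes> s)) \<longleftrightarrow> odd (cox_length w)"
    using length_parity[of "xs @ [s]"] length_parity[of xs] xs assms
    by (simp add: word_prod_append_S S_closed)
  show "even (cox_length (s \<otimes> w)) \<longleftrightarrow> odd (cox_length w)"
    using length_parity[of "s # xs"] length_parity[of xs] xs assms by simp
qed

lemma cox_length_mult_simple:
  assumes "w \<in> carrier W" "s \<in> S"
  shows "cox_length (w \<otimes> s) = Suc (cox_length w) \<or> Suc (cox_length (w \<otimes> s)) = cox_length w"
proof -
  have "cox_length (w \<otimes> s) \<le> cox_length w + 1"
    using cox_length_mult[of w s] cox_length_simple_le[of s] assms S_closed by fastforce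
  moreover have "cox_length w \<le> cox_length (w \<otimes> s) + 1"
    using cox_length_mult[of "w \<otimes> s" s] cox_length_simple_le[of s] assms S_closed by fastforce
  moreover have "cox_length (w \<otimes> s) \<noteq> cox_length w"
    using parity_mult_simple(1)[OF assms] by metis
  ultimately show ?thesis by linarith
qed

lemma cox_length_simple_mult:
  assumes "w \<in> carrier W" "s \<in> S"
  shows "cox_length (s \<otimes> w) = Suc (cox_length w) \<or> Suc (cox_length (s \<otimes> w)) = cox_length w"
proof -
  have "cox_length (s \<otimes> w) \<le> cox_length w + 1"
    using cox_length_mult[of s w] cox_length_simple_le[of s] assms S_closed by fastforce
  moreover have "cox_length w \<le> cox_length (s \<otimes> w) + 1"
    using cox_length_mult[of s "s \<otimes> w"] cox_length_simple_le[of s] assms S_closed by fastforce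
  moreover have "cox_length (s \<otimes> w) \<noteq> cox_length w"
    using parity_mult_simple(2)[OF assms] by metis
  ultimately show ?thesis by linarith
qed

lemma alternating_lists: "r \<in> S \<Longrightarrow> s \<in> S \<Longrightarrow> alternating r s k \<in> lists S"
  using set_alternating[of r s k] by auto

lemma word_prod_replicate:
  "r \<in> S \<Longrightarrow> s \<in> S \<Longrightarrow> word_prod W (concat (replicate n [r, s])) = (r \<otimes> s) [^] n"
proof (induction n)
  case (Suc n)
  then have "(r \<otimes> s) [^] Suc n = (r \<otimes> s) \<otimes> (r \<otimes> s) [^] n"
    using S_closed by (intro nat_pow_Suc2) auto
  with Suc show ?case by (simp add: S_closed m_assoc del: nat_pow_Suc)
qed simp

lemma ord_simple_ge_2:
  assumes "r \<in> S" "s \<in> S" "r \<noteq> s" "ord (r \<otimes> s) \<noteq> 0"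
  shows "ord (r \<otimes> s) \<ge> 2"
proof -
  have "r \<otimes> s \<noteq> \<one>"
    using assms inv_simple S_closed inv_equality by metis
  then have "ord (r \<otimes> s) \<noteq> 1"
    using assms S_closed ord_eq_1 by simp
  then show ?thesis using assms by linarith
qed

text \<open>The alternating word of length \<open>2 * m\<close> has trivial product; cut it into
  halves and use that the inverse of a half is its reversal. At infinite order \<open>m = 0\<close>
  and both words are empty.\<close>

lemma braid:
  assumes "r \<in> S" "s \<in> S" "ord (r \<otimes> s) = m"
  shows "word_prod W (alternating r s m) = word_prod W (alternating s r m)"
proof -
  have "word_prod W (alternating s r (m + m)) = (r \<otimes> s) [^] m"
    using alternating_double[of s r m] word_prod_replicate[of r s m] assms by (simp add: mult_2)
  also have "\<dots> = \<one>"
    using assms S_closed by auto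
  finally have 1: "word_prod W (alternating s r (m + m)) = \<one>" .
  \<comment> \<open>The first half of the word of length \<open>m + m\<close>. The parity decides
    its last letter so that its reversal is \<open>alternating r s m\<close> in both cases.\<close>
  define x where "x = (if even m then alternating s r m else alternating r s m)"
  have x: "x \<in> lists S" unfolding x_def using alternating_lists assms by auto
  have "word_prod W x \<otimes> word_prod W (alternating s r m) = \<one>"
    using 1 assms alternating_lists x unfolding alternating_add
    by (subst word_prod_append_S[symmetric]) (auto simp: x_def)
  then have "word_prod W (alternating s r m) = inv (word_prod W x)"
    using x assms alternating_lists by (metis inv_comm inv_equality word_prod_S_closed)
  also have "\<dots> = word_prod W (rev x)"
    by (rule inv_word_prod[OF x])
  also have "rev x = alternating r s m"
    by (simp add: x_def rev_alternating)
  finally show ?thesis by simp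
qed

end

section \<open>The geometric representation\<close>

context coxeter_root_datum
begin

text \<open>The simple coroot of \<open>s\<close> as a linear functional.\<close>

definition pairing :: "'a \<Rightarrow> ('a \<Rightarrow>\<^sub>0 real) \<Rightarrow> real"
  where "pairing s v = (\<Sum>s'\<in>S. A s s' * coord v s')"

lemma simple_act_pairing: "simple_act s v = v - pairing s v *\<^sub>R simple_root s"
  by (simp add: simple_act_def pairing_def)

lemma pairing_linear: "linear (pairing s)"
  by (rule linearI)
    (simp_all add: pairing_def lookup_add algebra_simps sum.distrib sum_distrib_left)

lemma pairing_simple_root: "s \<in> S \<Longrightarrow> t \<in> S \<Longrightarrow> pairing s (simple_root t) = A s t"
  using finite_S
  by (simp add: pairing_def simple_root_def lookup_single when_def if_distrib[of "(*) _"]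
      sum.delta cong: if_cong)

lemma simple_act_linear: "linear (simple_act s)"
  unfolding simple_act_pairing
  using pairing_linear[of s]
  by (auto intro!: linearI simp: linear_add linear_scale algebra_simps)

lemma word_act_Nil [simp]: "word_act [] v = v"
  by (simp add: word_act_def)

lemma word_act_Cons [simp]: "word_act (a # xs) v = simple_act a (word_act xs v)"
  by (simp add: word_act_def)

lemma word_act_append: "word_act (xs @ ys) v = word_act xs (word_act ys v)"
  by (simp add: word_act_def)

lemma word_act_linear: "linear (word_act xs)"
proof (induction xs)
  case (Cons a xs)
  have "word_act (a # xs) = simple_act a \<circ> word_act xs" by auto
  then show ?case using Cons simple_act_linear linear_compose by metis
qed (auto simp: linear_iff)

lemma simple_act_root: "s \<in> S \<Longrightarrow> t \<in> S \<Longrightarrow>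
    simple_act s (simple_root t) = simple_root t - A s t *\<^sub>R simple_root s"
  by (simp add: simple_act_pairing pairing_simple_root)

lemma simple_act_self: "s \<in> S \<Longrightarrow> simple_act s (simple_root s) = - simple_root s"
  by (simp add: simple_act_root A_diag scaleR_2)

lemma simple_act_invol: "s \<in> S \<Longrightarrow> simple_act s (simple_act s v) = v"
proof -
  assume s: "s \<in> S"
  have "pairing s (simple_act s v) = - pairing s v"
    using s by (simp add: simple_act_pairing linear_diff[OF pairing_linear]
        linear_scale[OF pairing_linear] pairing_simple_root A_diag)
  then show ?thesis by (simp add: simple_act_pairing[of s "simple_act s v"]) (simp add: simple_act_pairing)
qed

text \<open>
  With respect to this scaling the non-symmetric action of a dihedral parabolic subgroup becomes
  symmetric in its two generators.
\<close>

definition unit_root :: "'a \<Rightarrow> ('a \<Rightarrow>\<^sub>0 real)"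
  where "unit_root s = (1 / sqrt (\<delta> s)) *\<^sub>R simple_root s"

text \<open>For distinct simple reflections this is the nonnegative square root of
  \<open>A r s * A s r\<close>, hence \<open>2 * cos (pi / m)\<close> at finite order
  \<open>m\<close> and at least 2 at infinite order.\<close>

definition kappa :: "'a \<Rightarrow> 'a \<Rightarrow> real"
  where "kappa r s = - K_simple r s / (sqrt (\<delta> r) * sqrt (\<delta> s))"

lemma K_simple_sym: "r \<in> S \<Longrightarrow> s \<in> S \<Longrightarrow> K_simple r s = K_simple s r"
  by (simp add: K_simple_def symmetrizable)

lemma kappa_sym: "r \<in> S \<Longrightarrow> s \<in> S \<Longrightarrow> kappa r s = kappa s r"
  by (simp add: kappa_def K_simple_sym mult.commute)

lemma kappa_nonneg: "r \<in> S \<Longrightarrow> s \<in> S \<Longrightarrow> r \<noteq> s \<Longrightarrow> kappa r s \<ge> 0"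
  using A_nonpos[of r s] \<delta>_pos[of r] \<delta>_pos[of s]
  by (auto simp: kappa_def K_simple_def divide_nonpos_nonneg mult_nonneg_nonpos)

lemma kappa_sq:
  assumes "r \<in> S" "s \<in> S" shows "(kappa r s)\<^sup>2 = A r s * A s r"
proof -
  have "sqrt (\<delta> r) * sqrt (\<delta> s) * (sqrt (\<delta> r) * sqrt (\<delta> s)) =
      (sqrt (\<delta> r) * sqrt (\<delta> r)) * (sqrt (\<delta> s) * sqrt (\<delta> s))"
    by (simp only: ac_simps)
  also have "\<dots> = \<delta> r * \<delta> s" using \<delta>_pos[of r] \<delta>_pos[of s] assms by simp
  finally have "(kappa r s)\<^sup>2 = K_simple r s * K_simple s r / (\<delta> r * \<delta> s)"
    using K_simple_sym[OF assms]
    by (simp add: kappa_def power2_eq_square less_imp_le)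
  then show ?thesis
    using \<delta>_pos[of r] \<delta>_pos[of s] assms by (simp add: K_simple_def)
qed

lemma simple_act_unit_self: "s \<in> S \<Longrightarrow> simple_act s (unit_root s) = - unit_root s"
  using simple_act_linear[of s] by (simp add: unit_root_def linear_scale simple_act_self)

lemma simple_act_unit:
  assumes "r \<in> S" "s \<in> S"
  shows "simple_act r (unit_root s) = unit_root s + kappa r s *\<^sub>R unit_root r"
proof -
  have "kappa r s / sqrt (\<delta> r) = - (A r s / sqrt (\<delta> s))"
  proof -
    have "\<delta> r = sqrt (\<delta> r) * sqrt (\<delta> r)" "sqrt (\<delta> r) \<noteq> 0"
      using \<delta>_pos[of r] assms by auto
    then show ?thesis
      unfolding kappa_def K_simple_def by (simp add: divide_simps)
  qed
  then show ?thesis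
    using simple_act_linear[of r] assms
    by (simp add: unit_root_def linear_scale simple_act_root algebra_simps)
qed

text \<open>One more letter replaces the coefficient pair \<open>(p, q)\<close> by
  \<open>(kappa r s * p - q, p)\<close>, which is the recursion of \<open>cheb\<close>.\<close>

lemma alternating_act:
  assumes "r \<in> S" "s \<in> S"
  shows "word_act (alternating r s k) (unit_root s) =
    (if even k then cheb (kappa r s) (Suc k) *\<^sub>R unit_root s + cheb (kappa r s) k *\<^sub>R unit_root r
     else cheb (kappa r s) (Suc k) *\<^sub>R unit_root r + cheb (kappa r s) k *\<^sub>R unit_root s)"
proof (induction k)
  case (Suc k)
  then show ?case
    using assms simple_act_linear[of r] simple_act_linear[of s] kappa_sym[of r s]
      simple_act_unit[of r s] simple_act_unit[of s r]
    by (auto simp: alternating_Suc_Cons linear_add linear_scale simple_act_unit_self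
        algebra_simps simp del: alternating.simps(2))
qed simp

lemma kappa_finite:
  assumes "r \<in> S" "s \<in> S" "r \<noteq> s" "ord (r \<otimes> s) \<noteq> 0"
  shows "kappa r s = 2 * cos (pi / real (ord (r \<otimes> s)))"
proof -
  let ?x = "pi / real (ord (r \<otimes> s))"
  have "0 \<le> ?x" "?x \<le> pi / 2"
    using ord_simple_ge_2[OF assms] by (auto simp: field_simps)
  then have "cos ?x \<ge> 0" using cos_ge_zero[of ?x] pi_gt_zero by linarith
  moreover have "(kappa r s)\<^sup>2 = (2 * cos ?x)\<^sup>2"
    using kappa_sq A_finite assms by (simp add: power2_eq_square)
  ultimately show ?thesis
    using kappa_nonneg[OF assms(1-3)] power2_eq_iff_nonneg \<open>cos ?x \<ge> 0\<close>
    by (metis mult_nonneg_nonneg zero_le_numeral)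
qed

lemma kappa_infinite:
  assumes "r \<in> S" "s \<in> S" "r \<noteq> s" "ord (r \<otimes> s) = 0"
  shows "kappa r s \<ge> 2"
proof -
  have "(kappa r s)\<^sup>2 \<ge> 2\<^sup>2"
    using kappa_sq A_infinite assms by simp
  then show ?thesis
    using kappa_nonneg[OF assms(1-3)] power2_le_imp_le by blast
qed

lemma sin_pi_ord_pos:
  assumes "r \<in> S" "s \<in> S" "r \<noteq> s" "ord (r \<otimes> s) \<noteq> 0"
  shows "sin (pi / real (ord (r \<otimes> s))) > 0"
  using ord_simple_ge_2[OF assms] by (intro sin_gt_zero) (auto simp: field_simps)

lemma cheb_kappa_nonneg:
  assumes "r \<in> S" "s \<in> S" "r \<noteq> s" "ord (r \<otimes> s) = 0 \<or> k \<le> ord (r \<otimes> s)"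
  shows "cheb (kappa r s) k \<ge> 0"
proof (cases "ord (r \<otimes> s) = 0")
  case True
  then show ?thesis using cheb_mono kappa_infinite assms by blast
next
  case False
  let ?x = "pi / real (ord (r \<otimes> s))"
  have "sin (real k * ?x) \<ge> 0"
    using assms False by (intro sin_ge_zero) (auto simp: field_simps)
  then show ?thesis
    using cheb_cos[of ?x k] sin_pi_ord_pos[OF assms(1-3) False] kappa_finite[OF assms(1-3) False]
    by (metis mult_le_cancel_left_pos mult_zero_right)
qed

text \<open>The relator fixes the plane of the two simple roots, where it is a full turn, and every
  vector on which both coroots vanish. At finite order the plane is nondegenerate, so each vector is
  a sum of two such vectors.\<close>

lemma relator_act:
  assumes "r \<in> S" "s \<in> S"
  shows "word_act (concat (replicate (ord (r \<otimes> s)) [r, s])) v = v"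
proof (cases "r = s \<or> ord (r \<otimes> s) = 0")
  case True
  then show ?thesis
    using assms by (auto simp: simple_sq simple_act_invol)
next
  case False
  define m where "m = ord (r \<otimes> s)"
  define x where "x = pi / real m"
  define F where "F = word_act (concat (replicate m [r, s]))"
  have m: "m \<ge> 2" using ord_simple_ge_2 False assms m_def by auto
  have sin: "sin x > 0" using sin_pi_ord_pos False assms by (auto simp: x_def m_def)
  have kap: "kappa r s = 2 * cos x" using kappa_finite False assms by (simp add: x_def m_def)
  have mx: "real m * x = pi" using m by (simp add: x_def)
  have c: "cheb (kappa r s) k = sin (real k * x) / sin x" for k
    using cheb_cos[of x k] sin kap by (simp add: field_simps)
  have e: "real (Suc (2 * m)) * x = 2 * pi + x" "real (2 * m) * x = 2 * pi"
    "real (2 * m - 1) * x = 2 * pi - x"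
    using mx m by (simp_all add: algebra_simps of_nat_diff)
  have ch: "cheb (kappa r s) (Suc (2 * m)) = 1" "cheb (kappa r s) (2 * m) = 0"
    "cheb (kappa r s) (2 * m - 1) = -1"
    unfolding c e using sin by (simp_all add: sin_add sin_diff)
  have Fr: "F (unit_root r) = unit_root r"
    using alternating_act[of s r "2 * m"] assms ch kappa_sym[of r s]
    by (simp add: F_def alternating_double)
  \<comment> \<open>The rightmost letter \<open>s\<close> merely negates \<open>unit_root s\<close>,
    so one letter fewer has to be evaluated by \<open>alternating_act\<close>.\<close>
  have "alternating s r (2 * m) = alternating r s (2 * m - 1) @ [s]"
    using m by (cases "2 * m") auto
  then have "F (unit_root s) = - word_act (alternating r s (2 * m - 1)) (unit_root s)"
    using assms linear_neg[OF word_act_linear]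
    by (simp add: F_def word_act_append simple_act_unit_self flip: alternating_double)
  moreover have "odd (2 * m - 1)" "Suc (2 * m - 1) = 2 * m" using m by auto
  ultimately have Fs: "F (unit_root s) = unit_root s"
    using alternating_act[of r s "2 * m - 1"] assms ch by simp
  have Flin: "linear F" by (simp add: F_def word_act_linear)
  have \<alpha>: "simple_root t = sqrt (\<delta> t) *\<^sub>R unit_root t" if "t \<in> S" for t
    using \<delta>_pos[OF that] by (simp add: unit_root_def)
  have FU: "F (p *\<^sub>R simple_root r + q *\<^sub>R simple_root s) = p *\<^sub>R simple_root r + q *\<^sub>R simple_root s" for p q
    using Flin Fr Fs assms by (simp add: \<alpha> linear_add linear_scale)
  \<comment> \<open>Cramer's rule: \<open>p\<close> and \<open>q\<close> below are chosen such that
    \<open>u\<close> in the plane has the same two pairings as \<open>v\<close>. The determinant is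
    \<open>D = 4 * (sin x)\<^sup>2\<close>.\<close>
  define D where "D = 4 - A r s * A s r"
  have "A r s * A s r = 4 * (cos x)\<^sup>2"
    using A_finite assms False by (simp add: x_def m_def)
  then have D: "D > 0" using sin by (simp add: D_def cos_squared_eq)
  define p where "p = (2 * pairing r v - A r s * pairing s v) / D"
  define q where "q = (2 * pairing s v - A s r * pairing r v) / D"
  define u where "u = p *\<^sub>R simple_root r + q *\<^sub>R simple_root s"
  have ur: "pairing r u = pairing r v"
  proof -
    have "pairing r u = 2 * p + A r s * q"
      using assms by (simp add: u_def linear_add[OF pairing_linear] linear_scale[OF pairing_linear]
          pairing_simple_root A_diag)
    also have "\<dots> = (4 - A r s * A s r) * pairing r v / D"
      using D by (simp add: p_def q_def field_simps)
    finally show ?thesis using D by (simp add: D_def)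
  qed
  have us: "pairing s u = pairing s v"
  proof -
    have "pairing s u = A s r * p + 2 * q"
      using assms by (simp add: u_def linear_add[OF pairing_linear] linear_scale[OF pairing_linear]
          pairing_simple_root A_diag)
    also have "\<dots> = (4 - A r s * A s r) * pairing s v / D"
      using D by (simp add: p_def q_def field_simps)
    finally show ?thesis using D by (simp add: D_def)
  qed
  have "simple_act r (v - u) = v - u" "simple_act s (v - u) = v - u"
    using ur us by (simp_all add: simple_act_pairing linear_diff[OF pairing_linear])
  then have "word_act (concat (replicate n [r, s])) (v - u) = v - u" for n
    by (induction n) auto
  then have "F (v - u) = v - u" by (simp add: F_def)
  moreover have "F u = u" using FU by (simp add: u_def)
  ultimately have "F v = v"
    using linear_diff[OF Flin, of v u] by simp
  then show ?thesis by (simp add: F_def m_def)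
qed

lemma coxeter_equiv_act: "coxeter_equiv W S xs ys \<Longrightarrow> word_act xs v = word_act ys v"
proof (induction arbitrary: v rule: coxeter_equiv.induct)
  case (rel s t xs ys)
  then show ?case by (simp add: word_act_append relator_act)
qed auto

definition act :: "'a \<Rightarrow> ('a \<Rightarrow>\<^sub>0 real) \<Rightarrow> ('a \<Rightarrow>\<^sub>0 real)"
  where "act w = word_act (SOME xs. xs \<in> lists S \<and> word_prod W xs = w)"

text \<open>Well-definedness of the action: words with equal product are linked by relators, and
  relators act trivially.\<close>

lemma act_word:
  assumes "xs \<in> lists S" shows "act (word_prod W xs) = word_act xs"
proof -
  define ys where "ys = (SOME ys. ys \<in> lists S \<and> word_prod W ys = word_prod W xs)"
  have "ys \<in> lists S \<and> word_prod W ys = word_prod W xs"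
    unfolding ys_def by (rule someI[of _ xs]) (simp add: assms)
  then have "coxeter_equiv W S ys xs" using presented assms by blast
  then show ?thesis
    using coxeter_equiv_act by (auto simp: act_def ys_def)
qed

lemma act_linear: "linear (act w)"
  by (simp add: act_def word_act_linear)

lemma act_one [simp]: "act \<one> v = v"
  using act_word[of "[]"] by simp

lemma act_simple: "s \<in> S \<Longrightarrow> act s = simple_act s"
  using act_word[of "[s]"] by (auto simp: S_closed)

lemma act_mult:
  assumes "x \<in> carrier W" "y \<in> carrier W" shows "act (x \<otimes> y) v = act x (act y v)"
proof -
  obtain xs ys where "xs \<in> lists S" "word_prod W xs = x" "ys \<in> lists S" "word_prod W ys = y"
    using exists_word assms by meson
  then show ?thesis
    using act_word[of "xs @ ys"] act_word[of xs] act_word[of ys]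
    by (auto simp: word_prod_append_S word_act_append)
qed

lemma act_inv [simp]:
  assumes "x \<in> carrier W" shows "act x (act (inv x) v) = v" "act (inv x) (act x v) = v"
  using assms by (simp_all flip: act_mult)

end

section \<open>Positive roots, reflections and inversions\<close>

definition nonneg :: "('a \<Rightarrow>\<^sub>0 real) \<Rightarrow> bool"
  where "nonneg v \<longleftrightarrow> (\<forall>x. coord v x \<ge> 0)"

definition supported :: "'a set \<Rightarrow> ('a \<Rightarrow>\<^sub>0 real) \<Rightarrow> bool"
  where "supported J v \<longleftrightarrow> (\<forall>x. x \<notin> J \<longrightarrow> coord v x = 0)"

lemma nonneg_add: "nonneg u \<Longrightarrow> nonneg v \<Longrightarrow> nonneg (u + v)"
  by (simp add: nonneg_def lookup_add)

lemma nonneg_scale: "c \<ge> 0 \<Longrightarrow> nonneg v \<Longrightarrow> nonneg (c *\<^sub>R v)"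
  by (simp add: nonneg_def)

lemma nonneg_antisym:
  assumes "nonneg v" "nonneg (- v)" shows "v = 0"
proof (rule poly_mapping_eqI)
  fix k show "coord v k = coord 0 k"
    using assms[unfolded nonneg_def, rule_format, of k] by simp
qed

lemma supported_add: "supported J u \<Longrightarrow> supported J v \<Longrightarrow> supported J (u + v)"
  by (simp add: supported_def lookup_add)

lemma supported_diff: "supported J u \<Longrightarrow> supported J v \<Longrightarrow> supported J (u - v)"
  by (simp add: supported_def lookup_minus)

lemma supported_uminus: "supported J u \<Longrightarrow> supported J (- u)"
  by (simp add: supported_def)

lemma supported_scale: "supported J v \<Longrightarrow> supported J (c *\<^sub>R v)"
  by (simp add: supported_def)

lemma supported_mono: "supported J v \<Longrightarrow> J \<subseteq> K \<Longrightarrow> supported K v"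
  by (auto simp: supported_def)

lemma (in group) inv_cancel [simp]:
  assumes "x \<in> carrier G" "y \<in> carrier G"
  shows "inv x \<otimes> (x \<otimes> y) = y" "x \<otimes> (inv x \<otimes> y) = y"
  using assms by (simp_all flip: m_assoc)

context coxeter_root_datum
begin

lemma lookup_simple_root: "coord (simple_root s) x = (if x = s then 1 else 0)"
  by (simp add: simple_root_def lookup_single when_def)

lemma nonneg_simple_root: "nonneg (simple_root s)"
  by (simp add: nonneg_def lookup_simple_root)

lemma supported_simple_root: "s \<in> J \<Longrightarrow> supported J (simple_root s)"
  by (auto simp: supported_def lookup_simple_root)

text \<open>The form \<open>K\<close> of the root data, expressed through the coroot pairing.
  Symmetry comes from \<open>symmetrizable\<close>.\<close>

definition bil :: "('a \<Rightarrow>\<^sub>0 real) \<Rightarrow> ('a \<Rightarrow>\<^sub>0 real) \<Rightarrow> real"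
  where "bil u v = (\<Sum>s\<in>S. \<delta> s * coord u s * pairing s v)"

lemma bil_sym: "bil u v = bil v u"
proof -
  have "bil u v = (\<Sum>s\<in>S. \<Sum>t\<in>S. \<delta> s * A s t * coord u s * coord v t)"
    by (simp add: bil_def pairing_def sum_distrib_left mult_ac)
  also have "\<dots> = (\<Sum>t\<in>S. \<Sum>s\<in>S. \<delta> s * A s t * coord u s * coord v t)"
    by (rule sum.swap)
  also have "\<dots> = (\<Sum>t\<in>S. \<Sum>s\<in>S. \<delta> t * A t s * coord v t * coord u s)"
  proof (rule sum.cong[OF HOL.refl], rule sum.cong[OF HOL.refl])
    fix t s assume "t \<in> S" "s \<in> S"
    then show "\<delta> s * A s t * coord u s * coord v t =
        \<delta> t * A t s * coord v t * coord u s"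
      by (simp add: symmetrizable[of s t])
  qed
  also have "\<dots> = bil v u"
    by (simp add: bil_def pairing_def sum_distrib_left mult_ac)
  finally show ?thesis .
qed

lemma bil_linear_right: "linear (bil u)"
  by (rule linearI)
    (simp_all add: bil_def linear_add[OF pairing_linear] linear_scale[OF pairing_linear]
      algebra_simps sum.distrib sum_distrib_left)

lemma bil_simps:
  "bil u (v + v') = bil u v + bil u v'" "bil u (v - v') = bil u v - bil u v'"
  "bil u (c *\<^sub>R v) = c * bil u v" "bil u (- v) = - bil u v"
  "bil (u + u') v = bil u v + bil u' v" "bil (u - u') v = bil u v - bil u' v"
  "bil (c *\<^sub>R u) v = c * bil u v" "bil (- u) v = - bil u v" "bil u 0 = 0" "bil 0 v = 0"
  using bil_linear_right[of u] bil_linear_right[of v]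
  by (simp_all add: linear_add linear_diff linear_scale linear_neg linear_0 bil_sym[of _ v])

lemma bil_simple_root: "s \<in> S \<Longrightarrow> bil (simple_root s) v = \<delta> s * pairing s v"
  using finite_S
  by (simp add: bil_def lookup_simple_root if_distrib[of "\<lambda>x. _ * x * _"] sum.delta cong: if_cong)

lemma bil_simple_act:
  assumes "s \<in> S" shows "bil (simple_act s u) (simple_act s v) = bil u v"
  using assms bil_sym[of u "simple_root s"]
  by (simp add: simple_act_pairing bil_simps bil_simple_root pairing_simple_root A_diag
      linear_diff[OF pairing_linear] linear_scale[OF pairing_linear])

lemma exists_word_act:
  assumes "w \<in> carrier W"
  obtains xs where "xs \<in> lists S" "word_prod W xs = w" "act w = word_act xs"
  using exists_word[OF assms] act_word by blast

lemma bil_act: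
  assumes "w \<in> carrier W" shows "bil (act w u) (act w v) = bil u v"
proof -
  obtain xs where xs: "xs \<in> lists S" "act w = word_act xs"
    using exists_word_act assms by blast
  from xs(1) have "bil (word_act xs u) (word_act xs v) = bil u v"
    by (induction xs) (auto simp: bil_simple_act)
  then show ?thesis using xs by simp
qed

lemmas act_simps =
  linear_add[OF act_linear] linear_diff[OF act_linear] linear_scale[OF act_linear]
  linear_neg[OF act_linear] linear_0[OF act_linear]

lemma cox_length_last:
  assumes "w \<in> carrier W" "w \<noteq> \<one>"
  obtains r where "r \<in> S" "Suc (cox_length (w \<otimes> r)) = cox_length w"
proof -
  obtain xs where xs: "xs \<in> lists S" "word_prod W xs = w" "length xs = cox_length w"
    using exists_reduced[OF assms(1)] by (auto simp: reduced_word_def)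
  then have "xs \<noteq> []" using assms by auto
  then obtain ys r where ys: "xs = ys @ [r]" by (metis append_butlast_last_id)
  then have *: "r \<in> S" "ys \<in> lists S" using xs by auto
  then have "w = word_prod W ys \<otimes> r"
    using xs ys by (auto simp: word_prod_append_S S_closed)
  then have "w \<otimes> r = word_prod W ys" using * by simp
  then have "cox_length (w \<otimes> r) < cox_length w"
    using cox_length_le[of ys] * xs ys by simp
  then have "Suc (cox_length (w \<otimes> r)) = cox_length w"
    using cox_length_mult_simple[OF assms(1) *(1)] by linarith
  then show ?thesis using that * by blast
qed

text \<open>
  Peel off from \<open>w\<close> the longest alternating suffix in its last letter \<open>r\<close> and \<open>s\<close>; induction applies
  to the remaining factor, and what is peeled off is a computation in the dihedral group.
\<close>

lemma act_simple_root_nonneg: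
  assumes "w \<in> carrier W" "s \<in> S" "cox_length w < cox_length (w \<otimes> s)"
  shows "nonneg (act w (simple_root s))"
  using assms
proof (induction "cox_length w" arbitrary: w s rule: less_induct)
  case less
  note w = less.prems(1) and s = less.prems(2)
  show ?case
  proof (cases "w = \<one>")
    case True
    then show ?thesis by (simp add: nonneg_simple_root)
  next
    case False
    then obtain r where r: "r \<in> S" "Suc (cox_length (w \<otimes> r)) = cox_length w"
      using cox_length_last w by blast
    then have rs: "r \<noteq> s" using less.prems by auto
    note alt = alternating_lists[OF r(1) s] alternating_lists[OF s r(1)]
    define Q where "Q k \<longleftrightarrow> (\<exists>v \<in> carrier W. w = v \<otimes> word_prod W (alternating r s k) \<and>
      cox_length v + k = cox_length w)" for k
    have "Q 1" unfolding Q_def using r w s S_closed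
      by (intro bexI[of _ "w \<otimes> r"]) auto
    have "Q k \<Longrightarrow> k \<le> cox_length w" for k by (auto simp: Q_def)
    then obtain k where k: "Q k" "\<And>j. Q j \<Longrightarrow> j \<le> k"
      using GreatestI_nat[of Q, OF \<open>Q 1\<close>] Greatest_le_nat[of Q] by metis
    then have "k \<ge> 1" using \<open>Q 1\<close> by blast
    then obtain j where kj: "k = Suc j" by (cases k) auto
    obtain v where v: "v \<in> carrier W" "w = v \<otimes> word_prod W (alternating r s k)"
      "cox_length v + k = cox_length w" using k(1) by (auto simp: Q_def)
    \<comment> \<open>\<open>a\<close> is the first letter of the peeled-off word, \<open>b\<close>
      the other one. Neither can be a right descent of \<open>v\<close>: \<open>a\<close> would make
      \<open>w\<close> shorter, \<open>b\<close> would allow a longer suffix.\<close>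
    define a where "a = (if even j then r else s)"
    define b where "b = (if even j then s else r)"
    have ab: "a \<in> S" "b \<in> S" using r s by (auto simp: a_def b_def)
    have a: "cox_length v < cox_length (v \<otimes> a)"
    proof (rule ccontr)
      assume "\<not> ?thesis"
      then have l: "Suc (cox_length (v \<otimes> a)) = cox_length v"
        using cox_length_mult_simple[OF v(1) ab(1)] by linarith
      have "w = v \<otimes> a \<otimes> word_prod W (alternating r s j)"
        using v ab alt S_closed
        by (simp add: kj alternating_Suc_Cons a_def m_assoc del: alternating.simps(2))
      then have "cox_length w \<le> cox_length (v \<otimes> a) + j"
        using cox_length_mult[of "v \<otimes> a" "word_prod W (alternating r s j)"] alt ab v S_closed
          cox_length_le[OF alt(1), of j] by simp
      then show False using l v kj by linarith
    qed
    have b: "cox_length v < cox_length (v \<otimes> b)"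
    proof (rule ccontr)
      assume "\<not> ?thesis"
      then have l: "Suc (cox_length (v \<otimes> b)) = cox_length v"
        using cox_length_mult_simple[OF v(1) ab(2)] by linarith
      have "w = (v \<otimes> b) \<otimes> word_prod W (alternating r s (Suc k))"
        using v ab alt S_closed r s
        by (simp add: kj alternating_Suc_Cons[of r s "Suc j"] b_def m_assoc del: alternating.simps(2))
      then have "Q (Suc k)"
        unfolding Q_def using l v ab S_closed by (intro bexI[of _ "v \<otimes> b"]) auto
      then show False using k by fastforce
    qed
    have "cox_length v < cox_length w" using v \<open>k \<ge> 1\<close> by linarith
    then have "nonneg (act v (simple_root a))" "nonneg (act v (simple_root b))"
      using less.hyps v(1) ab a b by auto
    then have vrs: "nonneg (act v (simple_root r))" "nonneg (act v (simple_root s))"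
      by (auto simp: a_def b_def split: if_splits)
    \<comment> \<open>A suffix of length at least the order could be rewritten by the braid relation
      so that it ends in \<open>s\<close>, and then \<open>w \<otimes> s\<close> would be shorter
      than \<open>w\<close>.\<close>
    have km: "ord (r \<otimes> s) = 0 \<or> k < ord (r \<otimes> s)"
    proof (rule ccontr)
      assume "\<not> ?thesis"
      then have m: "ord (r \<otimes> s) \<noteq> 0" "ord (r \<otimes> s) \<le> k" by auto
      define m where "m = ord (r \<otimes> s)"
      obtain m' where m': "m = Suc m'" using m(1) m_def not0_implies_Suc by blast
      define i where "i = k - m"
      have ki: "k = i + m" using m by (simp add: i_def m_def)
      define pre where "pre = (if even m then alternating r s i else alternating s r i)"
      have pre: "pre \<in> lists S" "length pre = i" using alt by (auto simp: pre_def)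
      have "word_prod W (alternating r s k) = word_prod W pre \<otimes> word_prod W (alternating r s m)"
        unfolding ki alternating_add pre_def[symmetric] using pre alt by (simp add: word_prod_append_S)
      also have "word_prod W (alternating r s m) = word_prod W (alternating s r m)"
        using braid[OF r(1) s] m_def by blast
      also have "\<dots> = word_prod W (alternating r s m') \<otimes> s"
        using alt s S_closed by (simp add: m' word_prod_append_S)
      finally have "w \<otimes> s = v \<otimes> (word_prod W (pre @ alternating r s m'))"
        using v pre alt s S_closed by (simp add: word_prod_append_S m_assoc simple_sq)
      then have "cox_length (w \<otimes> s) \<le> cox_length v + (i + m')"
        using cox_length_mult[OF v(1), of "word_prod W (pre @ alternating r s m')"]
          cox_length_le[of "pre @ alternating r s m'"] pre alt by simp
      then show False using less.prems(3) v(3) ki m' by linarith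
    qed
    have ch: "cheb (kappa r s) k \<ge> 0" "cheb (kappa r s) (Suc k) \<ge> 0"
      using km cheb_kappa_nonneg r s rs by auto
    have un: "nonneg (act v (unit_root r))" "nonneg (act v (unit_root s))"
      using vrs \<delta>_pos r s by (auto simp: unit_root_def act_simps intro!: nonneg_scale less_imp_le)
    have "act w (simple_root s) = sqrt (\<delta> s) *\<^sub>R act w (unit_root s)"
      using \<delta>_pos[OF s] by (simp add: unit_root_def act_simps)
    moreover have "act w (unit_root s) = act v (word_act (alternating r s k) (unit_root s))"
      using v alt act_mult act_word[OF alt(1)] by simp
    ultimately show ?thesis
      using un ch \<delta>_pos[OF s]
      by (auto simp: alternating_act[OF r(1) s] act_simps intro!: nonneg_scale nonneg_add)
  qed
qed

lemma act_simple_root_nonpos: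
  assumes "w \<in> carrier W" "s \<in> S" "cox_length (w \<otimes> s) < cox_length w"
  shows "nonneg (- act w (simple_root s))"
proof -
  have "nonneg (act (w \<otimes> s) (simple_root s))"
    using assms S_closed by (intro act_simple_root_nonneg) auto
  then show ?thesis
    using assms S_closed by (simp add: act_mult act_simple simple_act_self act_simps)
qed

text \<open>A nontrivial element makes the simple root of its last letter negative, so it cannot act
  as the identity.\<close>

lemma act_faithful:
  assumes "x \<in> carrier W" "y \<in> carrier W" "act x = act y"
  shows "x = y"
proof -
  define w where "w = inv x \<otimes> y"
  have w: "w \<in> carrier W" and wid: "\<And>v. act w v = v"
    using assms by (auto simp: w_def act_mult simp flip: assms(3))
  have "w = \<one>"
  proof (rule ccontr)
    assume "w \<noteq> \<one>"
    then obtain r where "r \<in> S" "Suc (cox_length (w \<otimes> r)) = cox_length w"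
      using cox_length_last w by blast
    then have "nonneg (- simple_root r)"
      using act_simple_root_nonpos[of w r] wid w by simp
    from this[unfolded nonneg_def, rule_format, of r] show False
      by (simp add: lookup_simple_root)
  qed
  then show ?thesis
    using assms w_def by (metis inv_closed inv_comm inv_equality inv_inv)
qed

section \<open>Roots and their reflections\<close>

definition is_root :: "('a \<Rightarrow>\<^sub>0 real) \<Rightarrow> bool"
  where "is_root \<beta> \<longleftrightarrow> (\<exists>x \<in> carrier W. \<exists>s \<in> S. \<beta> = act x (simple_root s))"

lemma is_root_act: "is_root \<beta> \<Longrightarrow> x \<in> carrier W \<Longrightarrow> is_root (act x \<beta>)"
  unfolding is_root_def by (metis act_mult m_closed)

lemma is_root_sign: "is_root \<beta> \<Longrightarrow> nonneg \<beta> \<or> nonneg (- \<beta>)"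
  unfolding is_root_def
  using act_simple_root_nonneg act_simple_root_nonpos cox_length_mult_simple by (metis lessI)

lemma is_root_bil_pos: "is_root \<beta> \<Longrightarrow> bil \<beta> \<beta> > 0"
  unfolding is_root_def using \<delta>_pos
  by (auto simp: bil_act bil_simple_root pairing_simple_root A_diag)

lemma is_root_nonzero: "is_root \<beta> \<Longrightarrow> \<beta> \<noteq> 0"
  using is_root_bil_pos[of \<beta>] by (auto simp: bil_simps)

lemma is_root_not_both: "is_root \<beta> \<Longrightarrow> nonneg \<beta> \<Longrightarrow> \<not> nonneg (- \<beta>)"
  using nonneg_antisym is_root_nonzero by blast

definition reflect :: "('a \<Rightarrow>\<^sub>0 real) \<Rightarrow> ('a \<Rightarrow>\<^sub>0 real) \<Rightarrow> ('a \<Rightarrow>\<^sub>0 real)"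
  where "reflect \<beta> v = v - (2 * bil \<beta> v / bil \<beta> \<beta>) *\<^sub>R \<beta>"

lemma simple_act_reflect: "s \<in> S \<Longrightarrow> simple_act s v = reflect (simple_root s) v"
  using \<delta>_pos[of s] by (simp add: reflect_def simple_act_pairing bil_simple_root pairing_simple_root A_diag)

lemma act_conj:
  assumes "x \<in> carrier W" "s \<in> S"
  shows "act (x \<otimes> s \<otimes> inv x) v = reflect (act x (simple_root s)) v"
proof -
  have "act (x \<otimes> s \<otimes> inv x) v = act x (reflect (simple_root s) (act (inv x) v))"
    using assms S_closed by (simp add: act_mult act_simple simple_act_reflect)
  also have "\<dots> = reflect (act x (simple_root s)) v"
    using assms bil_act[of x "simple_root s" "act (inv x) v"] bil_act[of x "simple_root s" "simple_root s"]
    by (simp add: reflect_def act_simps)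
  finally show ?thesis .
qed

lemma reflections_closed: "t \<in> reflections \<Longrightarrow> t \<in> carrier W"
  using S_closed by (auto simp: reflections_def)

lemma conj_closed: 
  assumes "t \<in> reflections" "x \<in> carrier W" shows "x \<otimes> t \<otimes> inv x \<in> reflections"
proof -
  obtain y s where "t = y \<otimes> s \<otimes> inv y" "y \<in> carrier W" "s \<in> S"
    using assms by (auto simp: reflections_def)
  then have "x \<otimes> t \<otimes> inv x = (x \<otimes> y) \<otimes> s \<otimes> inv (x \<otimes> y)"
    using assms S_closed by (simp add: m_assoc inv_mult_group)
  then show ?thesis
    using \<open>y \<in> carrier W\<close> \<open>s \<in> S\<close> assms(2) m_closed unfolding reflections_def by blast
qed

text \<open>Equal reflections have proportional roots. Conjugate simple reflections share \<delta>,
  so both roots have the same norm and the factor is 1 or -1; positivity excludes -1. This justifies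
  the definite description in \<open>root_of\<close>.\<close>

lemma conj_root_unique:
  assumes x: "x \<in> carrier W" "s \<in> S" and y: "y \<in> carrier W" "u \<in> S"
    and eq: "x \<otimes> s \<otimes> inv x = y \<otimes> u \<otimes> inv y"
    and nn: "nonneg (act x (simple_root s))" "nonneg (act y (simple_root u))"
  shows "act x (simple_root s) = act y (simple_root u)"
proof -
  let ?b = "act x (simple_root s)" and ?g = "act y (simple_root u)"
  have root: "is_root ?b" "is_root ?g" using x y by (auto simp: is_root_def)
  define z where "z = inv y \<otimes> x"
  have "z \<otimes> s \<otimes> inv z = inv y \<otimes> (x \<otimes> s \<otimes> inv x) \<otimes> y"
    using x y S_closed by (simp add: z_def inv_mult_group m_assoc)
  also have "\<dots> = u"
    unfolding eq using y S_closed by (simp add: m_assoc)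
  finally have "u = z \<otimes> s \<otimes> inv z" ..
  moreover have "z \<in> carrier W" using x y by (simp add: z_def)
  ultimately have "\<delta> s = \<delta> u"
    using \<delta>_conj x y by blast
  then have bb: "bil ?b ?b = bil ?g ?g"
    using x y by (simp add: bil_act bil_simple_root pairing_simple_root A_diag)
  have "reflect ?b ?b = reflect ?g ?b"
    using act_conj eq x y by metis
  moreover have "reflect ?b ?b = - ?b"
    using is_root_bil_pos[OF root(1)] by (simp add: reflect_def scaleR_2)
  moreover define c where "c = bil ?g ?b / bil ?g ?g"
  ultimately have "2 *\<^sub>R ?b = (2 * c) *\<^sub>R ?g"
    by (simp add: reflect_def scaleR_2 algebra_simps)
  then have "2 *\<^sub>R ?b = 2 *\<^sub>R (c *\<^sub>R ?g)" by simp
  then have bg: "?b = c *\<^sub>R ?g" by (metis scaleR_cancel_left zero_neq_numeral)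
  then have "bil ?g ?g = c * (c * bil ?g ?g)" using bb by (simp add: bil_simps)
  then have "c * c = 1" using is_root_bil_pos[OF root(2)] by simp
  then have "c = 1 \<or> c = -1" by (simp add: square_eq_1_iff)
  then show ?thesis
  proof
    assume "c = -1"
    then have "?b = - ?g" using bg by simp
    then show ?thesis using nn nonneg_antisym is_root_nonzero[OF root(2)] by metis
  qed (use bg in simp)
qed

text \<open>Each letter changes a vector only by a multiple of its own simple root.\<close>

lemma act_supported_diff:
  assumes "xs \<in> lists K" "K \<subseteq> S" shows "supported K (word_act xs v - v)"
  using assms(1)
proof (induction xs)
  case (Cons a xs)
  have eq: "word_act (a # xs) v - v = (word_act xs v - v) - pairing a (word_act xs v) *\<^sub>R simple_root a"
    by (simp add: simple_act_pairing)
  show ?case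
    unfolding eq using Cons
    by (intro supported_diff[of K "word_act xs v - v"] supported_scale supported_simple_root) auto
qed (simp add: supported_def)

lemma supported_act: 
  assumes "w \<in> carrier W" "supported S v" shows "supported S (act w v)"
proof -
  obtain xs where xs: "xs \<in> lists S" "act w = word_act xs" using exists_word_act assms by blast
  then have "supported S ((word_act xs v - v) + v)"
    using act_supported_diff[of xs S v] assms by (intro supported_add) auto
  then show ?thesis using xs by simp
qed

lemma is_root_supported: "is_root \<beta> \<Longrightarrow> supported S \<beta>"
  by (auto simp: is_root_def intro!: supported_act supported_simple_root)

lemma root_of_eqI:
  assumes x: "x \<in> carrier W" "s \<in> S" and nn: "nonneg (act x (simple_root s))"
    and t: "t = x \<otimes> s \<otimes> inv x"
  shows "root_of t = act x (simple_root s)"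
  unfolding root_of_def
proof (rule the_equality)
  obtain xs where xs: "xs \<in> lists S" "word_prod W xs = x" "act x = word_act xs"
    using exists_word_act x by blast
  then have "act x (simple_root s) = word_act xs (simple_root s)"
    by simp
  then show "(\<exists>ws\<in>lists S. \<exists>s'\<in>S. t = word_prod W ws \<otimes> s' \<otimes> inv word_prod W ws \<and>
      act x (simple_root s) = word_act ws (simple_root s')) \<and>
      (\<forall>s'\<in>S. 0 \<le> coord (act x (simple_root s)) s')"
    using xs x t nn unfolding nonneg_def by blast
next
  fix \<beta>
  assume b: "(\<exists>ws\<in>lists S. \<exists>s\<in>S. t = word_prod W ws \<otimes> s \<otimes> inv word_prod W ws \<and>
      \<beta> = word_act ws (simple_root s)) \<and> (\<forall>s\<in>S. 0 \<le> coord \<beta> s)"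
  then obtain ws u where ws: "ws \<in> lists S" "u \<in> S"
    "t = word_prod W ws \<otimes> u \<otimes> inv word_prod W ws" "\<beta> = act (word_prod W ws) (simple_root u)"
    using act_word by metis
  then have "is_root \<beta>" unfolding is_root_def using word_prod_S_closed by blast
  then have "nonneg \<beta>"
    using b is_root_supported unfolding nonneg_def supported_def by (metis order_refl)
  then show "\<beta> = act x (simple_root s)"
    using conj_root_unique[of "word_prod W ws" u x s] ws x nn t by auto
qed

text \<open>If the root belonging to the representative \<open>x\<close> is negative,
  \<open>x \<otimes> s\<close> represents the same reflection and has the opposite root.\<close>

lemma reflection_cases:
  assumes "t \<in> reflections"
  obtains x s where "x \<in> carrier W" "s \<in> S" "t = x \<otimes> s \<otimes> inv x" "root_of t = act x (simple_root s)"
proof -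
  obtain x s where x: "t = x \<otimes> s \<otimes> inv x" "x \<in> carrier W" "s \<in> S"
    using assms by (auto simp: reflections_def)
  show ?thesis
  proof (cases "nonneg (act x (simple_root s))")
    case True
    then show ?thesis using that x root_of_eqI by blast
  next
    case False
    then have "nonneg (- act x (simple_root s))"
      using is_root_sign x by (auto simp: is_root_def)
    then have "nonneg (act (x \<otimes> s) (simple_root s))"
      using x S_closed by (simp add: act_mult act_simple simple_act_self act_simps)
    moreover have "t = (x \<otimes> s) \<otimes> s \<otimes> inv (x \<otimes> s)"
      using x S_closed by (simp add: inv_mult_group inv_simple m_assoc)
    ultimately show ?thesis
      using that[of "x \<otimes> s" s] root_of_eqI[of "x \<otimes> s" s t] x S_closed by simp
  qed
qed

lemma root_of_is_root: "t \<in> reflections \<Longrightarrow> is_root (root_of t)"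
  using reflection_cases unfolding is_root_def by metis

lemma root_of_nonneg:
  assumes "t \<in> reflections" shows "nonneg (root_of t)"
proof -
  obtain x s where x: "x \<in> carrier W" "s \<in> S" "t = x \<otimes> s \<otimes> inv x" "root_of t = act x (simple_root s)"
    using reflection_cases assms by blast
  show ?thesis
  proof (rule ccontr)
    assume n: "\<not> ?thesis"
    then have "nonneg (- act x (simple_root s))"
      using is_root_sign x root_of_is_root[OF assms] by metis
    then have nn: "nonneg (act (x \<otimes> s) (simple_root s))"
      using x S_closed by (simp add: act_mult act_simple simple_act_self act_simps)
    moreover have "t = (x \<otimes> s) \<otimes> s \<otimes> inv (x \<otimes> s)"
      using x S_closed by (simp add: inv_mult_group inv_simple m_assoc)
    ultimately show False
      using n root_of_eqI[of "x \<otimes> s" s t] x S_closed by simp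
  qed
qed

lemma root_of_bil_pos: "t \<in> reflections \<Longrightarrow> bil (root_of t) (root_of t) > 0"
  using root_of_is_root is_root_bil_pos by blast

lemma root_of_supported: "t \<in> reflections \<Longrightarrow> supported S (root_of t)"
  using root_of_is_root is_root_supported by blast

lemma act_reflection: "t \<in> reflections \<Longrightarrow> act t v = reflect (root_of t) v"
  using reflection_cases act_conj by metis

lemma act_reflection_self: "t \<in> reflections \<Longrightarrow> act t (root_of t) = - root_of t"
  using root_of_bil_pos[of t] by (simp add: act_reflection reflect_def scaleR_2)

lemma reflection_sq: 
  assumes "t \<in> reflections" shows "t \<otimes> t = \<one>" "inv t = t" "t \<noteq> \<one>"
proof -
  obtain x s where x: "t = x \<otimes> s \<otimes> inv x" "x \<in> carrier W" "s \<in> S"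
    using assms by (auto simp: reflections_def)
  have "t \<otimes> t = x \<otimes> (s \<otimes> (inv x \<otimes> (x \<otimes> (s \<otimes> inv x))))"
    using x S_closed by (simp add: m_assoc del: inv_cancel)
  also have "\<dots> = \<one>"
    using x S_closed by simp
  finally show *: "t \<otimes> t = \<one>" .
  then show "inv t = t" using reflections_closed assms inv_equality by blast
  show "t \<noteq> \<one>"
  proof
    assume "t = \<one>"
    then have "root_of t = - root_of t" using act_reflection_self[OF assms] by simp
    then show False using root_of_nonneg[OF assms] nonneg_antisym is_root_nonzero root_of_is_root[OF assms] by metis
  qed
qed

lemma simple_reflection: "s \<in> S \<Longrightarrow> s \<in> reflections"
  unfolding reflections_def using S_closed by (intro CollectI exI[of _ \<one>] exI[of _ s]) auto

lemma root_of_simple: "s \<in> S \<Longrightarrow> root_of s = simple_root s"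
  using root_of_eqI[of \<one> s s] S_closed by (simp add: nonneg_simple_root)

lemma root_of_conj:
  assumes "t \<in> reflections" "x \<in> carrier W"
  shows "root_of (x \<otimes> t \<otimes> inv x) = act x (root_of t) \<or> root_of (x \<otimes> t \<otimes> inv x) = - act x (root_of t)"
    and "nonneg (act x (root_of t)) \<Longrightarrow> root_of (x \<otimes> t \<otimes> inv x) = act x (root_of t)"
proof -
  obtain y s where y: "y \<in> carrier W" "s \<in> S" "t = y \<otimes> s \<otimes> inv y" "root_of t = act y (simple_root s)"
    using reflection_cases assms by blast
  have eq: "x \<otimes> t \<otimes> inv x = (x \<otimes> y) \<otimes> s \<otimes> inv (x \<otimes> y)"
    using y assms S_closed by (simp add: m_assoc inv_mult_group)
  have b: "act x (root_of t) = act (x \<otimes> y) (simple_root s)"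
    using y assms by (simp add: act_mult)
  show *: "root_of (x \<otimes> t \<otimes> inv x) = act x (root_of t)" if "nonneg (act x (root_of t))"
    using root_of_eqI[of "x \<otimes> y" s] eq b that y assms by simp
  show "root_of (x \<otimes> t \<otimes> inv x) = act x (root_of t) \<or> root_of (x \<otimes> t \<otimes> inv x) = - act x (root_of t)"
  proof (cases "nonneg (act x (root_of t))")
    case False
    then have "nonneg (- act x (root_of t))"
      using is_root_sign is_root_act root_of_is_root assms by blast
    then have nn: "nonneg (act (x \<otimes> y \<otimes> s) (simple_root s))"
      using y(1,2) assms S_closed unfolding b
      by (simp add: act_mult act_simple simple_act_self act_simps)
    have "x \<otimes> t \<otimes> inv x = (x \<otimes> y \<otimes> s) \<otimes> s \<otimes> inv (x \<otimes> y \<otimes> s)"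
      unfolding eq using y assms S_closed by (simp add: inv_mult_group inv_simple m_assoc)
    then have "root_of (x \<otimes> t \<otimes> inv x) = act (x \<otimes> y \<otimes> s) (simple_root s)"
      using root_of_eqI[of "x \<otimes> y \<otimes> s" s] nn y assms S_closed by simp
    then show ?thesis
      using y assms S_closed by (simp add: act_mult act_simple simple_act_self act_simps)
  qed (use * in simp)
qed

lemma reflect_scale: "c \<noteq> 0 \<Longrightarrow> reflect (c *\<^sub>R \<beta>) v = reflect \<beta> v"
  by (simp add: reflect_def bil_simps)

text \<open>Proportional roots define the same orthogonal reflection, and the action is
  faithful.\<close>

lemma root_of_inj:
  assumes "t \<in> reflections" "u \<in> reflections" "root_of t = c *\<^sub>R root_of u"
  shows "t = u"
proof -
  have "c \<noteq> 0" using assms is_root_nonzero[OF root_of_is_root] by auto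
  then have "act t = act u"
    using assms act_reflection reflect_scale by (intro ext) simp
  then show ?thesis using act_faithful reflections_closed assms by blast
qed

text \<open>A positive root other than \<alpha>_s has a positive coordinate away from
  \<open>s\<close>. The reflection \<open>s\<close> does not touch that coordinate, so the image is
  not negative.\<close>

lemma simple_act_root_of:
  assumes "s \<in> S" "t \<in> reflections" "t \<noteq> s"
  shows "nonneg (simple_act s (root_of t))" "root_of (s \<otimes> t \<otimes> s) = simple_act s (root_of t)"
proof -
  have "\<exists>x. x \<noteq> s \<and> coord (root_of t) x > 0"
  proof (rule ccontr)
    assume "\<not> ?thesis"
    then have "coord (root_of t) x = 0" if "x \<noteq> s" for x
      using root_of_nonneg[OF assms(2)] that unfolding nonneg_def by (metis not_less order_antisym)
    then have "root_of t = coord (root_of t) s *\<^sub>R root_of s"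
      by (intro poly_mapping_eqI) (auto simp: root_of_simple assms lookup_simple_root)
    then show False using root_of_inj simple_reflection assms by blast
  qed
  then obtain x where x: "x \<noteq> s" "coord (root_of t) x > 0" by blast
  then have "coord (simple_act s (root_of t)) x > 0"
    by (simp add: simple_act_pairing lookup_minus lookup_simple_root)
  then have "\<not> nonneg (- simple_act s (root_of t))"
    unfolding nonneg_def by (simp add: not_le) blast
  then show *: "nonneg (simple_act s (root_of t))"
    using is_root_sign[of "act s (root_of t)"] is_root_act root_of_is_root assms S_closed act_simple
    by metis
  then show "root_of (s \<otimes> t \<otimes> s) = simple_act s (root_of t)"
    using root_of_conj(2)[of t s] assms S_closed by (simp add: act_simple inv_simple)
qed

section \<open>Inversions as positive roots that become negative\<close>

lemma cox_length_inv: 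
  assumes "w \<in> carrier W" shows "cox_length (inv w) = cox_length w"
proof -
  have le: "cox_length (inv x) \<le> cox_length x" if x: "x \<in> carrier W" for x
  proof -
    obtain xs where xs: "xs \<in> lists S" "word_prod W xs = x" "length xs = cox_length x"
      using exists_reduced[OF x] by (auto simp: reduced_word_def)
    then have "inv x = word_prod W (rev xs)" "rev xs \<in> lists S"
      using inv_word_prod by (auto simp: in_lists_conv_set)
    then show ?thesis using cox_length_le[of "rev xs"] xs by simp
  qed
  show ?thesis using le[of w] le[of "inv w"] assms by simp
qed

lemma cox_length_first:
  assumes "w \<in> carrier W" "w \<noteq> \<one>"
  obtains r where "r \<in> S" "Suc (cox_length (r \<otimes> w)) = cox_length w"
proof -
  obtain r where r: "r \<in> S" "Suc (cox_length (inv w \<otimes> r)) = cox_length (inv w)"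
    using cox_length_last[of "inv w"] assms by auto
  have "inv w \<otimes> r = inv (r \<otimes> w)"
    using r assms S_closed by (simp add: inv_mult_group inv_simple)
  then show ?thesis using that r cox_length_inv assms S_closed by auto
qed

text \<open>Induction along a left descent \<open>s\<close>: replacing \<open>w\<close> by
  \<open>s \<otimes> w\<close> and \<open>t\<close> by its conjugate keeps the vector
  \<open>act (inv w) (root_of t)\<close>. The base situation is \<open>t = s\<close>.\<close>

lemma reflection_shortens:
  assumes "w \<in> carrier W" "t \<in> reflections" "nonneg (- act (inv w) (root_of t))"
  shows "cox_length (t \<otimes> w) < cox_length w"
  using assms
proof (induction "cox_length w" arbitrary: w t rule: less_induct)
  case less
  note w = less.prems(1) and t = less.prems(2)
  have tc: "t \<in> carrier W" using t reflections_closed by blast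
  have "w \<noteq> \<one>"
    using less.prems is_root_not_both root_of_is_root root_of_nonneg by auto
  then obtain s where s: "s \<in> S" "Suc (cox_length (s \<otimes> w)) = cox_length w"
    using cox_length_first w by blast
  show ?case
  proof (cases "t = s")
    case False
    define t' where "t' = s \<otimes> t \<otimes> s"
    have t': "t' \<in> reflections" "root_of t' = simple_act s (root_of t)"
      using simple_act_root_of[OF s(1) t False] conj_closed[OF t, of s] s S_closed
      by (auto simp: t'_def inv_simple)
    have "act (inv (s \<otimes> w)) (root_of t') = act (inv w) (act s (act s (root_of t)))"
      using t' w s S_closed by (simp add: inv_mult_group inv_simple act_mult act_simple)
    also have "\<dots> = act (inv w) (root_of t)"
      using s by (simp add: act_simple simple_act_invol)
    finally have "cox_length (t' \<otimes> (s \<otimes> w)) < cox_length (s \<otimes> w)"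
      using less.hyps[of "s \<otimes> w" t'] s t' w S_closed less.prems by simp
    moreover have "s \<otimes> (t' \<otimes> (s \<otimes> w)) = t \<otimes> w"
      using s w tc S_closed by (simp add: t'_def m_assoc)
    ultimately show ?thesis
      using cox_length_mult[of s "t' \<otimes> (s \<otimes> w)"] cox_length_simple_le[OF s(1)] s w S_closed
        reflections_closed[OF t'(1)] by fastforce
  qed (use s in simp)
qed

text \<open>For the forward direction: if the root stayed positive under \<open>inv w\<close>, it
  would become negative under \<open>inv (t \<otimes> w)\<close>, and
  \<open>reflection_shortens\<close> would make \<open>w\<close> shorter than
  \<open>t \<otimes> w\<close>.\<close>

lemma inversions_iff:
  assumes "w \<in> carrier W" "t \<in> reflections"
  shows "t \<in> inversions w \<longleftrightarrow> nonneg (- act (inv w) (root_of t))"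
proof
  assume "t \<in> inversions w"
  then have l: "cox_length (t \<otimes> w) < cox_length w" by (simp add: inversions_def)
  have tc: "t \<in> carrier W" using assms reflections_closed by blast
  show "nonneg (- act (inv w) (root_of t))"
  proof (rule ccontr)
    assume "\<not> ?thesis"
    then have "nonneg (act (inv w) (root_of t))"
      using is_root_sign is_root_act root_of_is_root assms by blast
    moreover have "act (inv (t \<otimes> w)) (root_of t) = - act (inv w) (root_of t)"
      using assms tc by (simp add: inv_mult_group act_mult reflection_sq act_reflection_self act_simps)
    ultimately have "cox_length (t \<otimes> (t \<otimes> w)) < cox_length (t \<otimes> w)"
      using reflection_shortens[of "t \<otimes> w" t] assms tc by simp
    moreover have "t \<otimes> (t \<otimes> w) = w"
      using assms tc reflection_sq(1) by (simp flip: m_assoc)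
    ultimately show False using l by simp
  qed
qed (use assms reflection_shortens in \<open>simp add: inversions_def\<close>)

lemma inversions_iff_not:
  assumes "w \<in> carrier W" "t \<in> reflections"
  shows "t \<notin> inversions w \<longleftrightarrow> nonneg (act (inv w) (root_of t))"
  using inversions_iff[OF assms] is_root_sign[of "act (inv w) (root_of t)"]
    is_root_not_both[of "act (inv w) (root_of t)"] is_root_act root_of_is_root assms by blast

lemma simple_inversion_iff: "s \<in> S \<Longrightarrow> s \<in> inversions w \<longleftrightarrow> cox_length (s \<otimes> w) < cox_length w"
  by (simp add: inversions_def simple_reflection)

text \<open>
  Membership in the standard parabolic subgroup of \<open>K\<close> is encoded by a condition on the action,
  which makes it trivial to decide for reflections and to pass to inverses.
\<close>

definition parab :: "'a set \<Rightarrow> 'a \<Rightarrow> bool"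
  where "parab K w \<longleftrightarrow> w \<in> carrier W \<and> (\<forall>v. supported K (act w v - v))"

lemma parab_word: "xs \<in> lists K \<Longrightarrow> K \<subseteq> S \<Longrightarrow> parab K (word_prod W xs)"
  using act_supported_diff[of xs K] act_word[of xs] lists_mono[of K S]
    word_prod_S_closed[of xs]
  unfolding parab_def by (metis subsetD)

text \<open>The first letter \<open>a\<close> of a reduced word is an inversion, so
  \<open>inv w\<close> makes \<alpha>_a negative. For \<open>a\<close> outside \<open>K\<close> the
  coordinate at \<open>a\<close> would be unchanged and equal to 1. Hence every reduced word, not
  just some word, stays in \<open>K\<close>.\<close>

lemma parab_reduced:
  assumes "parab K w" "K \<subseteq> S" "reduced_word w xs"
  shows "xs \<in> lists K"
  using assms
proof (induction xs arbitrary: w)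
  case (Cons a xs)
  have a: "a \<in> S" "xs \<in> lists S" and w: "w = a \<otimes> word_prod W xs"
    and len: "cox_length w = Suc (length xs)"
    using Cons.prems by (auto simp: reduced_word_def)
  define w' where "w' = word_prod W xs"
  have wc: "w \<in> carrier W" "w' \<in> carrier W" using a w S_closed by (auto simp: w'_def)
  have aw: "a \<otimes> w = w'" using a w wc by (simp add: w'_def)
  have l: "cox_length w' \<le> length xs" using cox_length_le a by (simp add: w'_def)
  then have l': "cox_length w' = length xs"
    using cox_length_simple_mult[OF wc(1) a(1), unfolded aw] len by linarith
  have aI: "a \<in> inversions w"
    using simple_inversion_iff a aw l len by simp
  then have neg: "nonneg (- act (inv w) (simple_root a))"
    using inversions_iff[OF wc(1) simple_reflection[OF a(1)]] root_of_simple a by simp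
  have aK: "a \<in> K"
  proof (rule ccontr)
    assume n: "a \<notin> K"
    define u where "u = act (inv w) (simple_root a)"
    have "supported K (act w u - u)" using Cons.prems by (auto simp: parab_def)
    then have "coord u a = 1"
      using n wc unfolding supported_def by (auto simp: u_def lookup_minus lookup_simple_root)
    then show False using neg[unfolded nonneg_def, rule_format, of a] by (simp add: u_def)
  qed
  have "parab K w'"
    unfolding parab_def
  proof (intro conjI allI)
    fix v
    have eq: "act w' v - v = (act w v - v) - pairing a (act w v) *\<^sub>R simple_root a"
      using aw wc a S_closed by (simp add: act_mult act_simple simple_act_pairing flip: aw)
    have "supported K (act w v - v)" using Cons.prems(1) by (simp add: parab_def)
    then show "supported K (act w' v - v)"
      unfolding eq using aK by (intro supported_diff[of K "act w v - v"] supported_scale supported_simple_root)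
  qed (rule wc)
  then have "xs \<in> lists K"
    using Cons.IH[of w'] Cons.prems(2) a l' by (auto simp: reduced_word_def w'_def)
  then show ?case using aK by simp
qed simp

lemma parab_iff:
  assumes "K \<subseteq> S" shows "parab K w \<longleftrightarrow> (\<exists>xs \<in> lists K. word_prod W xs = w)"
proof
  assume "parab K w"
  then obtain xs where "reduced_word w xs" using exists_reduced parab_def by blast
  then show "\<exists>xs \<in> lists K. word_prod W xs = w"
    using parab_reduced[OF \<open>parab K w\<close> assms] by (auto simp: reduced_word_def)
qed (use parab_word assms in blast)

lemma parab_mult:
  assumes "parab K x" "parab K y" "K \<subseteq> S" shows "parab K (x \<otimes> y)"
proof -
  obtain xs ys where "xs \<in> lists K" "word_prod W xs = x" "ys \<in> lists K" "word_prod W ys = y"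
    using parab_iff assms by meson
  moreover then have "xs \<in> lists S" "ys \<in> lists S" using assms(3) lists_mono by blast+
  ultimately show ?thesis
    using parab_word[of "xs @ ys" K] assms(3) by (simp add: word_prod_append_S)
qed

lemma parab_simple: "s \<in> K \<Longrightarrow> K \<subseteq> S \<Longrightarrow> parab K s"
  using parab_word[of "[s]" K] S_closed by auto

lemma parab_one: "parab K \<one>"
  by (simp add: parab_def supported_def)

lemma parab_S: "w \<in> carrier W \<Longrightarrow> parab S w"
  using parab_iff[of S] exists_word by blast

lemma parab_mono: "parab J w \<Longrightarrow> J \<subseteq> K \<Longrightarrow> parab K w"
  unfolding parab_def using supported_mono by blast

lemma parab_inv: 
  assumes "parab K w" shows "parab K (inv w)"
  unfolding parab_def
proof (intro conjI allI)
  show c: "inv w \<in> carrier W" using assms by (simp add: parab_def)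
  fix v
  have "supported K (act w (act (inv w) v) - act (inv w) v)"
    using assms unfolding parab_def by blast
  from supported_uminus[OF this] show "supported K (act (inv w) v - v)"
    using assms by (simp add: parab_def)
qed

text \<open>A reflection moves every vector by a multiple of its root, and its own root by -2 times
  itself.\<close>

lemma parab_reflection_iff:
  assumes "t \<in> reflections" shows "parab K t \<longleftrightarrow> supported K (root_of t)"
proof
  assume "parab K t"
  then have "supported K (act t (root_of t) - root_of t)" by (auto simp: parab_def)
  then show "supported K (root_of t)"
    using assms by (auto simp: act_reflection_self supported_def lookup_minus)
next
  assume "supported K (root_of t)"
  then show "parab K t"
    using assms reflections_closed
    by (auto simp: parab_def act_reflection reflect_def intro!: supported_uminus supported_scale)
qed

end

section \<open>Generalized rank two parabolic subgroups\<close>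

lemma span_pair_iff: "v \<in> span {a, b} \<longleftrightarrow> (\<exists>p q. v = p *\<^sub>R a + q *\<^sub>R b)"
  for a b :: "'v::real_vector"
proof -
  have "v \<in> span {a, b} \<longleftrightarrow> (\<exists>p. v - p *\<^sub>R a \<in> span {b})"
    by (simp add: span_insert)
  also have "\<dots> \<longleftrightarrow> (\<exists>p q. v - p *\<^sub>R a = q *\<^sub>R b)"
    by (auto simp: span_singleton)
  also have "\<dots> \<longleftrightarrow> (\<exists>p q. v = p *\<^sub>R a + q *\<^sub>R b)"
    by (simp add: diff_eq_eq add.commute)
  finally show ?thesis .
qed

lemma mem_ray_iff: "v \<in> conic hull {x} \<longleftrightarrow> (\<exists>c\<ge>0. v = c *\<^sub>R x)" for x :: "'v::real_vector"
  by (auto simp: conic_hull_explicit)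

text \<open>Inside a cone the points of an open segment may be rescaled, which turns the face
  condition on segments into one on sums of two cone elements.\<close>

lemma ray_face_of_iff:
  fixes x :: "'v::real_vector"
  assumes "convex_cone C"
  shows "(conic hull {x}) face_of C \<longleftrightarrow> conic hull {x} \<subseteq> C \<and>
    (\<forall>a\<in>C. \<forall>b\<in>C. a + b \<in> conic hull {x} \<longrightarrow> a \<in> conic hull {x})"
    (is "_ \<longleftrightarrow> ?R \<subseteq> C \<and> ?F")
proof
  have scale: "c *\<^sub>R v \<in> ?R" if "v \<in> ?R" "c \<ge> 0" for c v
    using that by (auto simp: mem_ray_iff) (metis scaleR_scaleR mult_nonneg_nonneg)
  {
    assume face: "?R face_of C"
    show "?R \<subseteq> C \<and> ?F"
    proof (intro conjI ballI impI)
      show "?R \<subseteq> C" using face face_of_imp_subset by blast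
      fix a b assume ab: "a \<in> C" "b \<in> C" "a + b \<in> ?R"
      have m: "(1/2) *\<^sub>R (a + b) \<in> ?R" using ab scale by simp
      show "a \<in> ?R"
      \<comment> \<open>For \<open>a = b\<close> the open segment is empty and the face property
        gives no information.\<close>
      proof (cases "a = b")
        case True
        then show ?thesis using m by (simp flip: scaleR_2)
      next
        case False
        then have "(1/2) *\<^sub>R (a + b) \<in> open_segment a b"
          using midpoint_in_open_segment[of a b] by (simp add: midpoint_def)
        then show ?thesis using face ab m unfolding face_of_def by blast
      qed
    qed
  next
    assume R: "?R \<subseteq> C \<and> ?F"
    show "?R face_of C"
      unfolding face_of_def
    proof (intro conjI ballI impI)
      show "convex ?R" by (simp add: convex_conic_hull)
      fix a b y assume ab: "a \<in> C" "b \<in> C" "y \<in> ?R" "y \<in> open_segment a b"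
      then obtain u where u: "0 < u" "u < 1" "y = (1 - u) *\<^sub>R a + u *\<^sub>R b"
        by (auto simp: in_segment)
      have c: "(1 - u) *\<^sub>R a \<in> C" "u *\<^sub>R b \<in> C"
        using u ab assms by (auto intro!: convex_cone_scaleR)
      then have "(1 - u) *\<^sub>R a \<in> ?R" "u *\<^sub>R b \<in> ?R"
        using R ab u by (auto simp: add.commute)
      then have "(1 / (1 - u)) *\<^sub>R (1 - u) *\<^sub>R a \<in> ?R" "(1 / u) *\<^sub>R u *\<^sub>R b \<in> ?R"
        using u scale[of "(1 - u) *\<^sub>R a" "1 / (1 - u)"] scale[of "u *\<^sub>R b" "1 / u"]
        by (simp_all del: scaleR_scaleR)
      then show "a \<in> ?R" "b \<in> ?R" using u by auto
    qed (use R in auto)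
  }
qed

definition in_cone :: "'v::real_vector \<Rightarrow> 'v \<Rightarrow> 'v \<Rightarrow> bool"
  where "in_cone a b v \<longleftrightarrow> (\<exists>p\<ge>0. \<exists>q\<ge>0. v = p *\<^sub>R a + q *\<^sub>R b)"

lemma in_cone_sym: "in_cone a b v \<Longrightarrow> in_cone b a v"
  unfolding in_cone_def by (metis add.commute)

lemma convex_cone_in_cone: "convex_cone {v. in_cone a b v}"
proof -
  have "in_cone a b 0" unfolding in_cone_def by (intro exI[of _ 0]) auto
  moreover have "in_cone a b (x + y)" if xy: "in_cone a b x" "in_cone a b y" for x y
  proof -
    obtain p q p' q' where "p \<ge> 0" "q \<ge> 0" "p' \<ge> 0" "q' \<ge> 0"
      "x = p *\<^sub>R a + q *\<^sub>R b" "y = p' *\<^sub>R a + q' *\<^sub>R b"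
      using xy unfolding in_cone_def by blast
    then show ?thesis unfolding in_cone_def
      by (intro exI[of _ "p + p'"] conjI exI[of _ "q + q'"]) (auto simp: algebra_simps)
  qed
  moreover have "in_cone a b (c *\<^sub>R x)" if xy: "in_cone a b x" "c \<ge> 0" for x c
  proof -
    obtain p q where "p \<ge> 0" "q \<ge> 0" "x = p *\<^sub>R a + q *\<^sub>R b"
      using xy unfolding in_cone_def by blast
    then show ?thesis unfolding in_cone_def
      using xy by (intro exI[of _ "c * p"] conjI exI[of _ "c * q"]) (auto simp: algebra_simps)
  qed
  ultimately show ?thesis by (auto simp: convex_cone_iff)
qed

context coxeter_root_datum
begin

lemma roots_independent:
  assumes "t \<in> reflections" "u \<in> reflections" "t \<noteq> u" "p *\<^sub>R root_of t + q *\<^sub>R root_of u = 0"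
  shows "p = 0 \<and> q = 0"
proof -
  have p: "p = 0"
  proof (rule ccontr)
    assume "p \<noteq> 0"
    have "p *\<^sub>R root_of t = (- q) *\<^sub>R root_of u"
      using assms(4) by (simp add: eq_neg_iff_add_eq_0)
    then have "(1 / p) *\<^sub>R p *\<^sub>R root_of t = (1 / p) *\<^sub>R (- q) *\<^sub>R root_of u" by simp
    then have "root_of t = (- q / p) *\<^sub>R root_of u" using \<open>p \<noteq> 0\<close> by simp
    then show False using root_of_inj assms by blast
  qed
  then have "q *\<^sub>R root_of u = 0" using assms by simp
  then show ?thesis using p is_root_nonzero[OF root_of_is_root] assms by auto
qed

lemma roots_coordinates_unique:
  assumes "t \<in> reflections" "u \<in> reflections" "t \<noteq> u"
    "p *\<^sub>R root_of t + q *\<^sub>R root_of u = p' *\<^sub>R root_of t + q' *\<^sub>R root_of u"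
  shows "p = p'" "q = q'"
proof -
  have "(p - p') *\<^sub>R root_of t + (q - q') *\<^sub>R root_of u =
    (p *\<^sub>R root_of t + q *\<^sub>R root_of u) - (p' *\<^sub>R root_of t + q' *\<^sub>R root_of u)"
    by (simp add: algebra_simps)
  also have "\<dots> = 0" using assms(4) by simp
  finally show "p = p'" "q = q'"
    using roots_independent[OF assms(1-3), of "p - p'" "q - q'"] by auto
qed

text \<open>The vectors \<open>a\<close> and \<open>b\<close> need not be roots. Independence of two
  roots makes the determinant of their coordinates nonzero, and Cramer's rule recovers
  \<open>a\<close> and \<open>b\<close>.\<close>

lemma span_roots_eq:
  assumes t: "t1 \<in> reflections" "t2 \<in> reflections" "t1 \<noteq> t2"
    and "root_of t1 \<in> span {a, b}" "root_of t2 \<in> span {a, b}"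
  shows "span {root_of t1, root_of t2} = span {a, b}"
proof
  show "span {root_of t1, root_of t2} \<subseteq> span {a, b}"
    using assms by (intro span_minimal) (auto simp: subspace_span)
  obtain p1 q1 p2 q2 where e: "root_of t1 = p1 *\<^sub>R a + q1 *\<^sub>R b" "root_of t2 = p2 *\<^sub>R a + q2 *\<^sub>R b"
    using assms by (meson span_pair_iff)
  define D where "D = p1 * q2 - p2 * q1"
  have Da: "D *\<^sub>R a = q2 *\<^sub>R root_of t1 + (- q1) *\<^sub>R root_of t2"
    by (simp add: e D_def algebra_simps)
  have Db: "D *\<^sub>R b = (- p2) *\<^sub>R root_of t1 + p1 *\<^sub>R root_of t2"
    by (simp add: e D_def algebra_simps)
  have "D \<noteq> 0"
  proof
    assume "D = 0"
    then have "q2 *\<^sub>R root_of t1 + (- q1) *\<^sub>R root_of t2 = 0" "(- p2) *\<^sub>R root_of t1 + p1 *\<^sub>R root_of t2 = 0"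
      using Da Db by simp_all
    then have "- q1 = 0" "p1 = 0" using roots_independent[OF t] by blast+
    then show False using e is_root_nonzero[OF root_of_is_root[OF t(1)]] by simp
  qed
  have "D *\<^sub>R a \<in> span {root_of t1, root_of t2}" "D *\<^sub>R b \<in> span {root_of t1, root_of t2}"
    unfolding Da Db span_pair_iff by blast+
  then have "(1 / D) *\<^sub>R D *\<^sub>R a \<in> span {root_of t1, root_of t2}"
    "(1 / D) *\<^sub>R D *\<^sub>R b \<in> span {root_of t1, root_of t2}"
    by (simp_all only: span_scale)
  then have "a \<in> span {root_of t1, root_of t2}" "b \<in> span {root_of t1, root_of t2}"
    using \<open>D \<noteq> 0\<close> by simp_all
  then show "span {a, b} \<subseteq> span {root_of t1, root_of t2}"
    by (intro span_minimal) (auto simp: subspace_span)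
qed

text \<open>
  Canonical generators and alignment depend on a subgroup only through its reflections. Recording
  just these treats rank two parabolic and generalized rank two parabolic subgroups alike.
\<close>

definition flat :: "'a set \<Rightarrow> bool"
  where "flat P \<longleftrightarrow> P \<subseteq> carrier W \<and> (\<exists>t1 \<in> reflections. \<exists>t2 \<in> reflections. t1 \<noteq> t2 \<and>
    P \<inter> reflections = {t \<in> reflections. root_of t \<in> span {root_of t1, root_of t2}})"

lemma flatD:
  assumes "flat P" "r1 \<in> P \<inter> reflections" "r2 \<in> P \<inter> reflections" "r1 \<noteq> r2"
  shows "P \<inter> reflections = {t \<in> reflections. root_of t \<in> span {root_of r1, root_of r2}}"
proof -
  obtain t1 t2 where t: "P \<inter> reflections = {t \<in> reflections. root_of t \<in> span {root_of t1, root_of t2}}"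
    using assms(1) unfolding flat_def by blast
  then have "root_of r1 \<in> span {root_of t1, root_of t2}" "root_of r2 \<in> span {root_of t1, root_of t2}"
    using assms by auto
  then show ?thesis using t span_roots_eq assms by auto
qed

text \<open>The generated subgroup could contain further reflections. It does not: its elements move
  vectors only within the plane, and a reflection moves its own root by -2 times that root.\<close>

lemma gen_rank_two_parabolic_flat:
  assumes "gen_rank_two_parabolic P" shows "flat P"
proof -
  obtain t1 t2 where t: "t1 \<in> reflections" "t2 \<in> reflections" "t1 \<noteq> t2"
    and P: "P = generate W {t \<in> reflections. root_of t \<in> span {root_of t1, root_of t2}}"
    using assms unfolding gen_rank_two_parabolic_def by blast
  let ?U = "span {root_of t1, root_of t2}"
  have refl: "act t v - v \<in> ?U" if "t \<in> reflections" "root_of t \<in> ?U" for t v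
    using that by (simp add: act_reflection reflect_def span_neg span_scale)
  have P_act: "g \<in> carrier W \<and> (\<forall>v. act g v - v \<in> ?U)" if "g \<in> P" for g
    using that unfolding P
  proof induction
    case one then show ?case by (simp add: span_zero)
  next
    case (incl h) then show ?case using refl reflections_closed by auto
  next
    case (inv h) then show ?case using refl reflections_closed reflection_sq by auto
  next
    case (eng g h)
    show ?case
    proof (intro conjI allI)
      fix v
      have "act (g \<otimes> h) v - v = (act g (act h v) - act h v) + (act h v - v)"
        using eng by (simp add: act_mult)
      also have "\<dots> \<in> ?U" using eng by (intro span_add) auto
      finally show "act (g \<otimes> h) v - v \<in> ?U" .
    qed (use eng in auto)
  qed
  have "root_of t \<in> ?U" if "t \<in> P" "t \<in> reflections" for t
  proof -
    have "act t (root_of t) - root_of t \<in> ?U" using \<open>t \<in> P\<close> P_act by blast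
    then have "(- 1 / 2) *\<^sub>R (act t (root_of t) - root_of t) \<in> ?U"
      by (rule span_scale)
    also have "(- 1 / 2) *\<^sub>R (act t (root_of t) - root_of t) = root_of t"
      using that by (simp add: act_reflection_self algebra_simps flip: scaleR_add_left)
    finally show ?thesis by simp
  qed
  then have "P \<inter> reflections = {t \<in> reflections. root_of t \<in> ?U}"
    using P by (auto intro: generate.incl)
  then show ?thesis unfolding flat_def using t P_act by blast
qed

lemma generate_iff_parab:
  assumes "K \<subseteq> S" shows "y \<in> generate W K \<longleftrightarrow> parab K y"
proof
  assume "y \<in> generate W K"
  then show "parab K y"
  proof induction
    case (inv h) then show ?case using assms parab_simple[of h K] inv_simple[of h] by auto
  qed (use assms parab_simple parab_one parab_mult in auto)
next
  assume "parab K y"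
  then obtain xs where xs: "xs \<in> lists K" "word_prod W xs = y" using parab_iff assms by blast
  from xs(1) have "word_prod W xs \<in> generate W K"
    by (induction xs) (auto intro: generate.intros)
  then show "y \<in> generate W K" using xs by simp
qed

lemma supported_pair_iff:
  "supported {r, s} v \<longleftrightarrow> v \<in> span {simple_root r, simple_root s}"
proof
  assume v: "supported {r, s} v"
  have "v = coord v r *\<^sub>R simple_root r +
    (if r = s then 0 else coord v s) *\<^sub>R simple_root s"
    using v by (intro poly_mapping_eqI) (auto simp: lookup_add lookup_simple_root supported_def)
  then show "v \<in> span {simple_root r, simple_root s}" unfolding span_pair_iff by blast
qed (auto simp: span_pair_iff intro!: supported_add supported_scale supported_simple_root)

lemma conj_root_supported_iff:
  assumes "x \<in> carrier W" "t \<in> reflections"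
  shows "supported K (root_of (x \<otimes> t \<otimes> inv x)) \<longleftrightarrow> supported K (act x (root_of t))"
  using root_of_conj(1)[OF assms(2,1)] supported_uminus[of K] by (metis minus_minus)

text \<open>Conjugating back by \<open>x\<close> leads to a standard subgroup, where membership of a
  reflection is decided by the support of its root.\<close>

lemma rank_two_reflections:
  assumes x: "x \<in> carrier W" and rs: "r \<in> S" "s \<in> S"
    and P: "P = (\<lambda>y. x \<otimes> y \<otimes> inv x) ` generate W {r, s}"
  shows "P \<inter> reflections =
    {t \<in> reflections. root_of t \<in> span {act x (simple_root r), act x (simple_root s)}}"
proof -
  have "t \<in> P \<longleftrightarrow> root_of t \<in> span {act x (simple_root r), act x (simple_root s)}"
    if t: "t \<in> reflections" for t
  proof -
    have tc: "t \<in> carrier W" using t reflections_closed by blast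
    have gc: "generate W {r, s} \<subseteq> carrier W"
      using rs S_closed generate_incl[of "{r, s}"] by auto
    have "t \<in> P \<longleftrightarrow> inv x \<otimes> t \<otimes> x \<in> generate W {r, s}"
    proof
      assume "t \<in> P"
      then obtain y where y: "y \<in> generate W {r, s}" "t = x \<otimes> y \<otimes> inv x" using P by blast
      then have "inv x \<otimes> t \<otimes> x = y" using gc x by (auto simp: m_assoc)
      then show "inv x \<otimes> t \<otimes> x \<in> generate W {r, s}" using y by simp
    next
      assume g: "inv x \<otimes> t \<otimes> x \<in> generate W {r, s}"
      have "t = x \<otimes> (inv x \<otimes> t \<otimes> x) \<otimes> inv x" using x tc by (simp add: m_assoc)
      then show "t \<in> P" using g P by blast
    qed
    also have "\<dots> \<longleftrightarrow> supported {r, s} (root_of (inv x \<otimes> t \<otimes> x))"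
      using generate_iff_parab[of "{r, s}"] parab_reflection_iff conj_closed[OF t, of "inv x"] rs x
      by auto
    also have "\<dots> \<longleftrightarrow> act (inv x) (root_of t) \<in> span {simple_root r, simple_root s}"
      using conj_root_supported_iff[of "inv x" t "{r, s}"] x t supported_pair_iff by simp
    also have "\<dots> \<longleftrightarrow> root_of t \<in> span {act x (simple_root r), act x (simple_root s)}"
    proof
      assume "act (inv x) (root_of t) \<in> span {simple_root r, simple_root s}"
      then obtain p q where "act (inv x) (root_of t) = p *\<^sub>R simple_root r + q *\<^sub>R simple_root s"
        unfolding span_pair_iff by blast
      then have "act x (act (inv x) (root_of t)) = act x (p *\<^sub>R simple_root r + q *\<^sub>R simple_root s)"
        by simp
      then show "root_of t \<in> span {act x (simple_root r), act x (simple_root s)}"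
        using x by (auto simp: act_simps span_pair_iff)
    next
      assume "root_of t \<in> span {act x (simple_root r), act x (simple_root s)}"
      then obtain p q where "root_of t = p *\<^sub>R act x (simple_root r) + q *\<^sub>R act x (simple_root s)"
        unfolding span_pair_iff by blast
      then have "act (inv x) (root_of t) = p *\<^sub>R simple_root r + q *\<^sub>R simple_root s"
        using x by (simp add: act_simps)
      then show "act (inv x) (root_of t) \<in> span {simple_root r, simple_root s}"
        unfolding span_pair_iff by blast
    qed
    finally show ?thesis .
  qed
  then show ?thesis by blast
qed

lemma rank_two_parabolic_flat:
  assumes "rank_two_parabolic P" shows "flat P"
proof -
  obtain x r s where x: "x \<in> carrier W" and rs: "r \<in> S" "s \<in> S" "r \<noteq> s"
    and P: "P = (\<lambda>y. x \<otimes> y \<otimes> inv x) ` generate W {r, s}"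
    using assms unfolding rank_two_parabolic_def by blast
  let ?t1 = "x \<otimes> r \<otimes> inv x" and ?t2 = "x \<otimes> s \<otimes> inv x"
  have t: "?t1 \<in> reflections" "?t2 \<in> reflections" "?t1 \<noteq> ?t2"
    using conj_closed simple_reflection x rs S_closed by auto
  have "root_of ?t1 \<in> span {act x (simple_root r), act x (simple_root s)}"
    "root_of ?t2 \<in> span {act x (simple_root r), act x (simple_root s)}"
    using root_of_conj(1)[OF simple_reflection x] rs
    by (metis insertI1 root_of_simple span_base span_neg, metis insertI1 insertI2 root_of_simple span_base span_neg)
  from span_roots_eq[OF t this] have "P \<inter> reflections = {t \<in> reflections. root_of t \<in> span {root_of ?t1, root_of ?t2}}"
    using rank_two_reflections[OF x rs(1,2) P] by simp
  moreover have "P \<subseteq> carrier W"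
    using rs S_closed generate_incl[of "{r, s}"] x unfolding P by auto
  ultimately show ?thesis unfolding flat_def using t by blast
qed

lemma not_in_ray:
  assumes "t \<in> reflections" "u \<in> reflections" "t \<noteq> u" "p > 0"
  shows "p *\<^sub>R root_of t \<notin> conic hull {root_of u}"
proof
  assume "p *\<^sub>R root_of t \<in> conic hull {root_of u}"
  then obtain c where "p *\<^sub>R root_of t = c *\<^sub>R root_of u" by (auto simp: mem_ray_iff)
  then have "p *\<^sub>R root_of t + (- c) *\<^sub>R root_of u = 0" by simp
  then have "p = 0" using roots_independent assms(1-3) by blast
  then show False using assms(4) by simp
qed

text \<open>A negative coordinate of \<open>root_of t\<close> could be moved to the other side,
  writing a multiple of one canonical root as a sum of two cone elements. The face property would
  then put the other canonical root on the same ray.\<close>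

lemma canonical_labelingD:
  assumes "flat P" and can: "canonical_labeling P r1 r2"
  shows "r1 \<noteq> r2" "r1 \<in> P \<inter> reflections" "r2 \<in> P \<inter> reflections"
    and "t \<in> P \<inter> reflections \<Longrightarrow> in_cone (root_of r1) (root_of r2) (root_of t)"
proof -
  let ?C = "convex_cone hull (root_of ` (P \<inter> reflections))"
  have C: "convex_cone ?C" by (rule convex_cone_convex_cone_hull)
  show r: "r1 \<noteq> r2" "r1 \<in> P \<inter> reflections" "r2 \<in> P \<inter> reflections"
    using can by (auto simp: canonical_labeling_def canonical_generators_def)
  have face: "(conic hull {root_of r1}) face_of ?C" "(conic hull {root_of r2}) face_of ?C"
    using can by (auto simp: canonical_labeling_def canonical_generators_def)
  assume t: "t \<in> P \<inter> reflections"
  then obtain a b where ab: "root_of t = a *\<^sub>R root_of r1 + b *\<^sub>R root_of r2"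
    using flatD[OF assms(1) r(2,3,1)] span_pair_iff by blast
  have nn: "nonneg (root_of r1)" "nonneg (root_of r2)" "nonneg (root_of t)" "is_root (root_of t)"
    using r t root_of_nonneg root_of_is_root by auto
  have inC: "c \<ge> 0 \<Longrightarrow> u \<in> P \<inter> reflections \<Longrightarrow> c *\<^sub>R root_of u \<in> ?C" for c u
    using C by (intro convex_cone_scaleR) (auto intro: hull_inc)
  have not_both: "\<not> (a \<le> 0 \<and> b \<le> 0)"
  proof
    assume "a \<le> 0 \<and> b \<le> 0"
    then have "nonneg ((- a) *\<^sub>R root_of r1 + (- b) *\<^sub>R root_of r2)"
      using nn by (intro nonneg_add nonneg_scale) auto
    then have "nonneg (- root_of t)" by (simp add: ab)
    then show False using is_root_not_both nn by blast
  qed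
  have "a \<ge> 0"
  proof (rule ccontr)
    assume "\<not> a \<ge> 0"
    then have b: "a < 0" "b > 0" using not_both by auto
    have "(- a) *\<^sub>R root_of r1 + root_of t = b *\<^sub>R root_of r2" by (simp add: ab)
    then have "(- a) *\<^sub>R root_of r1 + root_of t \<in> conic hull {root_of r2}"
      using b unfolding mem_ray_iff by (metis less_imp_le)
    then have "(- a) *\<^sub>R root_of r1 \<in> conic hull {root_of r2}"
      using face(2)[unfolded ray_face_of_iff[OF C]] inC[of "- a" r1] inC[of 1 t] b r t by auto
    then show False using not_in_ray[of r1 r2 "- a"] r b by auto
  qed
  moreover have "b \<ge> 0"
  proof (rule ccontr)
    assume "\<not> b \<ge> 0"
    then have b: "b < 0" "a > 0" using not_both by auto
    have "(- b) *\<^sub>R root_of r2 + root_of t = a *\<^sub>R root_of r1" by (simp add: ab)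
    then have "(- b) *\<^sub>R root_of r2 + root_of t \<in> conic hull {root_of r1}"
      using b unfolding mem_ray_iff by (metis less_imp_le)
    then have "(- b) *\<^sub>R root_of r2 \<in> conic hull {root_of r1}"
      using face(1)[unfolded ray_face_of_iff[OF C]] inC[of "- b" r2] inC[of 1 t] b r t by auto
    then show False using not_in_ray[of r2 r1 "- b"] r b by auto
  qed
  ultimately show "in_cone (root_of r1) (root_of r2) (root_of t)"
    using ab by (auto simp: in_cone_def)
qed

lemma ray_face_of_cone:
  assumes r: "r1 \<in> reflections" "r2 \<in> reflections" "r1 \<noteq> r2" and C: "convex_cone C"
    and C1: "root_of r1 \<in> C" and sub: "\<And>v. v \<in> C \<Longrightarrow> in_cone (root_of r1) (root_of r2) v"
  shows "(conic hull {root_of r1}) face_of C"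
  unfolding ray_face_of_iff[OF C]
proof (intro conjI ballI impI)
  show "conic hull {root_of r1} \<subseteq> C"
    using C C1 by (auto simp: mem_ray_iff intro: convex_cone_scaleR)
  fix a b assume ab: "a \<in> C" "b \<in> C" "a + b \<in> conic hull {root_of r1}"
  obtain p q p' q' where pq: "p \<ge> 0" "q \<ge> 0" "p' \<ge> 0" "q' \<ge> 0"
    "a = p *\<^sub>R root_of r1 + q *\<^sub>R root_of r2" "b = p' *\<^sub>R root_of r1 + q' *\<^sub>R root_of r2"
    using sub[OF ab(1)] sub[OF ab(2)] unfolding in_cone_def by blast
  obtain c where "a + b = c *\<^sub>R root_of r1" using ab by (auto simp: mem_ray_iff)
  then have "(p + p') *\<^sub>R root_of r1 + (q + q') *\<^sub>R root_of r2 = c *\<^sub>R root_of r1 + 0 *\<^sub>R root_of r2"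
    by (simp add: pq algebra_simps)
  then have "q + q' = 0" using roots_coordinates_unique[OF r] by blast
  then have "q = 0" using pq by linarith
  then show "a \<in> conic hull {root_of r1}" using pq by (auto simp: mem_ray_iff)
qed

text \<open>The criterion by which canonical generators are recognized. A third extreme ray is
  impossible, since its root would be a sum with a nonzero part on the ray of
  \<open>r1\<close>.\<close>

lemma canonical_labelingI:
  assumes r: "r1 \<noteq> r2" "r1 \<in> P \<inter> reflections" "r2 \<in> P \<inter> reflections"
    and cone: "\<And>t. t \<in> P \<inter> reflections \<Longrightarrow> in_cone (root_of r1) (root_of r2) (root_of t)"
  shows "canonical_labeling P r1 r2"
proof -
  let ?C = "convex_cone hull (root_of ` (P \<inter> reflections))"
  have C: "convex_cone ?C" by (rule convex_cone_convex_cone_hull)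
  have "?C \<subseteq> {v. in_cone (root_of r1) (root_of r2) v}"
    using cone convex_cone_in_cone by (intro hull_minimal) auto
  then have sub: "v \<in> ?C \<Longrightarrow> in_cone (root_of r1) (root_of r2) v" for v by blast
  have inC: "c \<ge> 0 \<Longrightarrow> u \<in> P \<inter> reflections \<Longrightarrow> c *\<^sub>R root_of u \<in> ?C" for c u
    using C by (intro convex_cone_scaleR) (auto intro: hull_inc)
  have face1: "(conic hull {root_of r1}) face_of ?C"
    using r C inC[of 1 r1] sub by (intro ray_face_of_cone[of r1 r2]) auto
  have face2: "(conic hull {root_of r2}) face_of ?C"
    using r C inC[of 1 r2] sub
    by (intro ray_face_of_cone[of r2 r1]) (auto intro: in_cone_sym)
  have "t = r1 \<or> t = r2"
    if t: "t \<in> P \<inter> reflections" and face: "(conic hull {root_of t}) face_of ?C" for t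
  proof (rule ccontr)
    assume neq: "\<not> ?thesis"
    obtain p q where pq: "p \<ge> 0" "q \<ge> 0" "root_of t = p *\<^sub>R root_of r1 + q *\<^sub>R root_of r2"
      using cone[OF t] by (auto simp: in_cone_def)
    have "p \<noteq> 0" using root_of_inj[of t r2 q] pq neq t r by auto
    then have "p > 0" using pq by simp
    have "p *\<^sub>R root_of r1 + q *\<^sub>R root_of r2 \<in> conic hull {root_of t}"
      using pq(3) unfolding mem_ray_iff by (intro exI[of _ 1]) simp
    then have "p *\<^sub>R root_of r1 \<in> conic hull {root_of t}"
      using face[unfolded ray_face_of_iff[OF C]] inC[of p r1] inC[of q r2] r pq(1,2) by blast
    then show False using not_in_ray[of r1 t p] \<open>p > 0\<close> neq r t by auto
  qed
  then have "canonical_generators P = {r1, r2}"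
    unfolding canonical_generators_def using r face1 face2 by blast
  then show ?thesis using r by (simp add: canonical_labeling_def)
qed

end

text \<open>Up to a positive factor, the coordinates of an indexed reflection's root in the basis
  \<open>unit r1\<close>, \<open>unit r2\<close>. Counting from the end \<open>r2\<close> exchanges
  the two entries.\<close>

fun dihedral_coord :: "real \<Rightarrow> dihedral_index \<Rightarrow> real \<times> real" where
  "dihedral_coord \<kappa> (Fin i) = (cheb \<kappa> i, cheb \<kappa> (i - 1))"
| "dihedral_coord \<kappa> (Inf_minus k) = (cheb \<kappa> k, cheb \<kappa> (Suc k))"

context coxeter_root_datum
begin

definition unit :: "'a \<Rightarrow> ('a \<Rightarrow>\<^sub>0 real)"
  where "unit t = (1 / sqrt (bil (root_of t) (root_of t))) *\<^sub>R root_of t"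

text \<open>The counterpart of \<open>kappa\<close> for arbitrary reflections. The factor 2
  compensates that \<open>unit t\<close> has square 1 under \<open>bil\<close>, whereas
  \<open>unit_root s\<close> has square 2.\<close>

definition kap :: "'a \<Rightarrow> 'a \<Rightarrow> real"
  where "kap t u = - 2 * bil (unit t) (unit u)"

lemma kap_sym: "kap t u = kap u t"
  by (simp add: kap_def bil_sym)

lemma bil_unit: "t \<in> reflections \<Longrightarrow> bil (unit t) (unit t) = 1"
  using root_of_bil_pos[of t] by (simp add: unit_def bil_simps)

lemma act_reflection_unit:
  "t \<in> reflections \<Longrightarrow> act t v = v - (2 * bil (unit t) v) *\<^sub>R unit t"
proof -
  assume t: "t \<in> reflections"
  have "act t v = reflect (unit t) v"
    using root_of_bil_pos[OF t] t by (simp add: unit_def reflect_scale act_reflection)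
  then show ?thesis using bil_unit[OF t] by (simp add: reflect_def)
qed

lemma unit_scale: 
  assumes "t \<in> reflections" obtains c where "c > 0" "unit t = c *\<^sub>R root_of t"
  using root_of_bil_pos[OF assms] that[of "1 / sqrt (bil (root_of t) (root_of t))"]
  by (simp add: unit_def)

lemma root_of_unit: 
  assumes "t \<in> reflections" obtains c where "c > 0" "root_of t = c *\<^sub>R unit t"
  using root_of_bil_pos[OF assms] that[of "sqrt (bil (root_of t) (root_of t))"]
  by (simp add: unit_def)

lemma dihedral_refl_Suc:
  assumes "t \<in> reflections" "u \<in> reflections"
  shows "dihedral_refl W t u (Fin (Suc (Suc k))) = t \<otimes> dihedral_refl W u t (Fin (Suc k)) \<otimes> t"
proof -
  have c: "t \<in> carrier W" "u \<in> carrier W" using assms reflections_closed by auto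
  have "(t \<otimes> u) [^] j \<otimes> t = t \<otimes> (u \<otimes> t) [^] j" for j :: nat
  proof (induction j)
    case (Suc j)
    have "(t \<otimes> u) [^] Suc j \<otimes> t = (t \<otimes> u) \<otimes> ((t \<otimes> u) [^] j \<otimes> t)"
      using c by (subst nat_pow_Suc2) (auto simp: m_assoc)
    also have "\<dots> = t \<otimes> ((u \<otimes> t) \<otimes> (u \<otimes> t) [^] j)"
      using c by (simp add: Suc m_assoc)
    also have "(u \<otimes> t) \<otimes> (u \<otimes> t) [^] j = (u \<otimes> t) [^] Suc j"
      using c by (subst nat_pow_Suc2) auto
    finally show ?case .
  qed (use c in simp)
  from this[of "Suc k"] show ?thesis
    using c by (simp add: m_assoc)
qed

text \<open>Conjugation by \<open>t\<close> performs one step of the Chebyshev recursion, with the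
  generators exchanged. The sign of the factor stays open here, since the signs of the coefficients
  are only obtained later from the signs of roots.\<close>

lemma dihedral_root:
  assumes "t \<in> reflections" "u \<in> reflections"
  shows "dihedral_refl W t u (Fin (Suc k)) \<in> reflections \<and>
    (\<exists>c. c \<noteq> 0 \<and> root_of (dihedral_refl W t u (Fin (Suc k))) =
      c *\<^sub>R (cheb (kap t u) (Suc k) *\<^sub>R unit t + cheb (kap t u) k *\<^sub>R unit u))"
  using assms
proof (induction k arbitrary: t u)
  case 0
  obtain c where "c > 0" "root_of t = c *\<^sub>R unit t" using root_of_unit 0 by blast
  then have "c \<noteq> 0 \<and> root_of t = c *\<^sub>R (1 *\<^sub>R unit t + 0 *\<^sub>R unit u)" by simp
  then show ?case using 0 reflections_closed by auto
next
  case (Suc k)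
  let ?v = "dihedral_refl W u t (Fin (Suc k))"
  obtain c where c: "c \<noteq> 0" "root_of ?v =
      c *\<^sub>R (cheb (kap u t) (Suc k) *\<^sub>R unit u + cheb (kap u t) k *\<^sub>R unit t)"
    and v: "?v \<in> reflections"
    using Suc by blast
  have tc: "t \<in> carrier W" "inv t = t" using Suc.prems reflections_closed reflection_sq by auto
  have eq: "dihedral_refl W t u (Fin (Suc (Suc k))) = t \<otimes> ?v \<otimes> inv t"
    using dihedral_refl_Suc Suc.prems tc by simp
  have "act t (unit t) = - unit t" "act t (unit u) = unit u + kap t u *\<^sub>R unit t"
    using Suc.prems bil_unit by (simp_all add: act_reflection_unit kap_def scaleR_2)
  then have "act t (root_of ?v) =
      c *\<^sub>R (cheb (kap t u) (Suc (Suc k)) *\<^sub>R unit t + cheb (kap t u) (Suc k) *\<^sub>R unit u)"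
    unfolding c(2) kap_sym[of u t] by (simp add: act_simps algebra_simps)
  then have "root_of (t \<otimes> ?v \<otimes> inv t) =
      c *\<^sub>R (cheb (kap t u) (Suc (Suc k)) *\<^sub>R unit t + cheb (kap t u) (Suc k) *\<^sub>R unit u) \<or>
     root_of (t \<otimes> ?v \<otimes> inv t) =
      (- c) *\<^sub>R (cheb (kap t u) (Suc (Suc k)) *\<^sub>R unit t + cheb (kap t u) (Suc k) *\<^sub>R unit u)"
    using root_of_conj(1)[OF v tc(1)] by (simp del: cheb.simps)
  then show ?case
    using c(1) conj_closed[OF v tc(1)] unfolding eq by (metis neg_equal_0_iff_equal)
qed

end

section \<open>Dihedral subgroups with labeled canonical generators\<close>

locale dihedral_flat = coxeter_root_datum +
  fixes P :: "'a set" and r1 r2 :: 'a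
  assumes flat: "flat P" and labeling: "canonical_labeling P r1 r2"
    and noncomm: "r1 \<otimes> r2 \<noteq> r2 \<otimes> r1"
begin

lemma r12: "r1 \<noteq> r2" "r1 \<in> P" "r2 \<in> P" "r1 \<in> reflections" "r2 \<in> reflections"
    "r1 \<in> carrier W" "r2 \<in> carrier W"
  using canonical_labelingD[OF flat labeling] reflections_closed by auto

lemma sym_flat: "dihedral_flat W S A \<delta> P r2 r1"
  using flat labeling noncomm
  by unfold_locales (auto simp: canonical_labeling_def insert_commute)

text \<open>Reflections in orthogonal roots commute, by faithfulness of the action.\<close>

lemma kap_neq_0: "kap r1 r2 \<noteq> 0"
proof
  assume "kap r1 r2 = 0"
  then have "bil (unit r1) (unit r2) = 0" "bil (unit r2) (unit r1) = 0"
    by (simp_all add: kap_def bil_sym[of "unit r2"])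
  then have "act (r1 \<otimes> r2) = act (r2 \<otimes> r1)"
    using r12 by (intro ext) (simp add: act_mult act_reflection_unit bil_simps)
  then show False using act_faithful noncomm r12 by blast
qed

text \<open>A root in the plane belongs to \<open>P\<close> up to sign, and roots of
  \<open>P\<close> lie in the canonical cone. This is the source of all sign information on
  Chebyshev values.\<close>

lemma combination_sign:
  assumes "t \<in> reflections" "root_of t = c *\<^sub>R (p *\<^sub>R unit r1 + q *\<^sub>R unit r2)" "c \<noteq> 0"
  shows "t \<in> P" "p \<ge> 0 \<and> q \<ge> 0 \<or> p \<le> 0 \<and> q \<le> 0"
proof -
  obtain a b where a: "a > 0" "unit r1 = a *\<^sub>R root_of r1" and b: "b > 0" "unit r2 = b *\<^sub>R root_of r2"
    using unit_scale r12 by metis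
  have eq: "root_of t = (c * p * a) *\<^sub>R root_of r1 + (c * q * b) *\<^sub>R root_of r2"
    using assms a b by (simp add: algebra_simps)
  then have "t \<in> P \<inter> reflections"
    using flatD[OF flat, of r1 r2] r12 assms span_pair_iff by blast
  then show "t \<in> P" by blast
  obtain p' q' where pq: "p' \<ge> 0" "q' \<ge> 0" "root_of t = p' *\<^sub>R root_of r1 + q' *\<^sub>R root_of r2"
    using canonical_labelingD(4)[OF flat labeling] \<open>t \<in> P \<inter> reflections\<close> unfolding in_cone_def by blast
  then have "c * p * a \<ge> 0" "c * q * b \<ge> 0"
    using eq roots_coordinates_unique r12 by metis+
  then have "c * p \<ge> 0" "c * q \<ge> 0" using a b by (simp_all add: zero_le_mult_iff)
  then show "p \<ge> 0 \<and> q \<ge> 0 \<or> p \<le> 0 \<and> q \<le> 0"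
    using assms(3) by (auto simp: zero_le_mult_iff)
qed

text \<open>The second reflection has coordinates proportional to \<open>(kap r1 r2, 1)\<close>,
  which must agree in sign.\<close>

lemma kap_pos: "kap r1 r2 > 0"
proof -
  have "dihedral_refl W r1 r2 (Fin (Suc (Suc 0))) \<in> reflections"
    using dihedral_root[of r1 r2 "Suc 0"] r12 by blast
  moreover obtain c where "c \<noteq> 0" "root_of (dihedral_refl W r1 r2 (Fin (Suc (Suc 0)))) =
      c *\<^sub>R (kap r1 r2 *\<^sub>R unit r1 + 1 *\<^sub>R unit r2)"
    using dihedral_root[of r1 r2 "Suc 0"] r12 by auto
  ultimately show ?thesis
    using combination_sign(2) kap_neq_0 by fastforce
qed

lemma bil_neg: "bil (root_of r1) (root_of r2) < 0"
proof -
  obtain a b where a: "a > 0" "unit r1 = a *\<^sub>R root_of r1" and b: "b > 0" "unit r2 = b *\<^sub>R root_of r2"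
    using unit_scale r12 by metis
  then have "a * b * bil (root_of r1) (root_of r2) < 0"
    using kap_pos by (simp add: kap_def bil_simps)
  then show ?thesis using a b by (simp add: mult_less_0_iff)
qed

text \<open>The power is \<open>dihedral_refl W r1 r2 (Fin (Suc k))\<close> times \<open>r2\<close>,
  so it is trivial iff that reflection is \<open>r2\<close>, that is, iff the first coordinate of
  its root vanishes.\<close>

lemma power_eq_one_iff: "(r1 \<otimes> r2) [^] Suc k = \<one> \<longleftrightarrow> cheb (kap r1 r2) (Suc k) = 0"
proof -
  let ?u = "dihedral_refl W r1 r2 (Fin (Suc k))"
  obtain c where c: "c \<noteq> 0" "root_of ?u =
      c *\<^sub>R (cheb (kap r1 r2) (Suc k) *\<^sub>R unit r1 + cheb (kap r1 r2) k *\<^sub>R unit r2)"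
    and u: "?u \<in> reflections"
    using dihedral_root[OF r12(4,5)] by blast
  obtain a b where a: "a > 0" "unit r1 = a *\<^sub>R root_of r1" and b: "b > 0" "unit r2 = b *\<^sub>R root_of r2"
    using unit_scale r12 by metis
  have eq: "root_of ?u = (c * cheb (kap r1 r2) (Suc k) * a) *\<^sub>R root_of r1
      + (c * cheb (kap r1 r2) k * b) *\<^sub>R root_of r2"
    using c a b by (simp add: algebra_simps)
  have "(r1 \<otimes> r2) [^] Suc k = ?u \<otimes> r2"
    using r12 by (simp add: m_assoc)
  then have "(r1 \<otimes> r2) [^] Suc k = \<one> \<longleftrightarrow> ?u \<otimes> r2 = \<one>" by simp
  also have "\<dots> \<longleftrightarrow> ?u = r2"
    using r12 u reflections_closed reflection_sq by (metis inv_equality)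
  also have "\<dots> \<longleftrightarrow> cheb (kap r1 r2) (Suc k) = 0"
  proof
    assume "?u = r2"
    then have "(c * cheb (kap r1 r2) (Suc k) * a) *\<^sub>R root_of r1
      + (c * cheb (kap r1 r2) k * b) *\<^sub>R root_of r2 = 0 *\<^sub>R root_of r1 + 1 *\<^sub>R root_of r2"
      using eq by simp
    then have "c * cheb (kap r1 r2) (Suc k) * a = 0"
      using roots_coordinates_unique r12 by blast
    then show "cheb (kap r1 r2) (Suc k) = 0" using a c by simp
  next
    assume "cheb (kap r1 r2) (Suc k) = 0"
    then have "root_of ?u = (c * cheb (kap r1 r2) k * b) *\<^sub>R root_of r2" using eq by simp
    then show "?u = r2" using root_of_inj u r12 by blast
  qed
  finally show ?thesis .
qed

abbreviation "m \<equiv> ord (r1 \<otimes> r2)"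

text \<open>By induction, with \<open>combination_sign\<close> the next value cannot be negative
  once the previous one is positive. It cannot vanish either, as then a positive power of
  \<open>r1 \<otimes> r2\<close> below its order would be trivial.\<close>

lemma cheb_pos: "m = 0 \<or> Suc k < m \<Longrightarrow> cheb (kap r1 r2) (Suc k) > 0"
proof (induction k)
  case (Suc k)
  then have pos: "cheb (kap r1 r2) (Suc k) > 0" by auto
  have "(r1 \<otimes> r2) [^] Suc (Suc k) \<noteq> \<one>"
  proof
    assume one: "(r1 \<otimes> r2) [^] Suc (Suc k) = \<one>"
    have "m dvd Suc (Suc k)"
      using one r12 pow_eq_id[of "r1 \<otimes> r2" "Suc (Suc k)"] by (simp del: nat_pow_Suc)
    then show False using Suc.prems by (auto dest: dvd_imp_le)
  qed
  then have "cheb (kap r1 r2) (Suc (Suc k)) \<noteq> 0"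
    using power_eq_one_iff by blast
  moreover have "cheb (kap r1 r2) (Suc (Suc k)) \<ge> 0"
    using dihedral_root[OF r12(4,5), of "Suc k"] combination_sign(2) pos
    by (metis not_less order_antisym_conv linorder_not_le)
  ultimately show ?case by simp
qed simp

lemma cheb_m: "m \<noteq> 0 \<Longrightarrow> cheb (kap r1 r2) m = 0"
  using power_eq_one_iff[of "m - 1"] pow_ord_eq_1[of "r1 \<otimes> r2"] r12 by simp

lemma cheb_nonneg: "m = 0 \<or> k \<le> m \<Longrightarrow> cheb (kap r1 r2) k \<ge> 0"
  using cheb_pos[of "k - 1"] cheb_m by (cases k; cases "k = m") (auto simp: less_imp_le)

lemma index_coord:
  assumes "i \<in> index_set m"
  shows "dihedral_refl W r1 r2 i \<in> P \<inter> reflections"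
    and "\<exists>c>0. root_of (dihedral_refl W r1 r2 i) =
      c *\<^sub>R (fst (dihedral_coord (kap r1 r2) i) *\<^sub>R unit r1 + snd (dihedral_coord (kap r1 r2) i) *\<^sub>R unit r2)"
proof -
  let ?u = "dihedral_refl W r1 r2 i"
  define p q where "p = fst (dihedral_coord (kap r1 r2) i)" and "q = snd (dihedral_coord (kap r1 r2) i)"
  have "\<exists>c. c \<noteq> 0 \<and> ?u \<in> reflections \<and> root_of ?u = c *\<^sub>R (p *\<^sub>R unit r1 + q *\<^sub>R unit r2) \<and> p \<ge> 0 \<and> q \<ge> 0"
  proof (cases i)
    case (Fin j)
    then obtain k where k: "j = Suc k" using assms by (cases j) (auto simp: index_set_def split: if_splits)
    then have "p \<ge> 0" "q \<ge> 0"
      using assms Fin cheb_nonneg by (auto simp: p_def q_def index_set_def split: if_splits)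
    then show ?thesis
      using dihedral_root[OF r12(4,5), of k] unfolding Fin k p_def q_def by auto
  next
    case (Inf_minus k)
    then have m0: "m = 0" using assms by (auto simp: index_set_def split: if_splits)
    then have pq: "p \<ge> 0" "q \<ge> 0"
      using Inf_minus cheb_nonneg by (auto simp: p_def q_def)
    have u: "?u = dihedral_refl W r2 r1 (Fin (Suc k))" using Inf_minus by simp
    obtain c where "c \<noteq> 0" "root_of ?u = c *\<^sub>R (q *\<^sub>R unit r2 + p *\<^sub>R unit r1)" "?u \<in> reflections"
      using dihedral_root[OF r12(5,4), of k] kap_sym[of r2 r1] Inf_minus unfolding u p_def q_def by auto
    then show ?thesis using pq by (auto simp: add.commute)
  qed
  then obtain c where c: "c \<noteq> 0" "?u \<in> reflections" "root_of ?u = c *\<^sub>R (p *\<^sub>R unit r1 + q *\<^sub>R unit r2)"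
    "p \<ge> 0" "q \<ge> 0" by blast
  then show "?u \<in> P \<inter> reflections" using combination_sign by blast
  \<comment> \<open>\<open>dihedral_root\<close> leaves the sign of the factor open; with
    nonnegative coordinates a nonpositive factor would make the negative of a positive root
    nonnegative.\<close>
  have "c > 0"
  proof (rule ccontr)
    assume "\<not> c > 0"
    have n: "nonneg (unit r1)" "nonneg (unit r2)"
      using r12 root_of_nonneg root_of_bil_pos unfolding unit_def
      by (auto intro!: nonneg_scale less_imp_le)
    then have "nonneg ((- c) *\<^sub>R (p *\<^sub>R unit r1 + q *\<^sub>R unit r2))"
      using c \<open>\<not> c > 0\<close> by (intro nonneg_scale nonneg_add) auto
    then have "nonneg (- root_of ?u)" using c by simp
    then show False using is_root_not_both root_of_is_root root_of_nonneg c(2) by blast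
  qed
  then show "\<exists>c>0. root_of ?u =
      c *\<^sub>R (fst (dihedral_coord (kap r1 r2) i) *\<^sub>R unit r1 + snd (dihedral_coord (kap r1 r2) i) *\<^sub>R unit r2)"
    using c by (auto simp: p_def q_def)
qed

text \<open>The index order is the angular order of the roots from \<open>r1\<close> to
  \<open>r2\<close>. Two indices counted from the same end reduce to \<open>cheb_det\<close>, one
  from each end to \<open>cheb_add\<close>.\<close>

lemma index_det:
  assumes "i \<in> index_set m" "j \<in> index_set m" "index_less i j"
  shows "fst (dihedral_coord (kap r1 r2) i) * snd (dihedral_coord (kap r1 r2) j) -
    snd (dihedral_coord (kap r1 r2) i) * fst (dihedral_coord (kap r1 r2) j) > 0"
proof -
  let ?S = "cheb (kap r1 r2)"
  have det: "?S (Suc a) * ?S (a + d) - ?S a * ?S (Suc (a + d)) = ?S d" for a d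
    using cheb_det[of "kap r1 r2" a d] by (simp add: mult.commute)
  show ?thesis
  proof (cases i)
    case (Fin i')
    then obtain a where a: "i' = Suc a" using assms by (cases i') (auto simp: index_set_def split: if_splits)
    show ?thesis
    proof (cases j)
      case (Fin j')
      define d where "d = j' - Suc a"
      have j': "j' = Suc (a + d)" "d > 0"
        using assms(3) \<open>i = Fin i'\<close> Fin a by (auto simp: d_def)
      have "m = 0 \<or> d < m" using assms(2) Fin j' by (auto simp: index_set_def split: if_splits)
      then have "?S d > 0" using cheb_pos[of "d - 1"] j' by simp
      then show ?thesis using det[of a d] Fin \<open>i = Fin i'\<close> j' a by (simp del: cheb.simps)
    next
      case (Inf_minus k)
      then have "m = 0" using assms by (auto simp: index_set_def split: if_splits)
      then have "?S (Suc (a + k)) > 0" using cheb_pos by blast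
      then show ?thesis
        using cheb_add[of "kap r1 r2" a k] Inf_minus Fin a by (simp del: cheb.simps)
    qed
  next
    case (Inf_minus k)
    then obtain k' where k': "j = Inf_minus k'" "k' < k" using assms(3) by (cases j) auto
    have "m = 0" using Inf_minus assms by (auto simp: index_set_def split: if_splits)
    define d where "d = k - k'"
    have d: "k = k' + d" "d > 0" using k' by (auto simp: d_def)
    then have "?S d > 0" using cheb_pos[of "d - 1"] \<open>m = 0\<close> by simp
    then show ?thesis
      using det[of k' d] Inf_minus k' d(1) by (simp add: mult.commute del: cheb.simps)
  qed
qed

end

section \<open>The form \<open>\<omega>\<close>\<close>

context coxeter_root_datum
begin

text \<open>For distinct \<open>cs\<close>, the product under \<open>K\<close> of the simple root of
  \<open>s\<close> with the part of \<open>u\<close> on the letters of \<open>cs\<close>. Adding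
  \<open>s\<close> at either end of \<open>cs\<close> changes \<omega> by terms in it.\<close>

definition cross :: "'a list \<Rightarrow> 'a \<Rightarrow> ('a \<Rightarrow>\<^sub>0 real) \<Rightarrow> real"
  where "cross cs s u = (\<Sum>j<length cs. coord u (cs ! j) * K_simple s (cs ! j))"

lemma cross_linear: 
  "cross cs s (u + v) = cross cs s u + cross cs s v"
  "cross cs s (c *\<^sub>R u) = c * cross cs s u"
  by (simp_all add: cross_def lookup_add algebra_simps sum.distrib sum_distrib_left)

lemma omega_Nil [simp]: "omega [] u v = 0"
  by (simp add: omega_def)

lemma omega_Cons:
  assumes "set (s # cs) \<subseteq> S"
  shows "omega (s # cs) u v =
    omega cs u v + coord v s * cross cs s u - coord u s * cross cs s v"
proof -
  have K: "K_simple (cs ! i) s = K_simple s (cs ! i)" if "i < length cs" for i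
    using assms that by (intro K_simple_sym) auto
  define F where "F i j = coord u ((s # cs) ! i) * coord v ((s # cs) ! j) *
    (if i > j then K_simple ((s # cs) ! i) ((s # cs) ! j)
     else if i = j then 0
     else - K_simple ((s # cs) ! i) ((s # cs) ! j))" for i j
  have "omega (s # cs) u v = (\<Sum>i<Suc (length cs). \<Sum>j<Suc (length cs). F i j)"
    by (simp add: omega_def F_def)
  also have "\<dots> = F 0 0 + (\<Sum>j<length cs. F 0 (Suc j)) + (\<Sum>i<length cs. F (Suc i) 0) +
      (\<Sum>i<length cs. \<Sum>j<length cs. F (Suc i) (Suc j))"
    by (simp add: sum.lessThan_Suc_shift sum.distrib del: sum.lessThan_Suc)
  also have "(\<Sum>i<length cs. \<Sum>j<length cs. F (Suc i) (Suc j)) = omega cs u v"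
    by (simp add: omega_def F_def cong: if_cong)
  also have "(\<Sum>j<length cs. F 0 (Suc j)) = - (coord u s * cross cs s v)"
    by (simp add: F_def cross_def sum_distrib_left sum_negf mult_ac)
  also have "(\<Sum>i<length cs. F (Suc i) 0) = coord v s * cross cs s u"
    by (simp add: F_def cross_def sum_distrib_left mult_ac K)
  also have "F 0 0 = 0" by (simp add: F_def)
  finally show ?thesis by simp
qed

text \<open>The correction of \<open>omega_Cons\<close> with opposite sign: moving \<open>s\<close>
  from the front to the back reverses its order with every other letter.\<close>

lemma omega_snoc:
  assumes "set (s # cs) \<subseteq> S"
  shows "omega (cs @ [s]) u v =
    omega cs u v + coord u s * cross cs s v - coord v s * cross cs s u"
proof -
  have K: "K_simple (cs ! i) s = K_simple s (cs ! i)" if "i < length cs" for i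
    using assms that by (intro K_simple_sym) auto
  define F where "F i j = coord u ((cs @ [s]) ! i) * coord v ((cs @ [s]) ! j) *
    (if i > j then K_simple ((cs @ [s]) ! i) ((cs @ [s]) ! j)
     else if i = j then 0
     else - K_simple ((cs @ [s]) ! i) ((cs @ [s]) ! j))" for i j
  let ?n = "length cs"
  have "omega (cs @ [s]) u v = (\<Sum>i<Suc ?n. \<Sum>j<Suc ?n. F i j)"
    by (simp add: omega_def F_def)
  also have "\<dots> = (\<Sum>i<?n. \<Sum>j<?n. F i j) + (\<Sum>i<?n. F i ?n) + (\<Sum>j<?n. F ?n j) + F ?n ?n"
    by (simp add: sum.distrib)
  also have "(\<Sum>i<?n. \<Sum>j<?n. F i j) = omega cs u v"
    by (simp add: omega_def F_def nth_append cong: if_cong)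
  also have "(\<Sum>i<?n. F i ?n) = - (coord v s * cross cs s u)"
    by (simp add: F_def cross_def sum_distrib_left sum_negf mult_ac nth_append K)
  also have "(\<Sum>j<?n. F ?n j) = coord u s * cross cs s v"
    by (simp add: F_def cross_def sum_distrib_left mult_ac nth_append)
  also have "F ?n ?n = 0" by (simp add: F_def)
  finally show ?thesis by simp
qed

lemma omega_skew: "set cs \<subseteq> S \<Longrightarrow> omega cs u v = - omega cs v u"
proof (induction cs)
  case (Cons s cs)
  then have "omega cs u v = - omega cs v u" by simp
  then show ?case unfolding omega_Cons[OF Cons.prems] by simp
qed simp

lemma omega_add_right: "set cs \<subseteq> S \<Longrightarrow> omega cs u (v + v') = omega cs u v + omega cs u v'"
proof (induction cs)
  case (Cons s cs)
  then have "omega cs u (v + v') = omega cs u v + omega cs u v'" by simp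
  then show ?case unfolding omega_Cons[OF Cons.prems] by (simp add: cross_linear lookup_add algebra_simps)
qed simp

lemma omega_scale_right: "set cs \<subseteq> S \<Longrightarrow> omega cs u (c *\<^sub>R v) = c * omega cs u v"
proof (induction cs)
  case (Cons s cs)
  then have "omega cs u (c *\<^sub>R v) = c * omega cs u v" by simp
  then show ?case unfolding omega_Cons[OF Cons.prems] by (simp add: cross_linear algebra_simps)
qed simp

lemma omega_simps:
  assumes "set cs \<subseteq> S"
  shows "omega cs u (v + v') = omega cs u v + omega cs u v'" "omega cs u (c *\<^sub>R v) = c * omega cs u v"
    "omega cs (v + v') u = omega cs v u + omega cs v' u" "omega cs (c *\<^sub>R v) u = c * omega cs v u"
    "omega cs u u = 0" "omega cs u (- v) = - omega cs u v" "omega cs (- v) u = - omega cs v u"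
    "omega cs u (v - v') = omega cs u v - omega cs u v'" "omega cs (v - v') u = omega cs v u - omega cs v' u"
proof -
  note skew = omega_skew[OF assms]
  show 1: "omega cs u (v + v') = omega cs u v + omega cs u v'" "omega cs u (c *\<^sub>R v) = c * omega cs u v" for u v v' c
    using omega_add_right omega_scale_right assms by auto
  show 2: "omega cs (v + v') u = omega cs v u + omega cs v' u" "omega cs (c *\<^sub>R v) u = c * omega cs v u" for u v v' c
    using 1 skew[of _ u] by simp_all
  show "omega cs u u = 0" using skew[of u u] by simp
  show 3: "omega cs u (- v) = - omega cs u v" "omega cs (- v) u = - omega cs v u" for u v
    using 1(2)[of u "- 1" v] 2(2)[of "- 1" v u] by simp_all
  show "omega cs u (v - v') = omega cs u v - omega cs u v'" "omega cs (v - v') u = omega cs v u - omega cs v' u"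
    using 1(1)[of u v "- v'"] 2(1)[of v "- v'" u] 3 by simp_all
qed

end

context dihedral_flat
begin

text \<open>On a plane a skew form is the determinant times its value on a basis, and
  \<open>index_det\<close> gives the sign of the determinant.\<close>

lemma omega_index:
  assumes cs: "set cs \<subseteq> S" and i: "i \<in> index_set m" and j: "j \<in> index_set m"
  shows "\<exists>d. omega cs (root_of (dihedral_refl W r1 r2 i)) (root_of (dihedral_refl W r1 r2 j)) =
      d * omega cs (root_of r1) (root_of r2) \<and> (index_less i j \<longrightarrow> d > 0)"
proof -
  let ?u = "dihedral_refl W r1 r2" and ?p = "\<lambda>i. fst (dihedral_coord (kap r1 r2) i)"
    and ?q = "\<lambda>i. snd (dihedral_coord (kap r1 r2) i)"
  obtain a where a: "a > 0" "unit r1 = a *\<^sub>R root_of r1" using unit_scale r12 by blast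
  obtain b where b: "b > 0" "unit r2 = b *\<^sub>R root_of r2" using unit_scale r12 by blast
  obtain c where c: "c > 0" "root_of (?u i) = c *\<^sub>R (?p i *\<^sub>R unit r1 + ?q i *\<^sub>R unit r2)"
    using index_coord(2)[OF i] by blast
  obtain d where d: "d > 0" "root_of (?u j) = d *\<^sub>R (?p j *\<^sub>R unit r1 + ?q j *\<^sub>R unit r2)"
    using index_coord(2)[OF j] by blast
  have "omega cs (root_of (?u i)) (root_of (?u j)) =
    (c * d * a * b * (?p i * ?q j - ?q i * ?p j)) * omega cs (root_of r1) (root_of r2)"
    unfolding c(2) d(2) a(2) b(2)
    using omega_skew[OF cs, of "root_of r2" "root_of r1"]
    by (simp add: omega_simps[OF cs] algebra_simps)
  moreover have "index_less i j \<Longrightarrow> c * d * a * b * (?p i * ?q j - ?q i * ?p j) > 0"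
    using index_det[OF i j] a b c d by simp
  ultimately show ?thesis by blast
qed

lemma m_neq_1: "m \<noteq> 1"
proof
  assume "m = 1"
  then have "r1 \<otimes> r2 = \<one>" using ord_eq_1 r12 by auto
  then show False using r12 reflection_sq inv_equality by metis
qed

lemma dihedral_last:
  assumes "m \<noteq> 0" shows "dihedral_refl W r1 r2 (Fin m) = r2"
proof -
  have "((r1 \<otimes> r2) [^] (m - 1) \<otimes> r1) \<otimes> r2 = (r1 \<otimes> r2) [^] Suc (m - 1)"
    using r12 by (simp add: m_assoc)
  also have "Suc (m - 1) = m" using assms by simp
  also have "(r1 \<otimes> r2) [^] m = \<one>" using r12 by simp
  finally have "inv r2 = (r1 \<otimes> r2) [^] (m - 1) \<otimes> r1"
    using r12 by (intro inv_equality) auto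
  then show ?thesis using r12 reflection_sq by simp
qed

lemma exists_omega_index:
  obtains i j where "i \<in> index_set m" "j \<in> index_set m" "index_less i j"
    "dihedral_refl W r1 r2 i = r1" "dihedral_refl W r1 r2 j = r2"
proof (cases "m = 0")
  case True
  then show ?thesis using that[of "Fin 1" "Inf_minus 0"] r12 by (auto simp: index_set_def)
next
  case False
  then have m: "m \<ge> 2" using m_neq_1 by linarith
  show ?thesis
    using that[of "Fin 1" "Fin m"] dihedral_last[OF False] m r12 by (auto simp: index_set_def)
qed

text \<open>The conditions over all pairs of indices collapse to a single value because
  \<open>r1\<close> and \<open>r2\<close> are themselves indexed reflections, in this order.\<close>

lemma omega_index_iff:
  assumes cs: "set cs \<subseteq> S"
  shows "(\<forall>i\<in>index_set m. \<forall>j\<in>index_set m. index_less i j \<longrightarrow>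
      omega cs (root_of (dihedral_refl W r1 r2 i)) (root_of (dihedral_refl W r1 r2 j)) > 0) \<longleftrightarrow>
      omega cs (root_of r1) (root_of r2) > 0"
    and "(\<forall>i\<in>index_set m. \<forall>j\<in>index_set m.
      omega cs (root_of (dihedral_refl W r1 r2 i)) (root_of (dihedral_refl W r1 r2 j)) = 0) \<longleftrightarrow>
      omega cs (root_of r1) (root_of r2) = 0"
  using exists_omega_index omega_index[OF cs] by (metis mult_pos_pos, metis mult_zero_right)

definition segment :: "'a set \<Rightarrow> bool"
  where "segment D \<longleftrightarrow> D = {} \<or> D = {r2} \<or>
    (\<exists>k\<ge>1. (m = 0 \<or> k \<le> m) \<and> D = (\<lambda>i. dihedral_refl W r1 r2 (Fin i)) ` {1..k})"

lemma Fin_index_iff: "Fin k \<in> index_set m \<longleftrightarrow> k \<ge> 1 \<and> (m = 0 \<or> k \<le> m)"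
  by (auto simp: index_set_def)

text \<open>Alignment for one fixed labeling. The inversion set is a parameter \<open>D\<close>, so
  that it can be transported by conjugation.\<close>

definition aligned_with :: "'a list \<Rightarrow> 'a set \<Rightarrow> bool"
  where "aligned_with cs D \<longleftrightarrow> omega cs (root_of r1) (root_of r2) > 0 \<and> segment D \<or>
     omega cs (root_of r1) (root_of r2) = 0 \<and> (D = {} \<or> is_singleton D)"

lemma aligned_with_iff:
  assumes cs: "set cs \<subseteq> S"
  shows "(let I = index_set (ord (r1 \<otimes> r2)); u = dihedral_refl W r1 r2; D = inversions w \<inter> P in
      (\<forall>i\<in>I. \<forall>j\<in>I. index_less i j \<longrightarrow> omega cs (root_of (u i)) (root_of (u j)) > 0) \<and>
        (D = {} \<or> D = {r2} \<or> (\<exists>k. Fin k \<in> I \<and> D = (u \<circ> Fin) ` {1..k}))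
      \<or>
      (\<forall>i\<in>I. \<forall>j\<in>I. omega cs (root_of (u i)) (root_of (u j)) = 0) \<and>
        (D = {} \<or> is_singleton D)) \<longleftrightarrow> aligned_with cs (inversions w \<inter> P)"
  unfolding Let_def omega_index_iff[OF cs] aligned_with_def segment_def Fin_index_iff
  by (simp add: comp_def conj_assoc)

end

context coxeter_root_datum
begin

abbreviation dihedral :: "'a set \<Rightarrow> 'a \<Rightarrow> 'a \<Rightarrow> bool"
  where "dihedral \<equiv> dihedral_flat W S A \<delta>"

abbreviation aligned_lab :: "'a list \<Rightarrow> 'a set \<Rightarrow> 'a \<Rightarrow> 'a \<Rightarrow> bool"
  where "aligned_lab cs D r1 r2 \<equiv> dihedral_flat.aligned_with W S A \<delta> r1 r2 cs D"

lemma aligned_wrt_iff: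
  assumes "dihedral P r1 r2" and cs: "set cs \<subseteq> S"
  shows "aligned_wrt cs w P \<longleftrightarrow>
    aligned_lab cs (inversions w \<inter> P) r1 r2 \<or> aligned_lab cs (inversions w \<inter> P) r2 r1"
proof -
  interpret d: dihedral_flat W S A \<delta> P r1 r2 by fact
  interpret e: dihedral_flat W S A \<delta> P r2 r1 by (rule d.sym_flat)
  have lab: "canonical_labeling P a b \<longleftrightarrow> a = r1 \<and> b = r2 \<or> a = r2 \<and> b = r1" for a b
    using d.labeling by (auto simp: canonical_labeling_def doubleton_eq_iff)
  show ?thesis
    unfolding aligned_wrt_def lab
    using d.aligned_with_iff[OF cs, of w] e.aligned_with_iff[OF cs, of w] by blast
qed

lemma noncommutativeD:
  assumes "flat P" "noncommutative P"
  obtains r1 r2 where "dihedral P r1 r2"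
proof -
  obtain r1 r2 where "canonical_labeling P r1 r2" "r1 \<otimes> r2 \<noteq> r2 \<otimes> r1"
    using assms unfolding noncommutative_def by blast
  then show ?thesis
    by (intro that[of r1 r2] dihedral_flat.intro[OF coxeter_root_datum_axioms]
        dihedral_flat_axioms.intro assms)
qed

end

section \<open>The recursion of sorting words\<close>

text \<open>Sortability in terms of positions: for distinct letters, a letter of one copy occurs in
  the previous copy iff the position \<open>n\<close> earlier is used.\<close>

definition periodic :: "nat \<Rightarrow> nat list \<Rightarrow> bool"
  where "periodic n ps \<longleftrightarrow> (\<forall>p. p + n \<in> set ps \<longrightarrow> p \<in> set ps)"

lemma lexord_map_mono:
  assumes "\<And>x y. f x < f y \<longleftrightarrow> x < (y::nat)" "\<And>x y. f x = f y \<longleftrightarrow> x = y"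
  shows "(map f xs, map f ys) \<in> lexord less_than \<longleftrightarrow> (xs, ys) \<in> lexord less_than"
proof (induction xs arbitrary: ys)
  case Nil
  then show ?case by (cases ys) auto
next
  case (Cons x xs)
  then show ?case using assms by (cases ys) auto
qed

lemma sorted_wrt_map_mono:
  assumes "\<And>x y. f x < f y \<longleftrightarrow> x < (y::nat)"
  shows "sorted_wrt (<) (map f xs) \<longleftrightarrow> sorted_wrt (<) xs"
  using assms by (simp add: sorted_wrt_map)

context coxeter_system
begin

text \<open>Without its first letter the periodic word of \<open>c\<close> is the periodic word of
  \<open>s c s\<close>.\<close>

lemma letter_at_Suc: "letter_at (s # cs) (Suc p) = letter_at (cs @ [s]) p"
  using mod_less_divisor[of "Suc (length cs)" p]
  by (auto simp: letter_at_def mod_Suc nth_append less_Suc_eq)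

lemma letter_at_0: "letter_at (s # cs) 0 = s"
  by (simp add: letter_at_def)

lemma blocks_decreasing_iff:
  assumes "distinct cs" "cs \<noteq> []"
  shows "(\<forall>j. block cs ps (Suc j) \<subseteq> block cs ps j) \<longleftrightarrow> periodic (length cs) ps"
proof
  let ?n = "length cs"
  have n: "?n > 0" using assms by simp
  {
    assume B: "\<forall>j. block cs ps (Suc j) \<subseteq> block cs ps j"
    show "periodic ?n ps"
      unfolding periodic_def
    proof (intro allI impI)
      fix p assume p: "p + ?n \<in> set ps"
      have "letter_at cs (p + ?n) \<in> block cs ps (Suc (p div ?n))"
        using p n unfolding block_def by (intro imageI) simp
      then have "letter_at cs p \<in> block cs ps (p div ?n)"
        using B by (auto simp: letter_at_def)
      then obtain p' where p': "p' \<in> set ps" "p' div ?n = p div ?n" "letter_at cs p' = letter_at cs p"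
        by (auto simp: block_def)
      then have "p' mod ?n = p mod ?n"
        using assms n by (simp add: letter_at_def nth_eq_iff_index_eq)
      then have "p' = p" using p'(2) by (metis div_mult_mod_eq)
      then show "p \<in> set ps" using p' by simp
    qed
  next
    assume per: "periodic ?n ps"
    show "\<forall>j. block cs ps (Suc j) \<subseteq> block cs ps j"
    proof (intro allI subsetI)
      fix j x assume "x \<in> block cs ps (Suc j)"
      then obtain p where p: "p \<in> set ps" "p div ?n = Suc j" "x = letter_at cs p"
        by (auto simp: block_def)
      then have "p \<ge> ?n" using n by (metis div_less not_less nat.distinct(1))
      then obtain q where q: "p = q + ?n" by (metis add.commute le_Suc_ex)
      then have "q \<in> set ps" using per p by (simp add: periodic_def)
      moreover have "q div ?n = j" "x = letter_at cs q"
        using p q n by (simp_all add: letter_at_def)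
      ultimately show "x \<in> block cs ps j" by (auto simp: block_def)
    qed
  }
qed

lemma reduced_word_one_iff: "reduced_word \<one> xs \<longleftrightarrow> xs = []"
  by (auto simp: reduced_word_def)

lemma c_sortable_one: "c_sortable cs \<one>"
  unfolding c_sortable_def sorting_positions_def reduced_subword_def reduced_word_one_iff
  by (intro exI[of _ "[]"]) (auto simp: block_def)

lemma reduced_word_Cons_iff:
  assumes "s \<in> S" "w \<in> carrier W" "Suc (cox_length (s \<otimes> w)) = cox_length w"
  shows "reduced_word w (s # ys) \<longleftrightarrow> reduced_word (s \<otimes> w) ys"
proof -
  have "s \<otimes> word_prod W ys = w \<longleftrightarrow> word_prod W ys = s \<otimes> w" if "ys \<in> lists S"
    using word_prod_S_closed[OF that] assms S_closed by auto
  then show ?thesis using assms by (auto simp: reduced_word_def)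
qed

lemma reduced_word_ConsD:
  assumes "reduced_word w (s # ys)"
  shows "s \<in> S" "w \<in> carrier W" "Suc (cox_length (s \<otimes> w)) = cox_length w"
proof -
  have ys: "ys \<in> lists S" and w: "w = s \<otimes> word_prod W ys" and l: "cox_length w = Suc (length ys)"
    and s: "s \<in> S"
    using assms by (auto simp: reduced_word_def)
  show "s \<in> S" by (rule s)
  show wc: "w \<in> carrier W" using ys w s S_closed by auto
  have "cox_length (s \<otimes> w) \<le> length ys"
    using cox_length_le[OF ys] w ys s by simp
  then show "Suc (cox_length (s \<otimes> w)) = cox_length w"
    using cox_length_simple_mult[OF wc s] l by linarith
qed

lemma exists_positions:
  assumes "ys \<in> lists (set cs)"
  shows "\<exists>ps. sorted_wrt (<) ps \<and> (\<forall>p\<in>set ps. k \<le> p) \<and> map (letter_at cs) ps = ys"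
  using assms
proof (induction ys arbitrary: k)
  case (Cons y ys)
  then obtain i where i: "i < length cs" "cs ! i = y"
    by (auto simp: in_set_conv_nth)
  \<comment> \<open>The next letter is taken from copy number \<open>k\<close>; thus
    \<open>k\<close> serves both as a lower bound for positions and as the number of a copy.\<close>
  define p where "p = k * length cs + i"
  have p: "k \<le> p" "letter_at cs p = y"
    using i by (auto simp: p_def letter_at_def trans_le_add1)
  obtain ps where "sorted_wrt (<) ps" "\<forall>q\<in>set ps. Suc p \<le> q" "map (letter_at cs) ps = ys"
    using Cons.IH[of "Suc p"] Cons.prems by auto
  then show ?case using p by (intro exI[of _ "p # ps"]) auto
qed simp

lemma map_Suc_conv:
  assumes "\<forall>p\<in>set ps. 0 < (p::nat)" obtains qs where "ps = map Suc qs"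
proof
  show "ps = map Suc (map (\<lambda>p. p - 1) ps)" using assms by (induction ps) auto
qed

lemma reduced_subword_shift_iff:
  assumes "s \<in> S" "w \<in> carrier W" "Suc (cox_length (s \<otimes> w)) = cox_length w"
  shows "reduced_subword (s # cs) w (0 # map Suc ps) \<longleftrightarrow> reduced_subword (cs @ [s]) (s \<otimes> w) ps"
proof -
  have eq: "map (letter_at (s # cs) \<circ> Suc) ps = map (letter_at (cs @ [s])) ps"
    by (simp add: letter_at_Suc)
  then show ?thesis
    unfolding reduced_subword_def
    using sorted_wrt_map_mono[of Suc ps] reduced_word_Cons_iff[OF assms]
    by (simp add: letter_at_0 eq)
qed

lemma reduced_subword_0:
  assumes "reduced_subword (s # cs) w (0 # ps)"
  obtains qs where "ps = map Suc qs"
  using assms map_Suc_conv[of ps] by (auto simp: reduced_subword_def)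

end

context coxeter_root_datum
begin

text \<open>Some reduced subword starts at position 0: \<open>s \<otimes> w\<close> has letters in
  \<open>set cs\<close> and \<open>s\<close> only, so the remaining periodic word contains a reduced
  word for it. The lexicographically first subword must therefore start at 0 as well.\<close>

lemma sorting_positions_descent:
  assumes s: "s \<in> S" and len: "Suc (cox_length (s \<otimes> w)) = cox_length w"
    and par: "parab (set (s # cs)) w" and sub: "set (s # cs) \<subseteq> S"
  shows "sorting_positions (s # cs) w ps \<longleftrightarrow>
    (\<exists>qs. ps = 0 # map Suc qs \<and> sorting_positions (cs @ [s]) (s \<otimes> w) qs)"
proof
  have w: "w \<in> carrier W" using par by (simp add: parab_def)
  note shift = reduced_subword_shift_iff[OF s w len]
  have lex: "(map Suc xs, map Suc ys) \<in> lexord less_than \<longleftrightarrow> (xs, ys) \<in> lexord less_than" for xs ys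
    by (rule lexord_map_mono) auto
  {
    assume P: "sorting_positions (s # cs) w ps"
    obtain ys where ys: "reduced_word (s \<otimes> w) ys" using exists_reduced s w S_closed by blast
    have "parab (set (s # cs)) (s \<otimes> w)"
      using par sub by (intro parab_mult[OF parab_simple[of s]]) auto
    then have "ys \<in> lists (set (cs @ [s]))"
      using parab_reduced[OF _ sub ys] by simp
    then obtain qs0 where qs0: "sorted_wrt (<) qs0" "map (letter_at (cs @ [s])) qs0 = ys"
      using exists_positions by blast
    then have "reduced_subword (cs @ [s]) (s \<otimes> w) qs0"
      using ys by (simp add: reduced_subword_def)
    then have "reduced_subword (s # cs) w (0 # map Suc qs0)" using shift by simp
    then have "ps = 0 # map Suc qs0 \<or> (ps, 0 # map Suc qs0) \<in> lexord less_than"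
      using P by (simp add: sorting_positions_def)
    moreover have "ps \<noteq> []"
      using P len by (auto simp: sorting_positions_def reduced_subword_def reduced_word_def)
    ultimately obtain ps1 where ps1: "ps = 0 # ps1" by (cases ps) auto
    moreover have red: "reduced_subword (s # cs) w ps" using P by (simp add: sorting_positions_def)
    ultimately obtain qs where qs: "ps1 = map Suc qs" using reduced_subword_0 by blast
    have "sorting_positions (cs @ [s]) (s \<otimes> w) qs"
      unfolding sorting_positions_def
    proof (intro conjI allI impI)
      show "reduced_subword (cs @ [s]) (s \<otimes> w) qs" using red shift ps1 qs by simp
      fix qs' assume "reduced_subword (cs @ [s]) (s \<otimes> w) qs'"
      then have "reduced_subword (s # cs) w (0 # map Suc qs')" using shift by simp
      then have "ps = 0 # map Suc qs' \<or> (ps, 0 # map Suc qs') \<in> lexord less_than"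
        using P by (simp add: sorting_positions_def)
      then show "qs = qs' \<or> (qs, qs') \<in> lexord less_than"
        using ps1 qs lex by (auto simp: inj_map_eq_map)
    qed
    then show "\<exists>qs. ps = 0 # map Suc qs \<and> sorting_positions (cs @ [s]) (s \<otimes> w) qs"
      using ps1 qs by blast
  next
    assume "\<exists>qs. ps = 0 # map Suc qs \<and> sorting_positions (cs @ [s]) (s \<otimes> w) qs"
    then obtain qs where qs: "ps = 0 # map Suc qs" "sorting_positions (cs @ [s]) (s \<otimes> w) qs" by blast
    show "sorting_positions (s # cs) w ps"
      unfolding sorting_positions_def
    proof (intro conjI allI impI)
      show "reduced_subword (s # cs) w ps"
        using qs shift by (simp add: sorting_positions_def)
      fix ps' assume ps': "reduced_subword (s # cs) w ps'"
      then have "ps' \<noteq> []"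
        using len by (auto simp: reduced_subword_def reduced_word_def)
      then obtain a ps1 where ps1: "ps' = a # ps1" by (cases ps') auto
      show "ps = ps' \<or> (ps, ps') \<in> lexord less_than"
      proof (cases "a = 0")
        case True
        then obtain qs' where qs': "ps1 = map Suc qs'" using ps' ps1 reduced_subword_0 by blast
        then have "reduced_subword (cs @ [s]) (s \<otimes> w) qs'" using ps' ps1 True shift by simp
        then have "qs = qs' \<or> (qs, qs') \<in> lexord less_than"
          using qs by (simp add: sorting_positions_def)
        then show ?thesis using qs ps1 qs' True lex by auto
      qed (use qs ps1 in simp)
    qed
  }
qed

text \<open>The new position 0 requires no earlier one, and it fulfils the requirement that position
  \<open>n\<close> would create.\<close>

lemma periodic_shift:
  assumes "n > 0" shows "periodic n (0 # map Suc qs) \<longleftrightarrow> periodic n qs"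
proof
  assume P: "periodic n (0 # map Suc qs)"
  show "periodic n qs"
    unfolding periodic_def
  proof (intro allI impI)
    fix p assume "p + n \<in> set qs"
    then have "Suc p + n \<in> set (0 # map Suc qs)" by simp
    then have "Suc p \<in> set (0 # map Suc qs)" using P unfolding periodic_def by blast
    then show "p \<in> set qs" by auto
  qed
next
  assume P: "periodic n qs"
  show "periodic n (0 # map Suc qs)"
    unfolding periodic_def
  proof (intro allI impI)
    fix p assume p: "p + n \<in> set (0 # map Suc qs)"
    show "p \<in> set (0 # map Suc qs)"
    proof (cases p)
      case (Suc q)
      then have "q + n \<in> set qs" using p by auto
      then show ?thesis using P Suc by (simp add: periodic_def)
    qed simp
  qed
qed

lemma c_sortable_descent:
  assumes s: "s \<in> S" and len: "Suc (cox_length (s \<otimes> w)) = cox_length w"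
    and par: "parab (set (s # cs)) w" and sub: "set (s # cs) \<subseteq> S" and dist: "distinct (s # cs)"
  shows "c_sortable (s # cs) w \<longleftrightarrow> c_sortable (cs @ [s]) (s \<otimes> w)"
proof -
  have "(\<forall>j. block (s # cs) ps (Suc j) \<subseteq> block (s # cs) ps j) \<longleftrightarrow> periodic (Suc (length cs)) ps"
    "(\<forall>j. block (cs @ [s]) ps (Suc j) \<subseteq> block (cs @ [s]) ps j) \<longleftrightarrow> periodic (Suc (length cs)) ps" for ps
    using blocks_decreasing_iff[of "s # cs" ps] blocks_decreasing_iff[of "cs @ [s]" ps] dist by auto
  then show ?thesis
    unfolding c_sortable_def
    by (auto simp: sorting_positions_descent[OF s len par sub] periodic_shift)
qed

end

section \<open>Renumbering positions when one letter is skipped\<close>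

locale position_gap =
  fixes k :: nat
  assumes k: "k > 0"
begin

text \<open>
  \<open>gap\<close> sends the \<open>p\<close>-th position not divisible by \<open>k + 1\<close> to its place in the full sequence, that is,
  positions of the word \<open>cs\<^sup>\<infinity>\<close> to positions of \<open>(s # cs)\<^sup>\<infinity>\<close>.
\<close>

definition gap :: "nat \<Rightarrow> nat" where "gap p = p + p div k + 1"

lemma gap_less: "gap p < gap q \<longleftrightarrow> p < q"
proof -
  have "p < q \<Longrightarrow> gap p < gap q" for p q
    unfolding gap_def using div_le_mono[of p q k] by linarith
  then show ?thesis by (metis nat_neq_iff less_asym)
qed

lemma gap_eq: "gap p = gap q \<longleftrightarrow> p = q"
  using gap_less by (metis nat_neq_iff)

lemma gap_add: "gap (p + k) = gap p + Suc k"
  using k by (simp add: gap_def)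

lemma gap_mod: "gap p mod Suc k = Suc (p mod k)"
proof -
  have "p = k * (p div k) + p mod k" by simp
  then have "gap p = Suc (p mod k) + p div k * Suc k" unfolding gap_def by (simp add: algebra_simps)
  moreover have "Suc (p mod k) < Suc k" using k by simp
  ultimately show ?thesis by (metis mod_less mod_mult_self1)
qed

lemma gap_surj:
  assumes "p mod Suc k \<noteq> 0" obtains q where "p = gap q"
proof
  define r where "r = p mod Suc k - 1"
  have r: "r < k" "p mod Suc k = Suc r"
    using assms mod_less_divisor[of "Suc k" p] unfolding r_def by linarith+
  have "gap (p div Suc k * k + r) = p div Suc k * Suc k + p mod Suc k"
    using r k by (simp add: gap_def)
  then show "p = gap (p div Suc k * k + r)" by (simp only: div_mult_mod_eq)
qed

lemma gap_map_surj:
  assumes "\<forall>p\<in>set ps. p mod Suc k \<noteq> 0" obtains qs where "ps = map gap qs"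
proof -
  have "\<forall>p\<in>set ps. \<exists>q. p = gap q" using assms gap_surj by metis
  then have "ps \<in> lists (range gap)" by auto
  then show ?thesis using that by (auto simp: lists_image)
qed

lemma gap_periodic: "periodic (Suc k) (map gap qs) \<longleftrightarrow> periodic k qs"
proof -
  have mem: "gap p \<in> set (map gap qs) \<longleftrightarrow> p \<in> set qs" for p by (auto simp: gap_eq)
  show ?thesis
  proof
    assume P: "periodic (Suc k) (map gap qs)"
    show "periodic k qs" unfolding periodic_def
      using P unfolding periodic_def by (metis gap_add mem)
  next
    assume P: "periodic k qs"
    show "periodic (Suc k) (map gap qs)" unfolding periodic_def
    proof (intro allI impI)
      fix p assume p: "p + Suc k \<in> set (map gap qs)"
      then obtain q where q: "p + Suc k = gap q" by auto
      then have "p mod Suc k \<noteq> 0" using gap_mod[of q] by (metis mod_add_self2 nat.distinct(1))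
      then obtain p' where p': "p = gap p'" using gap_surj by blast
      then have "p' + k \<in> set qs" using p mem gap_add by metis
      then show "p \<in> set (map gap qs)" using P p' mem unfolding periodic_def by blast
    qed
  qed
qed

end

context coxeter_root_datum
begin

lemma c_sortable_nondescent:
  assumes s: "s \<in> S" and len: "cox_length w < cox_length (s \<otimes> w)" and w: "w \<in> carrier W"
    and sub: "set (s # cs) \<subseteq> S" and dist: "distinct (s # cs)"
  shows "c_sortable (s # cs) w \<longleftrightarrow> parab (set cs) w \<and> c_sortable cs w"
proof -
  let ?k = "length cs"
  have blocks: "(\<forall>j. block (s # cs) ps (Suc j) \<subseteq> block (s # cs) ps j) \<longleftrightarrow> periodic (Suc ?k) ps" for ps
    using blocks_decreasing_iff[of "s # cs" ps] dist by auto
  have mod_0_iff: "p mod Suc ?k = 0 \<longleftrightarrow> letter_at (s # cs) p \<notin> set cs" for p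
  proof (cases "p mod Suc ?k")
    case (Suc i)
    moreover have "p mod Suc ?k < Suc ?k" by simp
    ultimately show ?thesis by (simp add: letter_at_def)
  qed (use dist in \<open>simp add: letter_at_def\<close>)
  have nonzero: "\<forall>p\<in>set ps. p mod Suc ?k \<noteq> 0"
    if ps: "reduced_subword (s # cs) w ps" and per: "periodic (Suc ?k) ps" for ps
  proof
    have 0: "0 \<notin> set ps"
    proof
      assume "0 \<in> set ps"
      then obtain ps' where ps': "ps = 0 # ps'"
        using ps by (cases ps) (auto simp: reduced_subword_def)
      then have "reduced_word w (s # map (letter_at (s # cs)) ps')"
        using ps by (simp add: reduced_subword_def letter_at_0)
      then show False using reduced_word_ConsD(3) len by fastforce
    qed
    have *: "j * Suc ?k \<notin> set ps" for j
    proof (induction j)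
      case (Suc j)
      have "Suc j * Suc ?k = j * Suc ?k + Suc ?k" by simp
      then show ?case using Suc per unfolding periodic_def by metis
    qed (use 0 in simp)
    fix p assume "p \<in> set ps"
    show "p mod Suc ?k \<noteq> 0"
    proof
      assume "p mod Suc ?k = 0"
      then have "p = p div Suc ?k * Suc ?k" using div_mult_mod_eq[of p "Suc ?k"] by simp
      then show False using *[of "p div Suc ?k"] \<open>p \<in> set ps\<close> by simp
    qed
  qed
  have letters: "map (letter_at (s # cs)) ps \<in> lists (set cs) \<longleftrightarrow> (\<forall>p\<in>set ps. p mod Suc ?k \<noteq> 0)" for ps
    by (auto simp: in_lists_conv_set mod_0_iff)
  have par: "parab (set cs) w" if "c_sortable (s # cs) w"
  proof -
    obtain ps where "reduced_subword (s # cs) w ps" "periodic (Suc ?k) ps"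
      using \<open>c_sortable (s # cs) w\<close> by (auto simp: c_sortable_def blocks sorting_positions_def)
    then have "map (letter_at (s # cs)) ps \<in> lists (set cs)"
      "word_prod W (map (letter_at (s # cs)) ps) = w"
      using nonzero letters by (auto simp: reduced_subword_def reduced_word_def)
    then show ?thesis using parab_word[of "map (letter_at (s # cs)) ps" "set cs"] sub by auto
  qed
  show ?thesis
  \<comment> \<open>\<open>gap\<close> divides by the length of \<open>cs\<close>, so the empty word
    is treated apart.\<close>
  proof (cases "cs = []")
    case True
    then have "w = \<one>" if "parab (set cs) w"
      using parab_iff[of "{}" w] that by auto
    then show ?thesis using par c_sortable_one by blast
  next
    case False
    then interpret position_gap ?k by unfold_locales simp
    have blocks': "(\<forall>j. block cs ps (Suc j) \<subseteq> block cs ps j) \<longleftrightarrow> periodic ?k ps" for ps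
      using blocks_decreasing_iff[of cs ps] dist False by auto
    have letter: "letter_at (s # cs) (gap p) = letter_at cs p" for p
      by (simp add: letter_at_def gap_mod)
    have red: "reduced_subword (s # cs) w (map gap qs) \<longleftrightarrow> reduced_subword cs w qs" for qs
    proof -
      have eq: "map (letter_at (s # cs) \<circ> gap) qs = map (letter_at cs) qs" by (simp add: letter)
      show ?thesis
        unfolding reduced_subword_def by (simp add: sorted_wrt_map_mono gap_less eq)
    qed
    have lex: "(map gap xs, map gap ys) \<in> lexord less_than \<longleftrightarrow> (xs, ys) \<in> lexord less_than" for xs ys
      by (rule lexord_map_mono) (auto simp: gap_less gap_eq)
    have inj: "map gap xs = map gap ys \<longleftrightarrow> xs = ys" for xs ys
      using gap_eq by (intro inj_map_eq_map injI) auto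
    have "sorting_positions (s # cs) w (map gap qs) \<longleftrightarrow> sorting_positions cs w qs"
      if P: "parab (set cs) w" for qs
    proof -
      have "\<exists>qs'. ps = map gap qs'" if "reduced_subword (s # cs) w ps" for ps
      proof -
        have "map (letter_at (s # cs)) ps \<in> lists (set cs)"
          using parab_reduced[OF P] sub that by (simp add: reduced_subword_def)
        then show ?thesis using letters gap_map_surj by metis
      qed
      then show ?thesis
        unfolding sorting_positions_def using red lex inj by metis
    qed
    then show ?thesis
      unfolding c_sortable_def blocks blocks'
      using par[unfolded c_sortable_def blocks] nonzero gap_map_surj gap_periodic
      by (metis sorting_positions_def)
  qed
qed

section \<open>The form under rotation and restriction of the word\<close>

lemma cross_eq_sum:
  assumes "distinct cs" shows "cross cs s u = (\<Sum>x\<in>set cs. coord u x * K_simple s x)"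
  unfolding cross_def
  using sum.reindex_bij_betw[OF bij_betw_nth[OF assms HOL.refl HOL.refl],
      of "\<lambda>x. coord u x * K_simple s x"] by simp

lemma pairing_cross:
  assumes "set (s # cs) \<subseteq> S" "distinct (s # cs)" "supported (set (s # cs)) u"
  shows "\<delta> s * pairing s u = 2 * \<delta> s * coord u s + cross cs s u"
proof -
  have "pairing s u = (\<Sum>x\<in>set (s # cs). A s x * coord u x)"
    unfolding pairing_def using assms finite_S
    by (intro sum.mono_neutral_right) (auto simp: supported_def)
  also have "\<dots> = 2 * coord u s + (\<Sum>x\<in>set cs. A s x * coord u x)"
    using assms A_diag by simp
  finally show ?thesis
    using assms by (simp add: cross_eq_sum K_simple_def algebra_simps sum_distrib_left)
qed

lemma omega_cong:
  assumes "\<And>x. x \<in> set cs \<Longrightarrow> coord u x = coord u' x"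
    "\<And>x. x \<in> set cs \<Longrightarrow> coord v x = coord v' x"
  shows "omega cs u v = omega cs u' v'"
  unfolding omega_def using assms by (intro sum.cong HOL.refl) simp

lemma cross_cong:
  assumes "\<And>x. x \<in> set cs \<Longrightarrow> coord u x = coord u' x"
  shows "cross cs s u = cross cs s u'"
  unfolding cross_def using assms by (intro sum.cong HOL.refl) simp

text \<open>Only the coordinate at \<open>s\<close> changes, and by \<open>pairing_cross\<close> it
  becomes its negative minus \<open>cross\<close> divided by \<delta>. The two products of
  \<open>cross\<close> values cancel, and the sign change is the difference between
  \<open>omega_snoc\<close> and \<open>omega_Cons\<close>.\<close>

lemma omega_rotate:
  assumes sub: "set (s # cs) \<subseteq> S" and dist: "distinct (s # cs)"
    and u: "supported (set (s # cs)) u" and v: "supported (set (s # cs)) v"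
  shows "omega (cs @ [s]) (simple_act s u) (simple_act s v) = omega (s # cs) u v"
proof -
  have d: "\<delta> s > 0" using sub \<delta>_pos by simp
  have look: "coord (simple_act s x) y = coord x y" if "y \<in> set cs" for x y
    using that dist by (auto simp: simple_act_pairing lookup_minus lookup_simple_root)
  have look_s: "\<delta> s * coord (simple_act s x) s = - \<delta> s * coord x s - cross cs s x"
    if "supported (set (s # cs)) x" for x
    using pairing_cross[OF sub dist that]
    by (simp add: simple_act_pairing lookup_minus lookup_simple_root algebra_simps)
  have om: "omega cs (simple_act s u) (simple_act s v) = omega cs u v"
    by (rule omega_cong) (simp_all add: look)
  have cr: "cross cs s (simple_act s x) = cross cs s x" for x
    by (rule cross_cong) (simp add: look)
  have "\<delta> s * omega (cs @ [s]) (simple_act s u) (simple_act s v) =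
    \<delta> s * omega cs u v + (\<delta> s * coord (simple_act s u) s) * cross cs s v
      - (\<delta> s * coord (simple_act s v) s) * cross cs s u"
    unfolding omega_snoc[OF sub] om cr by (simp add: algebra_simps)
  also have "\<dots> = \<delta> s * omega (s # cs) u v"
    unfolding look_s[OF u] look_s[OF v] omega_Cons[OF sub] by (simp add: algebra_simps)
  finally show ?thesis using d by simp
qed

lemma omega_Cons_restrict:
  assumes "set (s # cs) \<subseteq> S" "supported (set cs) u" "supported (set cs) v" "s \<notin> set cs"
  shows "omega (s # cs) u v = omega cs u v"
  unfolding omega_Cons[OF assms(1)] using assms by (simp add: supported_def)

lemma omega_initial:
  assumes "set (s # cs) \<subseteq> S" "s \<notin> set cs"
  shows "omega (s # cs) (simple_root s) v = - cross cs s v"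
proof -
  have cs: "set cs \<subseteq> S" using assms by simp
  have "omega cs (simple_root s) v = omega cs (0 *\<^sub>R simple_root s) v"
    "cross cs s (simple_root s) = cross cs s (0 *\<^sub>R simple_root s)"
    using assms by (auto intro!: omega_cong cross_cong simp: lookup_simple_root)
  then have "omega cs (simple_root s) v = 0" "cross cs s (simple_root s) = 0"
    by (simp_all only: omega_simps(4)[OF cs] cross_linear mult_zero_left)
  then show ?thesis
    unfolding omega_Cons[OF assms(1)] by (simp add: lookup_simple_root)
qed

text \<open>Off-diagonal values of \<open>K_simple\<close> are nonpositive, and a letter in front
  contributes them with a minus sign.\<close>

lemma omega_initial_nonneg:
  assumes "set (s # cs) \<subseteq> S" "s \<notin> set cs" "nonneg v"
  shows "omega (s # cs) (simple_root s) v \<ge> 0"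
proof -
  have "cross cs s v \<le> 0"
    unfolding cross_def
  proof (rule sum_nonpos)
    fix i assume "i \<in> {..<length cs}"
    then have "cs ! i \<in> S" "cs ! i \<noteq> s" using assms by (auto simp: subset_iff)
    then have "K_simple s (cs ! i) \<le> 0"
      using A_nonpos[of s "cs ! i"] \<delta>_pos[of s] assms(1) by (auto simp: K_simple_def mult_nonneg_nonpos)
    then show "coord v (cs ! i) * K_simple s (cs ! i) \<le> 0"
      using assms(3) by (simp add: nonneg_def mult_nonneg_nonpos)
  qed
  then show ?thesis using omega_initial assms by simp
qed

text \<open>Noncommuting canonical roots have negative product under \<open>bil\<close>. The
  coordinate at \<open>s\<close> contributes a nonnegative amount to it, so \<open>cross\<close> is
  strictly negative.\<close>

lemma omega_initial_pos:
  assumes "dihedral P s r" "set (s # cs) \<subseteq> S" "distinct (s # cs)"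
    "supported (set (s # cs)) (root_of r)"
  shows "omega (s # cs) (root_of s) (root_of r) > 0"
proof -
  interpret dihedral_flat W S A \<delta> P s r by fact
  have s: "s \<in> S" "root_of s = simple_root s" using assms root_of_simple by auto
  have "\<delta> s * pairing s (root_of r) < 0"
    using bil_neg s by (simp add: bil_simple_root)
  moreover have "coord (root_of r) s \<ge> 0"
    using root_of_nonneg r12 by (simp add: nonneg_def)
  then have "2 * \<delta> s * coord (root_of r) s \<ge> 0"
    using \<delta>_pos[OF s(1)] by simp
  ultimately have "cross cs s (root_of r) < 0"
    using pairing_cross[OF assms(2,3,4)] by linarith
  then show ?thesis using omega_initial assms s by simp
qed

end

section \<open>Alignment and conjugation by an initial letter\<close>

context dihedral_flat
begin

lemma dihedral_neq_first:
  assumes "k \<ge> 1" "m = 0 \<or> Suc k \<le> m"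
  shows "dihedral_refl W r1 r2 (Fin (Suc k)) \<noteq> r1"
proof
  assume eq: "dihedral_refl W r1 r2 (Fin (Suc k)) = r1"
  obtain c where c: "c \<noteq> 0" "root_of (dihedral_refl W r1 r2 (Fin (Suc k))) =
      c *\<^sub>R (cheb (kap r1 r2) (Suc k) *\<^sub>R unit r1 + cheb (kap r1 r2) k *\<^sub>R unit r2)"
    using dihedral_root[OF r12(4,5)] by blast
  obtain a where a: "a > 0" "unit r1 = a *\<^sub>R root_of r1" using unit_scale r12 by blast
  obtain b where b: "b > 0" "unit r2 = b *\<^sub>R root_of r2" using unit_scale r12 by blast
  have "(c * cheb (kap r1 r2) (Suc k) * a) *\<^sub>R root_of r1 + (c * cheb (kap r1 r2) k * b) *\<^sub>R root_of r2
      = 1 *\<^sub>R root_of r1 + 0 *\<^sub>R root_of r2"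
    using c(2) unfolding eq a(2) b(2) by (simp add: algebra_simps)
  then have "c * cheb (kap r1 r2) k * b = 0" using roots_coordinates_unique(2) r12 by blast
  then have "cheb (kap r1 r2) k = 0" using b c by simp
  moreover have "cheb (kap r1 r2) k > 0" using cheb_pos[of "k - 1"] assms by auto
  ultimately show False by simp
qed

text \<open>\<alpha>_s spans an extreme ray of the whole nonnegative orthant, so a canonical root
  that occurs in it with positive coefficient is proportional to it.\<close>

lemma canonical_simple:
  assumes "s \<in> S" "s \<in> P" shows "s = r1 \<or> s = r2"
proof (rule ccontr)
  assume neq: "\<not> ?thesis"
  have s: "s \<in> P \<inter> reflections" using assms simple_reflection by blast
  then obtain p q where pq: "p \<ge> 0" "q \<ge> 0" "root_of s = p *\<^sub>R root_of r1 + q *\<^sub>R root_of r2"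
    using canonical_labelingD(4)[OF flat labeling] unfolding in_cone_def by blast
  have "p \<noteq> 0" using root_of_inj[of s r2 q] pq neq s r12 by auto
  then have p: "p > 0" using pq by simp
  have "root_of r1 = coord (root_of r1) s *\<^sub>R root_of s"
  proof (rule poly_mapping_eqI)
    fix x
    show "coord (root_of r1) x =
        coord (coord (root_of r1) s *\<^sub>R root_of s) x"
    proof (cases "x = s")
      case False
      have "p * coord (root_of r1) x + q * coord (root_of r2) x = 0"
        using arg_cong[OF pq(3), of "\<lambda>v. coord v x"] False assms
        by (simp add: lookup_add root_of_simple lookup_simple_root)
      moreover have "p * coord (root_of r1) x \<ge> 0" "q * coord (root_of r2) x \<ge> 0"
        using pq root_of_nonneg r12 by (auto simp: nonneg_def)
      ultimately have "p * coord (root_of r1) x = 0" by linarith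
      then show ?thesis using p False assms by (simp add: root_of_simple lookup_simple_root)
    qed (use assms in \<open>simp add: root_of_simple lookup_simple_root\<close>)
  qed
  then show False using root_of_inj r12 s neq by blast
qed

lemma root_in_cone:
  assumes "t \<in> P" "t \<in> reflections"
  obtains p q where "p \<ge> 0" "q \<ge> 0" "root_of t = p *\<^sub>R root_of r1 + q *\<^sub>R root_of r2"
  using canonical_labelingD(4)[OF flat labeling] assms unfolding in_cone_def by blast

lemma inP_iff:
  "t \<in> reflections \<Longrightarrow> t \<in> P \<longleftrightarrow> root_of t \<in> span {root_of r1, root_of r2}"
  using flatD[OF flat, of r1 r2] r12 by blast

lemma P_carrier: "P \<subseteq> carrier W"
  using flat by (simp add: flat_def)

end

context coxeter_root_datum
begin

abbreviation cj :: "'a \<Rightarrow> 'a \<Rightarrow> 'a" where "cj s t \<equiv> s \<otimes> t \<otimes> s"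

lemma cj_cj: "s \<in> S \<Longrightarrow> t \<in> carrier W \<Longrightarrow> cj s (cj s t) = t"
  by (simp add: m_assoc S_closed simple_sq)

lemma cj_closed: "s \<in> S \<Longrightarrow> t \<in> carrier W \<Longrightarrow> cj s t \<in> carrier W"
  by (simp add: S_closed)

lemma cj_mult: "s \<in> S \<Longrightarrow> t \<in> carrier W \<Longrightarrow> u \<in> carrier W \<Longrightarrow> cj s t \<otimes> cj s u = cj s (t \<otimes> u)"
  by (simp add: m_assoc S_closed)

lemma cj_inj: "s \<in> S \<Longrightarrow> inj_on (cj s) (carrier W)"
  by (rule inj_onI) (metis cj_cj)

lemma cj_pow: 
  assumes "s \<in> S" "t \<in> carrier W" shows "cj s t [^] n = cj s (t [^] (n::nat))"
proof (induction n)
  case 0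
  show ?case using assms by (simp add: S_closed simple_sq)
next
  case (Suc n)
  have "cj s t [^] Suc n = cj s (t [^] n) \<otimes> cj s t" using Suc by simp
  also have "\<dots> = cj s (t [^] n \<otimes> t)" using assms cj_mult by simp
  finally show ?case by simp
qed

lemma cj_reflection: "s \<in> S \<Longrightarrow> t \<in> reflections \<Longrightarrow> cj s t \<in> reflections"
  using conj_closed[of t s] S_closed inv_simple by simp

lemma cj_neq: "s \<in> S \<Longrightarrow> t \<in> carrier W \<Longrightarrow> t \<noteq> s \<Longrightarrow> cj s t \<noteq> s"
  using cj_cj[of s t] by (metis S_closed l_one simple_sq)

lemma cj_image_iff:
  assumes "s \<in> S" "P \<subseteq> carrier W" "t \<in> carrier W"
  shows "t \<in> cj s ` P \<longleftrightarrow> cj s t \<in> P"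
proof
  assume "t \<in> cj s ` P"
  then obtain p where "p \<in> P" "t = cj s p" by blast
  then show "cj s t \<in> P" using cj_cj assms by auto
next
  assume "cj s t \<in> P"
  then have "cj s (cj s t) \<in> cj s ` P" by (rule imageI)
  then show "t \<in> cj s ` P" using cj_cj assms by simp
qed

lemma cj_ord: 
  assumes "s \<in> S" "t \<in> carrier W" shows "ord (cj s t) = ord t"
proof -
  have "cj s t [^] n = \<one> \<longleftrightarrow> t [^] n = \<one>" for n :: nat
  proof -
    have "cj s t [^] n = \<one> \<longleftrightarrow> cj s (t [^] n) = cj s \<one>"
      using assms cj_pow by (simp add: S_closed simple_sq)
    also have "\<dots> \<longleftrightarrow> t [^] n = \<one>"
      using inj_on_eq_iff[OF cj_inj[OF assms(1)]] assms by simp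
    finally show ?thesis .
  qed
  then have "ord (cj s t) dvd n \<longleftrightarrow> ord t dvd n" for n
    using pow_eq_id assms cj_closed by metis
  then show ?thesis by (meson dvd_antisym dvd_refl)
qed

lemma dihedral_refl_cj:
  assumes "s \<in> S" "a \<in> carrier W" "b \<in> carrier W"
  shows "dihedral_refl W (cj s a) (cj s b) (Fin i) = cj s (dihedral_refl W a b (Fin i))"
  using assms cj_mult cj_pow by simp

lemma rank_two_parabolic_cj:
  assumes "rank_two_parabolic P" "s \<in> S" shows "rank_two_parabolic (cj s ` P)"
proof -
  obtain x r t where x: "x \<in> carrier W" and rt: "r \<in> S" "t \<in> S" "r \<noteq> t"
    and P: "P = (\<lambda>y. x \<otimes> y \<otimes> inv x) ` generate W {r, t}"
    using assms unfolding rank_two_parabolic_def by blast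
  have gc: "generate W {r, t} \<subseteq> carrier W"
    using rt S_closed generate_incl[of "{r, t}"] by auto
  have "cj s ` P = (\<lambda>y. (s \<otimes> x) \<otimes> y \<otimes> inv (s \<otimes> x)) ` generate W {r, t}"
    unfolding P image_image using gc x assms(2) S_closed
    by (intro image_cong HOL.refl) (auto simp: inv_mult_group inv_simple m_assoc subset_iff)
  moreover have "s \<otimes> x \<in> carrier W" using x assms S_closed by simp
  ultimately show ?thesis unfolding rank_two_parabolic_def using rt by blast
qed

lemma simple_act_span_iff:
  assumes "s \<in> S"
  shows "simple_act s v \<in> span {a, b} \<longleftrightarrow> v \<in> span {simple_act s a, simple_act s b}"
proof -
  note l = linear_add[OF simple_act_linear] linear_scale[OF simple_act_linear]
  have "simple_act s v = p *\<^sub>R a + q *\<^sub>R b \<longleftrightarrow> v = p *\<^sub>R simple_act s a + q *\<^sub>R simple_act s b" for p q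
  proof
    assume "simple_act s v = p *\<^sub>R a + q *\<^sub>R b"
    then have "simple_act s (simple_act s v) = simple_act s (p *\<^sub>R a + q *\<^sub>R b)" by simp
    then show "v = p *\<^sub>R simple_act s a + q *\<^sub>R simple_act s b"
      using simple_act_invol[OF assms] by (simp add: l)
  next
    assume "v = p *\<^sub>R simple_act s a + q *\<^sub>R simple_act s b"
    then have "simple_act s v = simple_act s (p *\<^sub>R simple_act s a + q *\<^sub>R simple_act s b)" by simp
    then show "simple_act s v = p *\<^sub>R a + q *\<^sub>R b"
      using simple_act_invol[OF assms] by (simp add: l)
  qed
  then show ?thesis by (simp add: span_pair_iff)
qed

text \<open>As \<open>s \<notin> P\<close>, every positive root of \<open>P\<close> stays positive
  under \<open>s\<close>; hence the cone of \<open>P\<close> with its extreme rays is mapped onto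
  the cone of the conjugate.\<close>

lemma dihedral_flat_cj:
  assumes "dihedral P r1 r2" and s: "s \<in> S" "s \<notin> P"
  shows "dihedral (cj s ` P) (cj s r1) (cj s r2)"
proof -
  interpret d: dihedral_flat W S A \<delta> P r1 r2 by fact
  have neq: "r1 \<noteq> s" "r2 \<noteq> s" using s d.r12 by auto
  have refl: "cj s r1 \<in> reflections" "cj s r2 \<in> reflections" using cj_reflection s d.r12 by auto
  have roots: "root_of (cj s r1) = simple_act s (root_of r1)" "root_of (cj s r2) = simple_act s (root_of r2)"
    using simple_act_root_of(2) neq d.r12 s by auto
  have neq12: "cj s r1 \<noteq> cj s r2"
    using inj_on_eq_iff[OF cj_inj[OF s(1)]] d.r12 by simp
  have inP: "t \<in> cj s ` P \<longleftrightarrow> cj s t \<in> P" if "t \<in> reflections" for t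
    using cj_image_iff[OF s(1) d.P_carrier] reflections_closed that by blast
  have "t \<in> cj s ` P \<longleftrightarrow> root_of t \<in> span {root_of (cj s r1), root_of (cj s r2)}"
    if t: "t \<in> reflections" for t
  proof -
    have "root_of (cj s t) = simple_act s (root_of t) \<or> root_of (cj s t) = - simple_act s (root_of t)"
      using root_of_conj(1)[OF t, of s] s S_closed by (simp add: act_simple inv_simple)
    then have "cj s t \<in> P \<longleftrightarrow> simple_act s (root_of t) \<in> span {root_of r1, root_of r2}"
      using d.inP_iff[OF cj_reflection[OF s(1) t]] span_neg[of _ "{root_of r1, root_of r2}"]
      by (metis minus_minus)
    then show ?thesis
      using inP[OF t] simple_act_span_iff[OF s(1)] roots by simp
  qed
  moreover have "cj s ` P \<subseteq> carrier W" using d.P_carrier s cj_closed by auto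
  ultimately have "flat (cj s ` P)"
    unfolding flat_def using refl neq12 by (intro conjI bexI[of _ "cj s r1"] bexI[of _ "cj s r2"]) auto
  moreover have "canonical_labeling (cj s ` P) (cj s r1) (cj s r2)"
  proof (rule canonical_labelingI)
    show "cj s r1 \<noteq> cj s r2" by (rule neq12)
    show "cj s r1 \<in> cj s ` P \<inter> reflections" "cj s r2 \<in> cj s ` P \<inter> reflections"
      using refl d.r12 by auto
    fix t assume t: "t \<in> cj s ` P \<inter> reflections"
    then have c: "cj s t \<in> P" "cj s t \<in> reflections" "t \<in> carrier W"
      using inP cj_reflection s reflections_closed by auto
    then have "cj s t \<noteq> s" using s by auto
    then have root: "root_of t = simple_act s (root_of (cj s t))"
      using simple_act_root_of(2)[OF s(1) c(2)] cj_cj[OF s(1) c(3)] by simp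
    obtain p q where "p \<ge> 0" "q \<ge> 0" "root_of (cj s t) = p *\<^sub>R root_of r1 + q *\<^sub>R root_of r2"
      using d.root_in_cone c by blast
    then show "in_cone (root_of (cj s r1)) (root_of (cj s r2)) (root_of t)"
      unfolding in_cone_def root roots
      by (auto simp: linear_add[OF simple_act_linear] linear_scale[OF simple_act_linear])
  qed
  moreover have "cj s r1 \<otimes> cj s r2 \<noteq> cj s r2 \<otimes> cj s r1"
    using d.noncomm d.r12 s cj_mult inj_on_eq_iff[OF cj_inj[OF s(1)]] by simp
  ultimately show ?thesis
    by (intro dihedral_flat.intro[OF coxeter_root_datum_axioms] dihedral_flat_axioms.intro)
qed

text \<open>The vector \<open>act (inv w) (root_of t)\<close> is unchanged when \<open>w\<close>
  becomes \<open>s \<otimes> w\<close> and \<open>t\<close> is conjugated.\<close>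

lemma inversions_cj:
  assumes "s \<in> S" "w \<in> carrier W" "t \<in> reflections" "t \<noteq> s"
  shows "cj s t \<in> inversions (s \<otimes> w) \<longleftrightarrow> t \<in> inversions w"
proof -
  have "act (inv (s \<otimes> w)) (root_of (cj s t)) = act (inv w) (act s (act s (root_of t)))"
    using simple_act_root_of(2)[OF assms(1,3,4)] assms S_closed
    by (simp add: inv_mult_group inv_simple act_mult act_simple)
  also have "\<dots> = act (inv w) (root_of t)"
    using assms by (simp add: act_simple simple_act_invol)
  finally show ?thesis
    using inversions_iff[of "s \<otimes> w" "cj s t"] inversions_iff[of w t] assms cj_reflection S_closed by simp
qed

lemma inversions_reflections: "inversions w \<subseteq> reflections"
  by (auto simp: inversions_def)

lemma inversions_cj_image:
  assumes "s \<in> S" "s \<notin> P" "P \<subseteq> carrier W" "w \<in> carrier W"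
  shows "inversions (s \<otimes> w) \<inter> cj s ` P = cj s ` (inversions w \<inter> P)"
proof (intro equalityI subsetI)
  fix t assume t: "t \<in> inversions (s \<otimes> w) \<inter> cj s ` P"
  then obtain p where p: "p \<in> P" "t = cj s p" by blast
  have tr: "t \<in> reflections" using t inversions_reflections by blast
  have "p = cj s t" using p cj_cj assms by auto
  then have "p \<in> reflections" using cj_reflection tr assms by simp
  then have "p \<in> inversions w" using inversions_cj[of s w p] t p assms by auto
  then show "t \<in> cj s ` (inversions w \<inter> P)" using p by blast
next
  fix t assume "t \<in> cj s ` (inversions w \<inter> P)"
  then obtain p where p: "p \<in> P" "t = cj s p" "p \<in> inversions w" by blast
  then show "t \<in> inversions (s \<otimes> w) \<inter> cj s ` P"
    using inversions_cj[of s w p] assms inversions_reflections by auto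
qed

lemma supported_simple_act:
  "s \<in> J \<Longrightarrow> supported J v \<Longrightarrow> supported J (simple_act s v)"
  unfolding simple_act_pairing by (intro supported_diff supported_scale supported_simple_root)

text \<open>For \<open>s \<notin> P\<close> all ingredients are carried over: the canonical
  generators, the order of their product, the indexing, and the form by
  \<open>omega_rotate\<close>.\<close>

lemma aligned_cj:
  assumes d: "dihedral P r1 r2" and s: "s \<in> S" "s \<notin> P"
    and sub: "set (s # cs) \<subseteq> S" and dist: "distinct (s # cs)" and D: "D \<subseteq> carrier W"
    and sup: "supported (set (s # cs)) (root_of r1)" "supported (set (s # cs)) (root_of r2)"
  shows "aligned_lab (cs @ [s]) (cj s ` D) (cj s r1) (cj s r2) \<longleftrightarrow> aligned_lab (s # cs) D r1 r2"
proof -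
  interpret d: dihedral_flat W S A \<delta> P r1 r2 by fact
  interpret e: dihedral_flat W S A \<delta> "cj s ` P" "cj s r1" "cj s r2" by (rule dihedral_flat_cj[OF d s])
  have neq: "r1 \<noteq> s" "r2 \<noteq> s" using s d.r12 by auto
  have roots: "root_of (cj s r1) = simple_act s (root_of r1)" "root_of (cj s r2) = simple_act s (root_of r2)"
    using simple_act_root_of(2) neq d.r12 s by auto
  have om: "omega (cs @ [s]) (root_of (cj s r1)) (root_of (cj s r2)) = omega (s # cs) (root_of r1) (root_of r2)"
    unfolding roots by (rule omega_rotate[OF sub dist sup])
  have ord: "ord (cj s r1 \<otimes> cj s r2) = ord (r1 \<otimes> r2)"
    using cj_mult cj_ord s d.r12 by simp
  have inj: "cj s ` D = cj s ` E \<longleftrightarrow> D = E" if "E \<subseteq> carrier W" for E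
    using inj_on_image_eq_iff[OF cj_inj[OF s(1)] D that] .
  have u: "(\<lambda>i. dihedral_refl W (cj s r1) (cj s r2) (Fin i)) ` K = cj s ` (\<lambda>i. dihedral_refl W r1 r2 (Fin i)) ` K" for K
    using dihedral_refl_cj s d.r12 by (simp add: image_image)
  have uc: "(\<lambda>i. dihedral_refl W r1 r2 (Fin i)) ` K \<subseteq> carrier W" for K
    using d.r12 by auto
  have "cj s ` D = {cj s r2} \<longleftrightarrow> D = {r2}" using inj[of "{r2}"] d.r12 by simp
  then have "e.segment (cj s ` D) \<longleftrightarrow> d.segment D"
    unfolding d.segment_def e.segment_def ord u inj[OF uc] by simp
  moreover have "is_singleton (cj s ` D) \<longleftrightarrow> is_singleton D"
    using card_image[OF inj_on_subset[OF cj_inj[OF s(1)] D]] by (simp add: is_singleton_altdef)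
  ultimately show ?thesis
    unfolding d.aligned_with_def e.aligned_with_def om by simp
qed

text \<open>A canonical \<open>s\<close> comes first for \<open>s # cs\<close> and last for
  \<open>cs @ [s]\<close>, as the form changes sign on the pair. Removing \<open>s\<close> from the
  inversions of \<open>w\<close> and conjugating turns the initial segment of length
  \<open>k\<close> from \<open>s\<close> into that of length \<open>k - 1\<close> from
  \<open>r\<close>.\<close>

lemma aligned_descent:
  assumes d: "dihedral P s r" and s: "s \<in> S"
    and sub: "set (s # cs) \<subseteq> S" and dist: "distinct (s # cs)"
    and sup: "supported (set (s # cs)) (root_of r)"
    and w: "w \<in> carrier W" and len: "Suc (cox_length (s \<otimes> w)) = cox_length w"
  shows "aligned_lab (cs @ [s]) (inversions (s \<otimes> w) \<inter> P) s r \<or>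
      aligned_lab (cs @ [s]) (inversions (s \<otimes> w) \<inter> P) r s \<longleftrightarrow>
    aligned_lab (s # cs) (inversions w \<inter> P) s r \<or> aligned_lab (s # cs) (inversions w \<inter> P) r s"
proof -
  interpret d: dihedral_flat W S A \<delta> P s r by fact
  interpret e: dihedral_flat W S A \<delta> P r s by (rule d.sym_flat)
  define D where "D = inversions w \<inter> P"
  define E where "E = inversions (s \<otimes> w) \<inter> P"
  have sub': "set (cs @ [s]) \<subseteq> S" using sub by simp
  have rs: "root_of s = simple_root s" using root_of_simple s by blast
  have sup_s: "supported (set (s # cs)) (root_of s)" unfolding rs by (rule supported_simple_root) simp
  have o1: "omega (s # cs) (root_of s) (root_of r) > 0"
    by (rule omega_initial_pos[OF d sub dist sup])
  \<comment> \<open>Both roots are written as images under \<open>s\<close> to apply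
    \<open>omega_rotate\<close>. There \<open>s\<close> negates its own root and changes
    \<open>root_of r\<close> by a multiple of it, which a skew form does not see.\<close>
  have "omega (cs @ [s]) (root_of s) (root_of r) =
      omega (cs @ [s]) (simple_act s (simple_act s (root_of s))) (simple_act s (simple_act s (root_of r)))"
    using simple_act_invol[OF s] by simp
  also have "\<dots> = omega (s # cs) (simple_act s (root_of s)) (simple_act s (root_of r))"
    using sup sup_s by (intro omega_rotate[OF sub dist] supported_simple_act) auto
  also have "\<dots> = - omega (s # cs) (root_of s) (root_of r)"
    using s sub by (simp add: rs simple_act_self simple_act_pairing[of s "root_of r"] omega_simps[OF sub])
  finally have o2: "omega (cs @ [s]) (root_of s) (root_of r) < 0" using o1 by simp
  have o3: "omega (s # cs) (root_of r) (root_of s) < 0" "omega (cs @ [s]) (root_of r) (root_of s) > 0"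
    using o1 o2 omega_skew[OF sub, of "root_of r"] omega_skew[OF sub', of "root_of r"] by auto
  have sD: "s \<in> D" using simple_inversion_iff s len d.r12 by (simp add: D_def)
  have sE: "s \<notin> E" using simple_inversion_iff[OF s, of "s \<otimes> w"] s len w by (simp add: E_def)
  have cjP: "cj s t \<in> P" if "t \<in> P" "t \<in> reflections" "t \<noteq> s" for t
  proof -
    obtain p q where "root_of t = p *\<^sub>R root_of s + q *\<^sub>R root_of r"
      using d.root_in_cone \<open>t \<in> P\<close> \<open>t \<in> reflections\<close> by blast
    then have "root_of (cj s t) = (- p - q * pairing s (root_of r)) *\<^sub>R root_of s + q *\<^sub>R root_of r"
      using simple_act_root_of(2)[OF s \<open>t \<in> reflections\<close> \<open>t \<noteq> s\<close>] s
      by (simp add: linear_add[OF simple_act_linear] linear_scale[OF simple_act_linear] rs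
          simple_act_self simple_act_pairing[of s "root_of r"] algebra_simps)
    then show ?thesis
      using d.inP_iff cj_reflection s \<open>t \<in> reflections\<close> span_pair_iff by blast
  qed
  have E_iff: "E = cj s ` (D - {s})"
  proof (intro equalityI subsetI)
    fix t assume t: "t \<in> E"
    then have tr: "t \<in> reflections" "t \<in> P" "t \<noteq> s" "t \<in> carrier W"
      using sE inversions_reflections reflections_closed by (auto simp: E_def)
    then have c: "cj s t \<in> P" "cj s t \<in> reflections" "cj s t \<noteq> s" "cj s (cj s t) = t"
      using cjP cj_reflection cj_neq cj_cj s by auto
    then have "cj s t \<in> inversions w"
      using inversions_cj[OF s w c(2,3)] t by (simp add: E_def)
    then show "t \<in> cj s ` (D - {s})" using c by (metis D_def DiffI IntI imageI singletonD)
  next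
    fix t assume "t \<in> cj s ` (D - {s})"
    then obtain p where p: "p \<in> D" "p \<noteq> s" "t = cj s p" by blast
    then have "p \<in> reflections" "p \<in> P" using inversions_reflections by (auto simp: D_def)
    then show "t \<in> E"
      using p inversions_cj[OF s w] cjP by (auto simp: D_def E_def)
  qed
  have Dc: "D \<subseteq> carrier W" using d.P_carrier by (auto simp: D_def)
  have D_iff: "D = insert s (cj s ` E)"
  proof -
    have "cj s ` cj s ` (D - {s}) = (\<lambda>t. t) ` (D - {s})"
      unfolding image_image using cj_cj s Dc by (intro image_cong HOL.refl) auto
    then show ?thesis using sD E_iff by auto
  qed
  have ordeq: "ord (r \<otimes> s) = ord (s \<otimes> r)"
  proof -
    have "r \<otimes> s = inv (s \<otimes> r)" using d.r12 reflection_sq by (simp add: inv_mult_group)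
    then show ?thesis using d.r12 by simp
  qed
  let ?u = "\<lambda>i. dihedral_refl W s r (Fin i)" and ?v = "\<lambda>i. dihedral_refl W r s (Fin i)"
  have uv: "?u (Suc (Suc i)) = cj s (?v (Suc i))" for i
    using dihedral_refl_Suc d.r12 by blast
  have u1: "?u (Suc 0) = s" using d.r12 by simp
  \<comment> \<open>Conjugation by \<open>s\<close> sends the reflection with index \<open>i\<close>
    counted from \<open>r\<close> to the one with index \<open>i + 1\<close> counted from
    \<open>s\<close>.\<close>
  have uimg: "?u ` {1..Suc k} = insert s (cj s ` ?v ` {1..k})" for k
  proof -
    have "{1..Suc k} = insert 1 (Suc ` {1..k})"
      by (auto simp: image_iff)
    moreover have "?u ` Suc ` {1..k} = cj s ` ?v ` {1..k}"
      unfolding image_image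
    proof (intro image_cong HOL.refl)
      fix i assume "i \<in> {1..k}"
      then obtain j where "i = Suc j" by (cases i) auto
      then show "?u (Suc i) = cj s (?v i)" using uv by simp
    qed
    ultimately show ?thesis using u1 by simp
  qed
  have vc: "?v i \<in> carrier W" for i using d.r12 by simp
  have seg: "d.segment D \<longleftrightarrow> e.segment E"
  proof
    assume "d.segment D"
    then obtain k where k: "k \<ge> 1" "ord (s \<otimes> r) = 0 \<or> k \<le> ord (s \<otimes> r)" "D = ?u ` {1..k}"
      using sD d.r12 unfolding d.segment_def by auto
    then obtain j where j: "k = Suc j" by (cases k) auto
    have ns: "s \<notin> cj s ` ?v ` {1..j}"
    proof
      assume "s \<in> cj s ` ?v ` {1..j}"
      then obtain i where i: "1 \<le> i" "i \<le> j" "s = cj s (?v i)" by auto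
      then obtain i' where "i = Suc i'" by (cases i) auto
      then have "?u (Suc i) = s" using uv i by simp
      then show False using d.dihedral_neq_first[of i] i k j by auto
    qed
    have "D - {s} = cj s ` ?v ` {1..j}" using k(3) uimg ns unfolding j by auto
    then have "E = cj s ` cj s ` ?v ` {1..j}" using E_iff by simp
    also have "\<dots> = ?v ` {1..j}"
      unfolding image_image using cj_cj s vc by (intro image_cong HOL.refl) auto
    finally have E: "E = ?v ` {1..j}" .
    show "e.segment E"
    proof (cases "j = 0")
      case True
      then show ?thesis using E by (simp add: e.segment_def)
    next
      case False
      then show ?thesis unfolding e.segment_def ordeq using E k j by (intro disjI2 exI[of _ j]) auto
    qed
  next
    assume "e.segment E"
    then consider "E = {}" | k where "k \<ge> 1" "ord (s \<otimes> r) = 0 \<or> k \<le> ord (s \<otimes> r)" "E = ?v ` {1..k}"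
      using sE unfolding e.segment_def ordeq by auto
    then show "d.segment D"
    proof cases
      case 1
      then have "D = ?u ` {1..1}" using D_iff d.r12 by simp
      moreover have "ord (s \<otimes> r) = 0 \<or> 1 \<le> ord (s \<otimes> r)" by linarith
      ultimately show ?thesis unfolding d.segment_def by (intro disjI2 exI[of _ 1]) auto
    next
      case 2
      \<comment> \<open>A segment of full length from \<open>r\<close> would end in
        \<open>s\<close>, which is no inversion of \<open>s \<otimes> w\<close>. This leaves room
        for one more element.\<close>
      have "k \<noteq> ord (s \<otimes> r)"
      proof
        assume k: "k = ord (s \<otimes> r)"
        then have "?v k = s" using e.dihedral_last 2(1) ordeq by simp
        moreover have "k \<in> {1..k}" using 2(1) by simp
        ultimately have "s \<in> E" using 2(3) by (metis imageI)
        then show False using sE by blast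
      qed
      then have "ord (s \<otimes> r) = 0 \<or> Suc k \<le> ord (s \<otimes> r)" using 2 by linarith
      moreover have "D = ?u ` {1..Suc k}" using D_iff uimg 2 by simp
      ultimately show ?thesis unfolding d.segment_def by (intro disjI2 exI[of _ "Suc k"]) auto
    qed
  qed
  show ?thesis
    unfolding d.aligned_with_def e.aligned_with_def D_def[symmetric] E_def[symmetric]
    using o1 o2 o3 seg by simp
qed

text \<open>A canonical reflection is the first element for one labeling and the last for the other,
  and a singleton fits the degenerate case; so each sign of the form is covered.\<close>

lemma aligned_small:
  assumes "dihedral P r1 r2" "set cs \<subseteq> S" "D = {} \<or> D = {r1} \<or> D = {r2}"
  shows "aligned_lab cs D r1 r2 \<or> aligned_lab cs D r2 r1"
proof -
  interpret d: dihedral_flat W S A \<delta> P r1 r2 by fact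
  interpret e: dihedral_flat W S A \<delta> P r2 r1 by (rule d.sym_flat)
  have "{r1} = (\<lambda>i. dihedral_refl W r1 r2 (Fin i)) ` {1..1}"
    "{r2} = (\<lambda>i. dihedral_refl W r2 r1 (Fin i)) ` {1..1}" using d.r12 by simp_all
  moreover have "ord (r1 \<otimes> r2) = 0 \<or> 1 \<le> ord (r1 \<otimes> r2)" "ord (r2 \<otimes> r1) = 0 \<or> 1 \<le> ord (r2 \<otimes> r1)" by linarith+
  ultimately have "d.segment {r1}" "e.segment {r2}" "d.segment {r2}" "e.segment {r1}"
    "d.segment {}" "e.segment {}"
    unfolding d.segment_def e.segment_def by blast+
  then have "d.segment D" "e.segment D" using assms(3) by auto
  moreover have "D = {} \<or> is_singleton D" using assms(3) by auto
  ultimately show ?thesis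
    unfolding d.aligned_with_def e.aligned_with_def
    using omega_skew[OF assms(2), of "root_of r2" "root_of r1"]
    by (cases "omega cs (root_of r1) (root_of r2)" "0::real" rule: linorder_cases) auto
qed

end

section \<open>Sortable elements are aligned\<close>

text \<open>For a reduced word these are the roots of the inversions of its product, in the order in
  which its prefixes acquire them.\<close>

primrec (in coxeter_root_datum) root_seq :: "'a list \<Rightarrow> ('a \<Rightarrow>\<^sub>0 real) list" where
  "root_seq [] = []"
| "root_seq (a # as) = simple_root a # map (simple_act a) (root_seq as)"

context coxeter_root_datum
begin

text \<open>\<open>inv w\<close> does not change coordinates outside \<open>K\<close>, so a positive
  root that becomes negative has none there.\<close>

lemma parab_inversion_supported:
  assumes "parab K w" "t \<in> inversions w" shows "supported K (root_of t)"
  unfolding supported_def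
proof (intro allI impI)
  fix x assume x: "x \<notin> K"
  have t: "t \<in> reflections" and w: "w \<in> carrier W" using assms by (auto simp: inversions_def parab_def)
  have "supported K (act (inv w) (root_of t) - root_of t)"
    using parab_inv[OF assms(1)] by (simp add: parab_def)
  then have "coord (act (inv w) (root_of t)) x = coord (root_of t) x"
    using x by (simp add: supported_def lookup_minus)
  moreover have "nonneg (- act (inv w) (root_of t))" using inversions_iff assms t w by blast
  then have "coord (act (inv w) (root_of t)) x \<le> 0"
    by (simp add: nonneg_def) 
  moreover have "coord (root_of t) x \<ge> 0"
    using root_of_nonneg[OF t] by (simp add: nonneg_def)
  ultimately show "coord (root_of t) x = 0" by linarith
qed

lemma parab_empty: "parab {} w \<Longrightarrow> w = \<one>"
  using parab_iff[of "{}" w] by auto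

lemma simple_mult_cases:
  assumes "s \<in> S" "w \<in> carrier W"
  obtains "Suc (cox_length (s \<otimes> w)) = cox_length w" | "cox_length w < cox_length (s \<otimes> w)"
  using cox_length_simple_mult[OF assms(2,1)] by auto

text \<open>In a descent, \<open>s\<close> is a canonical generator of \<open>P\<close>
  (\<open>aligned_descent\<close>) or not in \<open>P\<close> (\<open>aligned_cj\<close>). Otherwise
  \<open>w\<close> omits \<open>s\<close>: either both canonical roots do so too and the shorter
  word applies, or at most one reflection of \<open>P\<close>, a canonical one, is inverted
  (\<open>aligned_small\<close>).\<close>

theorem sortable_imp_aligned:
  assumes "distinct cs" "set cs \<subseteq> S" "parab (set cs) w" "c_sortable cs w"
    "dihedral P r1 r2" "supported (set cs) (root_of r1)" "supported (set cs) (root_of r2)"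
  shows "aligned_lab cs (inversions w \<inter> P) r1 r2 \<or> aligned_lab cs (inversions w \<inter> P) r2 r1"
  using assms
proof (induction "cox_length w + length cs" arbitrary: cs w P r1 r2 rule: less_induct)
  case less
  interpret d: dihedral_flat W S A \<delta> P r1 r2 by (rule less.prems(5))
  interpret e: dihedral_flat W S A \<delta> P r2 r1 by (rule d.sym_flat)
  have w: "w \<in> carrier W" using less.prems by (simp add: parab_def)
  show ?case
  proof (cases cs)
    case Nil
    then have "root_of r1 = 0"
      using less.prems(6) by (intro poly_mapping_eqI) (simp add: supported_def)
    then show ?thesis using is_root_nonzero root_of_is_root d.r12 by blast
  next
    case (Cons s cs')
    have dist: "distinct (s # cs')" and sub: "set (s # cs') \<subseteq> S" and s: "s \<in> S"
      and par: "parab (set (s # cs')) w" and sort: "c_sortable (s # cs') w"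
      and sup: "supported (set (s # cs')) (root_of r1)" "supported (set (s # cs')) (root_of r2)"
      using less.prems Cons by auto
    have set_eq: "set (cs' @ [s]) = set (s # cs')" by simp
    show ?thesis
    proof (rule simple_mult_cases[OF s w])
      assume len: "Suc (cox_length (s \<otimes> w)) = cox_length w"
      have sort': "c_sortable (cs' @ [s]) (s \<otimes> w)"
        using c_sortable_descent[OF s len par sub dist] sort by simp
      have par': "parab (set (cs' @ [s])) (s \<otimes> w)"
        unfolding set_eq using par sub by (intro parab_mult[OF parab_simple[of s]]) auto
      have hyp: "aligned_lab (cs' @ [s]) (inversions (s \<otimes> w) \<inter> Q) a b \<or>
          aligned_lab (cs' @ [s]) (inversions (s \<otimes> w) \<inter> Q) b a"
        if "dihedral Q a b" "supported (set (s # cs')) (root_of a)"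
          "supported (set (s # cs')) (root_of b)" for Q a b
        using less.hyps[of "s \<otimes> w" "cs' @ [s]" Q a b] that dist sub sort' par' len Cons set_eq by auto
      show ?thesis
      proof (cases "s \<in> P")
        case True
        then consider "s = r1" | "s = r2" using d.canonical_simple s by blast
        then show ?thesis
        proof cases
          case 1
          then show ?thesis
            using hyp[OF less.prems(5) sup] aligned_descent[OF _ s sub dist sup(2) w len] less.prems(5)
            unfolding Cons by auto
        next
          case 2
          then show ?thesis
            using hyp[OF d.sym_flat sup(2,1)] aligned_descent[OF _ s sub dist sup(1) w len] d.sym_flat
            unfolding Cons by auto
        qed
      next
        case False
        note inv = inversions_cj_image[OF s False d.P_carrier w]
        have Dc: "inversions w \<inter> P \<subseteq> carrier W" using d.P_carrier by blast
        have "root_of (cj s r1) = simple_act s (root_of r1)" "root_of (cj s r2) = simple_act s (root_of r2)"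
          using simple_act_root_of(2) d.r12 s False by metis+
        then have "supported (set (s # cs')) (root_of (cj s r1))" "supported (set (s # cs')) (root_of (cj s r2))"
          using sup by (simp_all add: supported_simple_act)
        then show ?thesis
          using hyp[OF dihedral_flat_cj[OF less.prems(5) s False]]
            aligned_cj[OF less.prems(5) s False sub dist Dc sup]
            aligned_cj[OF d.sym_flat s False sub dist Dc sup(2,1)]
          unfolding Cons inv by blast
      qed
    next
      assume len: "cox_length w < cox_length (s \<otimes> w)"
      have K: "parab (set cs') w" "c_sortable cs' w"
        using c_sortable_nondescent[OF s len w sub dist] sort by auto
      have nn: "coord (root_of r1) s \<ge> 0" "coord (root_of r2) s \<ge> 0"
        using root_of_nonneg d.r12 by (auto simp: nonneg_def)
      show ?thesis
      proof (cases "coord (root_of r1) s = 0 \<and> coord (root_of r2) s = 0")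
        case True
        then have sup': "supported (set cs') (root_of r1)" "supported (set cs') (root_of r2)"
          using sup by (auto simp: supported_def)
        then have "aligned_lab cs' (inversions w \<inter> P) r1 r2 \<or> aligned_lab cs' (inversions w \<inter> P) r2 r1"
          using less.hyps[of w cs' P r1 r2] less.prems(5) dist sub K Cons by auto
        then show ?thesis
          unfolding Cons d.aligned_with_def e.aligned_with_def
          using omega_Cons_restrict[OF sub] sup' dist by simp
      next
        case False
        have "inversions w \<inter> P \<subseteq> {r2} \<or> inversions w \<inter> P \<subseteq> {r1}"
        proof -
          \<comment> \<open>Inversions of \<open>w\<close> have coordinate 0 at \<open>s\<close>.
            Both summands of this coordinate are nonnegative, so each vanishes and a canonical root
            involving \<open>s\<close> gets coefficient 0.\<close>
          have comb: "\<exists>p q. p \<ge> 0 \<and> q \<ge> 0 \<and> root_of t = p *\<^sub>R root_of r1 + q *\<^sub>R root_of r2 \<and>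
              p * coord (root_of r1) s = 0 \<and> q * coord (root_of r2) s = 0"
            if "t \<in> inversions w \<inter> P" for t
          proof -
            have t: "t \<in> reflections" "t \<in> P" "t \<in> inversions w"
              using that inversions_reflections by auto
            obtain p q where pq: "p \<ge> 0" "q \<ge> 0" "root_of t = p *\<^sub>R root_of r1 + q *\<^sub>R root_of r2"
              using d.root_in_cone t by blast
            have "coord (root_of t) s = 0"
              using parab_inversion_supported[OF K(1) t(3)] dist by (simp add: supported_def)
            then have "p * coord (root_of r1) s + q * coord (root_of r2) s = 0"
              by (simp add: pq lookup_add)
            then show ?thesis
              using pq nn by (metis add_nonneg_eq_0_iff mult_nonneg_nonneg)
          qed
          show ?thesis
          proof (cases "coord (root_of r1) s = 0")
            case True
            then have "coord (root_of r2) s \<noteq> 0" using False by simp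
            have "t = r1" if tP: "t \<in> inversions w \<inter> P" for t
            proof -
              obtain p q where "root_of t = p *\<^sub>R root_of r1 + q *\<^sub>R root_of r2"
                "q * coord (root_of r2) s = 0"
                using comb[OF tP] by blast
              then have "root_of t = p *\<^sub>R root_of r1"
                using \<open>coord (root_of r2) s \<noteq> 0\<close> by simp
              then show ?thesis using root_of_inj tP d.r12 inversions_reflections by blast
            qed
            then show ?thesis by blast
          next
            case False
            have "t = r2" if tP: "t \<in> inversions w \<inter> P" for t
            proof -
              obtain p q where "root_of t = p *\<^sub>R root_of r1 + q *\<^sub>R root_of r2"
                "p * coord (root_of r1) s = 0"
                using comb[OF tP] by blast
              then have "root_of t = q *\<^sub>R root_of r2"
                using False by simp
              then show ?thesis using root_of_inj tP d.r12 inversions_reflections by blast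
            qed
            then show ?thesis by blast
          qed
        qed
        then have "inversions w \<inter> P = {} \<or> inversions w \<inter> P = {r1} \<or> inversions w \<inter> P = {r2}" by blast
        then show ?thesis using aligned_small[OF less.prems(5,2)] by blast
      qed
    qed
  qed
qed

section \<open>Root sequences of reduced and of sorting words\<close>

lemma length_root_seq [simp]: "length (root_seq as) = length as"
  by (induction as) auto

lemma root_seq_nth:
  "j < length as \<Longrightarrow> root_seq as ! j = word_act (take j as) (simple_root (as ! j))"
proof (induction as arbitrary: j)
  case (Cons a as)
  then show ?case by (cases j) auto
qed simp

text \<open>Factors of a reduced word are reduced, so letter \<open>j\<close> is a right ascent of
  the prefix before it and a left descent of the suffix that it starts.\<close>

lemma reduced_prefix:
  assumes "reduced_word w zs" "j < length zs"
  defines "x \<equiv> word_prod W (take j zs)"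
  shows "x \<in> carrier W" "nonneg (act x (simple_root (zs ! j)))"
    "nonneg (- act (inv w) (act x (simple_root (zs ! j))))"
proof -
  have zs: "zs \<in> lists S" "word_prod W zs = w" "length zs = cox_length w"
    using assms by (auto simp: reduced_word_def)
  have a: "zs ! j \<in> S" using zs(1) assms(2) by auto
  have tk: "take i zs \<in> lists S" "drop i zs \<in> lists S" for i
    using zs(1) by (auto simp: in_lists_conv_set dest: in_set_takeD in_set_dropD)
  have split: "w = word_prod W (take i zs) \<otimes> word_prod W (drop i zs)" for i
    using word_prod_append_S[OF tk(1)[of i] tk(2)[of i]] zs(2) by (simp only: append_take_drop_id)
  have len: "cox_length (word_prod W (take i zs)) = i \<and> cox_length (word_prod W (drop i zs)) = length zs - i"
    if i: "i \<le> length zs" for i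
  proof -
    have "cox_length w \<le> cox_length (word_prod W (take i zs)) + cox_length (word_prod W (drop i zs))"
      using cox_length_mult[OF word_prod_S_closed[OF tk(1)[of i]] word_prod_S_closed[OF tk(2)[of i]]]
      unfolding split[of i, symmetric] .
    moreover have "cox_length (word_prod W (take i zs)) \<le> i"
      "cox_length (word_prod W (drop i zs)) \<le> length zs - i"
      using cox_length_le[OF tk(1)[of i]] cox_length_le[OF tk(2)[of i]] i by simp_all
    ultimately show ?thesis using zs(3) i by linarith
  qed
  show x: "x \<in> carrier W" using tk by (simp add: x_def)
  have "take (Suc j) zs = take j zs @ [zs ! j]" using assms by (simp add: take_Suc_conv_app_nth)
  then have "word_prod W (take (Suc j) zs) = x \<otimes> zs ! j"
    using tk a S_closed by (simp add: word_prod_append_S x_def)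
  then have "cox_length x < cox_length (x \<otimes> zs ! j)"
    using len[of j] len[of "Suc j"] assms by (simp add: x_def)
  then show "nonneg (act x (simple_root (zs ! j)))"
    using act_simple_root_nonneg x a by blast
  define y where "y = word_prod W (drop j zs)"
  have y: "y \<in> carrier W" using tk by (simp add: y_def)
  have dr: "drop j zs = zs ! j # drop (Suc j) zs" using assms by (simp add: Cons_nth_drop_Suc)
  then have "zs ! j \<otimes> y = word_prod W (drop (Suc j) zs)"
    using a tk[of "Suc j"] by (simp add: y_def)
  then have "cox_length (zs ! j \<otimes> y) < cox_length y"
    using len[of j] len[of "Suc j"] assms by (simp add: y_def)
  then have "nonneg (- act (inv y) (simple_root (zs ! j)))"
    using simple_inversion_iff inversions_iff[OF y simple_reflection[OF a]] root_of_simple a by simp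
  moreover have "act (inv w) (act x v) = act (inv y) v" for v
    using split[of j, folded x_def y_def] x y by (simp add: inv_mult_group act_mult)
  ultimately show "nonneg (- act (inv w) (act x (simple_root (zs ! j))))" by simp
qed

lemma root_seq_nonneg:
  assumes "reduced_word w as" "v \<in> set (root_seq as)" shows "nonneg v"
proof -
  obtain j where j: "j < length as" "v = root_seq as ! j"
    using assms by (metis in_set_conv_nth length_root_seq)
  have "take j as \<in> lists S"
    using assms(1) by (auto simp: reduced_word_def in_lists_conv_set dest: in_set_takeD)
  then show ?thesis
    using reduced_prefix(2)[OF assms(1) j(1)] act_word root_seq_nth[OF j(1)] j by simp
qed

lemma root_seq_supported:
  "as \<in> lists J \<Longrightarrow> v \<in> set (root_seq as) \<Longrightarrow> supported J v"
proof (induction as arbitrary: v)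
  case (Cons a as)
  then show ?case using supported_simple_act supported_simple_root by auto
qed simp

text \<open>The word produced follows the sorting recursion. A descent puts \<alpha>_s in front,
  where \<open>omega_initial_nonneg\<close> applies, and the rest keeps its order by
  \<open>omega_rotate\<close>; a nondescent changes nothing by
  \<open>omega_Cons_restrict\<close>.\<close>

lemma sortable_root_seq:
  assumes "distinct cs" "set cs \<subseteq> S" "parab (set cs) w" "c_sortable cs w"
  shows "\<exists>as. reduced_word w as \<and> as \<in> lists (set cs) \<and>
    sorted_wrt (\<lambda>u v. omega cs u v \<ge> 0) (root_seq as)"
  using assms
proof (induction "cox_length w + length cs" arbitrary: cs w rule: less_induct)
  case less
  have w: "w \<in> carrier W" using less.prems by (simp add: parab_def)
  show ?case
  proof (cases cs)
    case Nil
    then have "w = \<one>" using less.prems parab_empty by simp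
    then show ?thesis using reduced_word_one_iff by (intro exI[of _ "[]"]) auto
  next
    case (Cons s cs')
    have dist: "distinct (s # cs')" and sub: "set (s # cs') \<subseteq> S" and s: "s \<in> S"
      and par: "parab (set (s # cs')) w" and sort: "c_sortable (s # cs') w"
      using less.prems Cons by auto
    have set_eq: "set (cs' @ [s]) = set (s # cs')" by simp
    show ?thesis
    proof (rule simple_mult_cases[OF s w])
      assume len: "Suc (cox_length (s \<otimes> w)) = cox_length w"
      have sort': "c_sortable (cs' @ [s]) (s \<otimes> w)"
        using c_sortable_descent[OF s len par sub dist] sort by simp
      have par': "parab (set (cs' @ [s])) (s \<otimes> w)"
        unfolding set_eq using par sub by (intro parab_mult[OF parab_simple[of s]]) auto
      obtain as where as: "reduced_word (s \<otimes> w) as" "as \<in> lists (set (s # cs'))"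
        "sorted_wrt (\<lambda>u v. omega (cs' @ [s]) u v \<ge> 0) (root_seq as)"
        using less.hyps[of "s \<otimes> w" "cs' @ [s]"] dist sub sort' par' len Cons set_eq by auto
      have red: "reduced_word w (s # as)" using reduced_word_Cons_iff[OF s w len] as by simp
      have "omega (s # cs') (simple_root s) v \<ge> 0" if "v \<in> set (root_seq (s # as))" for v
        using omega_initial_nonneg[OF sub _ root_seq_nonneg[OF red that]] dist by simp
      moreover have "sorted_wrt (\<lambda>u v. omega (s # cs') (simple_act s u) (simple_act s v) \<ge> 0) (root_seq as)"
      proof (rule sorted_wrt_mono_rel[OF _ as(3)])
        fix u v assume uv: "u \<in> set (root_seq as)" "v \<in> set (root_seq as)" "omega (cs' @ [s]) u v \<ge> 0"
        then have "supported (set (s # cs')) (simple_act s u)" "supported (set (s # cs')) (simple_act s v)"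
          using root_seq_supported[OF as(2)] by (auto intro!: supported_simple_act)
        then show "omega (s # cs') (simple_act s u) (simple_act s v) \<ge> 0"
          using omega_rotate[OF sub dist, of "simple_act s u" "simple_act s v"] uv simple_act_invol[OF s] by simp
      qed
      ultimately have "sorted_wrt (\<lambda>u v. omega (s # cs') u v \<ge> 0) (root_seq (s # as))"
        by (simp add: sorted_wrt_map)
      then show ?thesis using red as(2) unfolding Cons by (intro exI[of _ "s # as"]) auto
    next
      assume len: "cox_length w < cox_length (s \<otimes> w)"
      have K: "parab (set cs') w" "c_sortable cs' w"
        using c_sortable_nondescent[OF s len w sub dist] sort by auto
      obtain as where as: "reduced_word w as" "as \<in> lists (set cs')"
        "sorted_wrt (\<lambda>u v. omega cs' u v \<ge> 0) (root_seq as)"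
        using less.hyps[of w cs'] dist sub K Cons by auto
      have "sorted_wrt (\<lambda>u v. omega (s # cs') u v \<ge> 0) (root_seq as)"
        using omega_Cons_restrict[OF sub] root_seq_supported[OF as(2)] dist
        by (intro sorted_wrt_mono_rel[OF _ as(3)]) auto
      then show ?thesis using as unfolding Cons by (intro exI[of _ as]) auto
    qed
  qed
qed

section \<open>Aligned elements are sortable\<close>

text \<open>The parabolic factorization of \<open>w\<close>, obtained by taking the left factor in
  the subgroup of \<open>K\<close> as long as possible among length-additive factorizations.\<close>

lemma exists_max_parabolic_prefix:
  assumes w: "w \<in> carrier W" and K: "K \<subseteq> S"
  obtains u v where "parab K u" "v \<in> carrier W" "w = u \<otimes> v" "cox_length w = cox_length u + cox_length v"
    "\<And>r. r \<in> K \<Longrightarrow> cox_length v < cox_length (r \<otimes> v)"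
proof -
  define Q where "Q k \<longleftrightarrow> (\<exists>u v. parab K u \<and> v \<in> carrier W \<and> w = u \<otimes> v \<and>
    cox_length w = cox_length u + cox_length v \<and> cox_length u = k)" for k
  have "Q 0" unfolding Q_def using w parab_one by (intro exI[of _ \<one>] exI[of _ w]) auto
  moreover have "Q k \<Longrightarrow> k \<le> cox_length w" for k by (auto simp: Q_def)
  ultimately obtain k where k: "Q k" "\<And>j. Q j \<Longrightarrow> j \<le> k"
    using GreatestI_nat[of Q 0] Greatest_le_nat[of Q] by metis
  obtain u v where u: "parab K u" and v: "v \<in> carrier W" "w = u \<otimes> v"
    and l: "cox_length w = cox_length u + cox_length v" "cox_length u = k"
    using k(1) by (auto simp: Q_def)
  have uc: "u \<in> carrier W" using u by (simp add: parab_def)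
  have "cox_length v < cox_length (r \<otimes> v)" if r: "r \<in> K" for r
  proof (rule ccontr)
    assume n: "\<not> ?thesis"
    have rS: "r \<in> S" using r K by blast
    have lv: "Suc (cox_length (r \<otimes> v)) = cox_length v"
      using cox_length_simple_mult[OF v(1) rS] n by linarith
    \<comment> \<open>A left descent of \<open>v\<close> in \<open>K\<close> can be moved over to
      \<open>u\<close>, which would then be longer.\<close>
    have eq: "w = (u \<otimes> r) \<otimes> (r \<otimes> v)" using v uc rS S_closed by (simp add: m_assoc)
    have "cox_length w \<le> cox_length (u \<otimes> r) + cox_length (r \<otimes> v)"
      using cox_length_mult[of "u \<otimes> r" "r \<otimes> v"] eq uc v rS S_closed by simp
    then have "cox_length (u \<otimes> r) = Suc (cox_length u)"
      using cox_length_mult_simple[OF uc rS] l lv by linarith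
    then have "Q (Suc k)" unfolding Q_def
      using parab_mult[OF u parab_simple[OF r K] K] eq l lv v rS S_closed
      by (intro exI[of _ "u \<otimes> r"] exI[of _ "r \<otimes> v"]) auto
    then show False using k by fastforce
  qed
  then show ?thesis using that u v l by blast
qed

lemma nonneg_act_supported:
  assumes "finite K" "supported K g" "nonneg g" "\<And>r. r \<in> K \<Longrightarrow> nonneg (act x (simple_root r))"
  shows "nonneg (act x g)"
proof -
  have "g = (\<Sum>r\<in>K. coord g r *\<^sub>R simple_root r)"
    using assms(1,2)
    by (intro poly_mapping_eqI)
      (simp add: lookup_sum lookup_simple_root supported_def if_distrib[of "\<lambda>x. _ * x"] cong: if_cong)
  then have "act x g = (\<Sum>r\<in>K. coord g r *\<^sub>R act x (simple_root r))"
    using linear_sum[OF act_linear[of x], of "\<lambda>r. coord g r *\<^sub>R simple_root r" K]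
    by (simp add: act_simps)
  moreover have "nonneg (\<Sum>r\<in>K. coord g r *\<^sub>R act x (simple_root r))"
    using assms by (auto simp: nonneg_def lookup_sum intro!: sum_nonneg)
  ultimately show ?thesis by simp
qed

text \<open>\<open>inv v\<close> keeps the simple roots of \<open>K\<close>, hence all nonnegative
  vectors supported on \<open>K\<close>, nonnegative. So a root supported on \<open>K\<close> can be
  made negative only by \<open>inv u\<close>.\<close>

lemma max_parabolic_prefix_inversions:
  assumes u: "parab K u" and v: "v \<in> carrier W" and K: "K \<subseteq> S"
    and len: "cox_length (u \<otimes> v) = cox_length u + cox_length v"
    and asc: "\<And>r. r \<in> K \<Longrightarrow> cox_length v < cox_length (r \<otimes> v)"
    and t: "t \<in> reflections" "supported K (root_of t)"
  shows "t \<in> inversions (u \<otimes> v) \<longleftrightarrow> t \<in> inversions u"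
proof
  have uc: "u \<in> carrier W" using u by (simp add: parab_def)
  have tc: "t \<in> carrier W" using t reflections_closed by blast
  {
    assume "t \<in> inversions u"
    then have "cox_length (t \<otimes> u) < cox_length u" by (simp add: inversions_def)
    moreover have "t \<otimes> (u \<otimes> v) = (t \<otimes> u) \<otimes> v" using tc uc v by (simp add: m_assoc)
    ultimately have "cox_length (t \<otimes> (u \<otimes> v)) < cox_length (u \<otimes> v)"
      using cox_length_mult[of "t \<otimes> u" v] len tc uc v by simp
    then show "t \<in> inversions (u \<otimes> v)" using t by (simp add: inversions_def)
  next
    assume uv: "t \<in> inversions (u \<otimes> v)"
    show "t \<in> inversions u"
    proof (rule ccontr)
      assume "t \<notin> inversions u"
      define g where "g = act (inv u) (root_of t)"
      have g: "nonneg g" using \<open>t \<notin> inversions u\<close> inversions_iff_not uc t by (simp add: g_def)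
      have "supported K ((g - root_of t) + root_of t)"
        using parab_inv[OF u] t(2) unfolding g_def
        by (intro supported_add[of K "_ - _"]) (auto simp: parab_def)
      then have sg: "supported K g" by simp
      have "nonneg (act (inv v) (simple_root r))" if "r \<in> K" for r
      proof -
        have rS: "r \<in> S" using that K by blast
        then have "r \<notin> inversions v" using simple_inversion_iff asc[OF that] by fastforce
        then show ?thesis
          using inversions_iff_not[OF v simple_reflection[OF rS]] root_of_simple[OF rS] by simp
      qed
      then have "nonneg (act (inv v) g)"
        using nonneg_act_supported sg g finite_subset[OF K finite_S] by blast
      moreover have "act (inv (u \<otimes> v)) (root_of t) = act (inv v) g"
        using uc v by (simp add: g_def inv_mult_group act_mult)
      ultimately have "t \<notin> inversions (u \<otimes> v)"
        using inversions_iff_not[of "u \<otimes> v" t] uc v t by simp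
      then show False using uv by simp
    qed
  }
qed

text \<open>Pulled back by \<open>x\<close>, a root of \<open>P\<close> is a combination of
  \<alpha>_a and \<alpha>_s with coefficients of one sign; as \<open>x\<close> keeps both positive,
  positive roots of \<open>P\<close> lie in the cone of their images. Commutation would force
  \<open>A a s = 0\<close>.\<close>

lemma rank_two_dihedral_flat:
  assumes x: "x \<in> carrier W" and as: "a \<in> S" "s \<in> S" "a \<noteq> s" and A: "A a s \<noteq> 0"
    and nn: "nonneg (act x (simple_root a))" "nonneg (act x (simple_root s))"
    and P: "P = (\<lambda>y. x \<otimes> y \<otimes> inv x) ` generate W {a, s}"
  shows "rank_two_parabolic P" "dihedral P (x \<otimes> a \<otimes> inv x) (x \<otimes> s \<otimes> inv x)"
    "root_of (x \<otimes> a \<otimes> inv x) = act x (simple_root a)"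
    "root_of (x \<otimes> s \<otimes> inv x) = act x (simple_root s)"
proof -
  let ?r = "x \<otimes> a \<otimes> inv x" and ?t = "x \<otimes> s \<otimes> inv x"
  show two: "rank_two_parabolic P" unfolding rank_two_parabolic_def using x as P by blast
  show roots: "root_of ?r = act x (simple_root a)" "root_of ?t = act x (simple_root s)"
    using root_of_eqI x as nn by auto
  have refl: "?r \<in> reflections" "?t \<in> reflections" using conj_closed simple_reflection x as by auto
  note PR = rank_two_reflections[OF x as(1,2) P]
  have neq: "?r \<noteq> ?t" using as x S_closed by simp
  have "canonical_labeling P ?r ?t"
  proof (rule canonical_labelingI)
    show "?r \<noteq> ?t" by (rule neq)
    show "?r \<in> P \<inter> reflections" "?t \<in> P \<inter> reflections"
      using PR refl roots by (auto intro: span_base)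
    fix t assume t: "t \<in> P \<inter> reflections"
    then obtain p q where pq: "root_of t = p *\<^sub>R act x (simple_root a) + q *\<^sub>R act x (simple_root s)"
      using PR span_pair_iff by blast
    have tr: "is_root (root_of t)" "nonneg (root_of t)" using t root_of_is_root root_of_nonneg by auto
    have e: "act (inv x) (root_of t) = p *\<^sub>R simple_root a + q *\<^sub>R simple_root s"
      using x by (simp add: pq act_simps)
    then have look: "coord (act (inv x) (root_of t)) a = p"
      "coord (act (inv x) (root_of t)) s = q"
      using as by (simp_all add: lookup_add lookup_simple_root)
    have "nonneg (act (inv x) (root_of t)) \<or> nonneg (- act (inv x) (root_of t))"
      using is_root_sign is_root_act tr x by blast
    then have "p \<ge> 0 \<and> q \<ge> 0"
    proof
      assume "nonneg (act (inv x) (root_of t))"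
      then show ?thesis using look unfolding nonneg_def by metis
    next
      assume "nonneg (- act (inv x) (root_of t))"
      then have "p \<le> 0" "q \<le> 0" using look unfolding nonneg_def by (metis lookup_uminus neg_0_le_iff_le)+
      then have "nonneg ((- p) *\<^sub>R act x (simple_root a) + (- q) *\<^sub>R act x (simple_root s))"
        using nn by (intro nonneg_add nonneg_scale) auto
      then have "nonneg (- root_of t)" by (simp add: pq)
      then show ?thesis using is_root_not_both tr by blast
    qed
    then show "in_cone (root_of ?r) (root_of ?t) (root_of t)"
      unfolding in_cone_def roots using pq by blast
  qed
  moreover have "?r \<otimes> ?t \<noteq> ?t \<otimes> ?r"
  proof
    assume "?r \<otimes> ?t = ?t \<otimes> ?r"
    then have "x \<otimes> (a \<otimes> s) \<otimes> inv x = x \<otimes> (s \<otimes> a) \<otimes> inv x"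
      using x as S_closed by (simp add: m_assoc)
    then have "a \<otimes> s = s \<otimes> a" using x as S_closed by simp
    then have "act a (act s (simple_root s)) = act s (act a (simple_root s))"
      using act_mult as S_closed by metis
    then have "- simple_act a (simple_root s) = simple_act s (simple_root s - A a s *\<^sub>R simple_root a)"
      using as by (simp add: act_simple simple_act_self simple_act_root linear_neg[OF simple_act_linear])
    then have "- (simple_root s - A a s *\<^sub>R simple_root a) =
        - simple_root s - A a s *\<^sub>R (simple_root a - A s a *\<^sub>R simple_root s)"
      using as by (simp add: simple_act_self simple_act_root linear_diff[OF simple_act_linear]
          linear_scale[OF simple_act_linear])
    from arg_cong[OF this, of "\<lambda>v. coord v a"] have "A a s = - A a s"
      using as by (simp add: lookup_minus lookup_simple_root)
    then show False using A by simp
  qed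
  ultimately show "dihedral P ?r ?t"
    using rank_two_parabolic_flat[OF two]
    by (intro dihedral_flat.intro[OF coxeter_root_datum_axioms] dihedral_flat_axioms.intro)
qed

end

context coxeter_root_datum
begin

lemma inversions_supported_cong:
  assumes d: "dihedral P r1 r2"
    and sup: "supported K (root_of r1)" "supported K (root_of r2)"
    and iff: "\<And>t. t \<in> reflections \<Longrightarrow> supported K (root_of t) \<Longrightarrow> t \<in> inversions w \<longleftrightarrow> t \<in> inversions u"
  shows "inversions w \<inter> P = inversions u \<inter> P"
proof -
  interpret d: dihedral_flat W S A \<delta> P r1 r2 by fact
  have "supported K (root_of t)" if t: "t \<in> P" "t \<in> reflections" for t
  proof -
    obtain p q where "root_of t = p *\<^sub>R root_of r1 + q *\<^sub>R root_of r2"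
      using d.root_in_cone t by blast
    then show ?thesis using sup by (simp add: supported_add supported_scale)
  qed
  then show ?thesis using iff inversions_reflections by blast
qed

text \<open>
  Along the prefixes \<open>x\<close> of the reduced word \<open>as\<close>, the root \<open>x \<alpha>\<^sub>s\<close> never becomes an inversion of
  \<open>w\<close>: at each step alignment with respect to a rank two parabolic subgroup with canonical roots
  \<open>x \<alpha>\<^sub>a\<close> and \<open>x \<alpha>\<^sub>s\<close> forbids it, the sign of \<open>\<omega>\<close> on these roots being controlled by \<open>as\<close>.
\<close>

lemma aligned_prefix_not_inversion:
  assumes dist: "distinct (s # cs)" and sub: "set (s # cs) \<subseteq> S"
    and w: "w \<in> carrier W" and zs: "reduced_word w (as @ bs)" and as: "as \<in> lists (set cs)"
    and seq: "sorted_wrt (\<lambda>u v. omega cs u v \<ge> 0) (root_seq as)"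
    and asc: "cox_length w < cox_length (s \<otimes> w)"
    and al: "\<And>P r1 r2. rank_two_parabolic P \<Longrightarrow> dihedral P r1 r2 \<Longrightarrow>
      supported (set (s # cs)) (root_of r1) \<Longrightarrow> supported (set (s # cs)) (root_of r2) \<Longrightarrow>
      aligned_lab (s # cs) (inversions w \<inter> P) r1 r2 \<or> aligned_lab (s # cs) (inversions w \<inter> P) r2 r1"
    and j: "j \<le> length as"
  shows "nonneg (act (inv w) (act (word_prod W (take j as)) (simple_root s))) \<and>
    (\<forall>l. j \<le> l \<longrightarrow> l < length as \<longrightarrow>
      omega (s # cs) (act (word_prod W (take j as)) (simple_root s)) (root_seq as ! l) \<ge> 0)"
  using j
proof (induction j)
  have s: "s \<in> S" using sub by simp
  have asS: "as \<in> lists S" using as sub by auto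
  have seq_sup: "supported (set cs) (root_seq as ! l)" if "l < length as" for l
    using root_seq_supported[OF as] that by (metis length_root_seq nth_mem)
  have seq_nn: "nonneg (root_seq as ! l)" if l: "l < length as" for l
  proof -
    have "take l as \<in> lists S" using asS by (auto simp: in_lists_conv_set dest: in_set_takeD)
    then show ?thesis
      using reduced_prefix(2)[OF zs, of l] l act_word root_seq_nth[OF l] by (simp add: nth_append)
  qed
  {
    case 0
    have "s \<notin> inversions w" using simple_inversion_iff s asc by fastforce
    then have "nonneg (act (inv w) (simple_root s))"
      using inversions_iff_not[OF w simple_reflection[OF s]] root_of_simple[OF s] by simp
    moreover have "omega (s # cs) (simple_root s) (root_seq as ! l) \<ge> 0" if "l < length as" for l
      using omega_initial_nonneg[OF sub _ seq_nn[OF that]] dist by simp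
    ultimately show ?case by simp
  next
    case (Suc j)
    define x where "x = word_prod W (take j as)"
    define a where "a = as ! j"
    define \<beta> where "\<beta> = act x (simple_root a)"
    define \<sigma> where "\<sigma> = act x (simple_root s)"
    have jl: "j < length as" using Suc.prems by simp
    have a: "a \<in> set cs" "a \<in> S" "a \<noteq> s" using as sub dist jl by (auto simp: a_def)
    have tk: "take j as \<in> lists (set cs)" "take j as \<in> lists S"
      using as asS by (auto simp: in_lists_conv_set dest: in_set_takeD)
    have x: "x \<in> carrier W" using tk by (simp add: x_def)
    have px: "parab (set cs) x" using parab_word[OF tk(1)] sub by (simp add: x_def)
    have \<beta>_seq: "\<beta> = root_seq as ! j"
      using root_seq_nth[OF jl] act_word[OF tk(2)] by (simp add: \<beta>_def x_def a_def)
    have \<beta>_nn: "nonneg \<beta>" "nonneg (- act (inv w) \<beta>)"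
      using reduced_prefix(2,3)[OF zs, of j] jl by (simp_all add: \<beta>_def x_def a_def nth_append)
    have \<beta>_sup: "supported (set cs) \<beta>" using seq_sup[OF jl] \<beta>_seq by simp
    have \<sigma>_diff: "supported (set cs) (\<sigma> - simple_root s)" using px by (simp add: parab_def \<sigma>_def)
    then have \<sigma>_s: "coord \<sigma> s = 1"
      using dist by (auto simp: supported_def lookup_minus lookup_simple_root)
    \<comment> \<open>Prefixes of \<open>as\<close> omit \<open>s\<close> and so preserve the
      coordinate at \<open>s\<close>. The images of \<alpha>_s keep coordinate 1 there, which alone
      decides their sign.\<close>
    have positive: "nonneg v" if "is_root v" "coord v s = 1" for v
      using is_root_sign[OF that(1)] that(2) unfolding nonneg_def
      by (metis lookup_uminus neg_0_le_iff_le not_one_le_zero)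
    have \<sigma>_root: "is_root \<sigma>" using x s by (auto simp: is_root_def \<sigma>_def)
    have \<sigma>_nn: "nonneg \<sigma>" using positive \<sigma>_root \<sigma>_s by blast
    have "supported (set (s # cs)) ((\<sigma> - simple_root s) + simple_root s)"
      by (intro supported_add[of _ "_ - _"] supported_mono[OF \<sigma>_diff] supported_simple_root) auto
    then have \<sigma>_sup: "supported (set (s # cs)) \<sigma>" by simp
    have \<beta>_sup': "supported (set (s # cs)) \<beta>" by (rule supported_mono[OF \<beta>_sup]) auto
    have IH: "nonneg (act (inv w) \<sigma>)"
      "\<And>l. j \<le> l \<Longrightarrow> l < length as \<Longrightarrow> omega (s # cs) \<sigma> (root_seq as ! l) \<ge> 0"
      using Suc by (simp_all add: \<sigma>_def x_def)
    \<comment> \<open>The image of \<alpha>_s under the next prefix. It adds a nonnegative multiple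
      of \<beta>, and \<beta> precedes the later roots of \<open>root_seq as\<close>, so the bound
      on \<omega> persists.\<close>
    define \<tau> where "\<tau> = \<sigma> - A a s *\<^sub>R \<beta>"
    have "word_prod W (take (Suc j) as) = x \<otimes> a"
      using tk a S_closed jl by (simp add: take_Suc_conv_app_nth word_prod_append_S x_def a_def)
    then have \<tau>: "act (word_prod W (take (Suc j) as)) (simple_root s) = \<tau>"
      using x a s S_closed
      by (simp add: act_mult act_simple simple_act_root act_simps \<tau>_def \<sigma>_def \<beta>_def)
    have Aas: "A a s \<le> 0" using A_nonpos a s by blast
    have "omega (s # cs) \<tau> (root_seq as ! l) \<ge> 0" if l: "Suc j \<le> l" "l < length as" for l
    proof -
      have "omega cs (root_seq as ! j) (root_seq as ! l) \<ge> 0"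
        using sorted_wrt_nth_less[OF seq, of j l] l by simp
      then have "omega (s # cs) \<beta> (root_seq as ! l) \<ge> 0"
        using omega_Cons_restrict[OF sub \<beta>_sup seq_sup[OF l(2)]] dist \<beta>_seq by simp
      then have "A a s * omega (s # cs) \<beta> (root_seq as ! l) \<le> 0"
        using Aas by (simp add: mult_nonpos_nonneg)
      then show ?thesis
        using IH(2)[of l] l by (simp add: \<tau>_def omega_simps[OF sub])
    qed
    moreover have "nonneg (act (inv w) \<tau>)"
    proof (cases "A a s = 0")
      case True
      then show ?thesis using IH(1) by (simp add: \<tau>_def)
    next
      case False
      define P where "P = (\<lambda>y. x \<otimes> y \<otimes> inv x) ` generate W {a, s}"
      define r1 where "r1 = x \<otimes> a \<otimes> inv x"
      define r2 where "r2 = x \<otimes> s \<otimes> inv x"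
      note two = rank_two_dihedral_flat[OF x a(2) s a(3) False \<beta>_nn(1)[unfolded \<beta>_def]
          \<sigma>_nn[unfolded \<sigma>_def] P_def, folded r1_def r2_def \<beta>_def \<sigma>_def]
      interpret d: dihedral_flat W S A \<delta> P r1 r2 by (rule two(2))
      interpret e: dihedral_flat W S A \<delta> P r2 r1 by (rule d.sym_flat)
      define D where "D = inversions w \<inter> P"
      have r1D: "r1 \<in> D" using inversions_iff[OF w, of r1] d.r12 two(3) \<beta>_nn by (simp add: D_def)
      have r2D: "r2 \<notin> D" using inversions_iff_not[OF w, of r2] d.r12 two(4) IH(1) by (simp add: D_def)
      \<comment> \<open>The induction hypothesis at \<open>l = j\<close> puts \<open>r2\<close>
        weakly before \<open>r1\<close>, which rules out alignment by a segment for the labeling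
        \<open>r1\<close>, \<open>r2\<close>.\<close>
      have "omega (s # cs) \<sigma> \<beta> \<ge> 0" using IH(2)[of j] jl \<beta>_seq by simp
      then have om: "omega (s # cs) (root_of r1) (root_of r2) \<le> 0"
        using omega_skew[OF sub, of \<beta> \<sigma>] two by simp
      have "aligned_lab (s # cs) D r1 r2 \<or> aligned_lab (s # cs) D r2 r1"
        unfolding D_def using al[OF two(1,2)] two(3,4) \<beta>_sup' \<sigma>_sup by simp
      moreover have "\<not> d.segment D \<or> \<not> omega (s # cs) (root_of r1) (root_of r2) > 0" using om by simp
      \<comment> \<open>Counted from \<open>r2\<close>, a nonempty initial segment contains
        \<open>r2\<close>, which is no inversion. Since \<open>D\<close> contains \<open>r1\<close>,
        only the singleton of the last element remains.\<close>
      moreover have "D = {r1}" if "e.segment D"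
      proof -
        have "D \<noteq> (\<lambda>i. dihedral_refl W r2 r1 (Fin i)) ` {1..k}" if "k \<ge> 1" for k
        proof
          assume D: "D = (\<lambda>i. dihedral_refl W r2 r1 (Fin i)) ` {1..k}"
          have "dihedral_refl W r2 r1 (Fin 1) \<in> D" unfolding D using that by (intro imageI) simp
          then show False using r2D d.r12 by simp
        qed
        then show ?thesis using that r1D unfolding e.segment_def by blast
      qed
      moreover have "D = {r1}" if "is_singleton D"
        using that r1D by (auto simp: is_singleton_def)
      ultimately have D: "D = {r1}"
        unfolding d.aligned_with_def e.aligned_with_def using r1D by auto
      \<comment> \<open>The reflection with root \<tau>. It lies in \<open>P\<close> and differs
        from \<open>r1\<close> in the coordinate at \<open>s\<close>, so the singleton
        \<open>D\<close> excludes it.\<close>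
      define t where "t = (x \<otimes> a) \<otimes> s \<otimes> inv (x \<otimes> a)"
      have xa: "x \<otimes> a \<in> carrier W" using x a S_closed by simp
      have act_xa: "act (x \<otimes> a) (simple_root s) = \<tau>"
        using x a s S_closed
        by (simp add: act_mult act_simple simple_act_root act_simps \<tau>_def \<sigma>_def \<beta>_def)
      have \<tau>_s: "coord \<tau> s = 1"
        using \<sigma>_s \<beta>_sup dist by (simp add: \<tau>_def lookup_minus supported_def)
      have "is_root \<tau>" using act_xa xa s unfolding is_root_def by blast
      then have root_t: "root_of t = \<tau>"
        using root_of_eqI[OF xa s _ t_def] positive \<tau>_s act_xa by simp
      have t: "t \<in> reflections" unfolding t_def using conj_closed simple_reflection xa s by blast
      have "root_of t = (- A a s) *\<^sub>R root_of r1 + 1 *\<^sub>R root_of r2"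
        using root_t two by (simp add: \<tau>_def)
      then have "t \<in> P" using d.inP_iff[OF t] span_pair_iff by blast
      moreover have "t \<noteq> r1"
        using root_t two(3) \<tau>_s \<beta>_sup dist by (auto simp: supported_def)
      ultimately have "t \<notin> inversions w" using D by (auto simp: D_def)
      then show ?thesis using inversions_iff_not[OF w t] root_t by simp
    qed
    ultimately show ?case unfolding \<tau> by blast
  }
qed

text \<open>Descents mirror the forward direction. Otherwise the longest prefix \<open>u\<close> of
  \<open>w\<close> omitting \<open>s\<close> inherits alignment, since \<open>w\<close> and
  \<open>u\<close> have the same inversions among roots supported off \<open>s\<close>. So
  \<open>u\<close> is sortable and has an ordered root sequence, which forces
  \<open>w = u\<close>.\<close>

theorem aligned_imp_sortable:
  assumes "distinct cs" "set cs \<subseteq> S" "parab (set cs) w"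
    and "\<And>P r1 r2. rank_two_parabolic P \<Longrightarrow> dihedral P r1 r2 \<Longrightarrow>
      supported (set cs) (root_of r1) \<Longrightarrow> supported (set cs) (root_of r2) \<Longrightarrow>
      aligned_lab cs (inversions w \<inter> P) r1 r2 \<or> aligned_lab cs (inversions w \<inter> P) r2 r1"
  shows "c_sortable cs w"
  using assms
proof (induction "cox_length w + length cs" arbitrary: cs w rule: less_induct)
  case less
  have w: "w \<in> carrier W" using less.prems(3) by (simp add: parab_def)
  show ?case
  proof (cases cs)
    case Nil
    then show ?thesis using less.prems(3) parab_empty c_sortable_one by auto
  next
    case (Cons s cs')
    have dist: "distinct (s # cs')" and sub: "set (s # cs') \<subseteq> S" and s: "s \<in> S"
      and par: "parab (set (s # cs')) w"
      using less.prems(1-3) Cons by auto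
    note al = less.prems(4)[unfolded Cons]
    have set_eq: "set (cs' @ [s]) = set (s # cs')" by simp
    show ?thesis
    proof (rule simple_mult_cases[OF s w])
      assume len: "Suc (cox_length (s \<otimes> w)) = cox_length w"
      have sw: "s \<otimes> w \<in> carrier W" using s w S_closed by simp
      have par': "parab (set (cs' @ [s])) (s \<otimes> w)"
        unfolding set_eq using par sub by (intro parab_mult[OF parab_simple[of s]]) auto
      have "aligned_lab (cs' @ [s]) (inversions (s \<otimes> w) \<inter> P) r1 r2 \<or>
          aligned_lab (cs' @ [s]) (inversions (s \<otimes> w) \<inter> P) r2 r1"
        if P: "rank_two_parabolic P" and d: "dihedral P r1 r2"
          and sup: "supported (set (s # cs')) (root_of r1)" "supported (set (s # cs')) (root_of r2)"
        for P r1 r2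
      proof -
        interpret d: dihedral_flat W S A \<delta> P r1 r2 by fact
        show ?thesis
        proof (cases "s \<in> P")
          case True
          then consider "s = r1" | "s = r2" using d.canonical_simple s by blast
          then show ?thesis
          proof cases
            case 1
            then show ?thesis
              using al[OF P d sup] aligned_descent[OF _ s sub dist sup(2) w len] d by auto
          next
            case 2
            then show ?thesis
              using al[OF P d.sym_flat sup(2,1)] aligned_descent[OF _ s sub dist sup(1) w len] d.sym_flat
              by auto
          qed
        next
          case False
          \<comment> \<open>\<open>P\<close> is a test subgroup for \<open>s \<otimes> w\<close>.
            The hypothesis on \<open>w\<close> is used at its conjugate, and
            \<open>aligned_cj\<close> leads back to \<open>P\<close>.\<close>
          let ?Q = "cj s ` P"
          have Qd: "dihedral ?Q (cj s r1) (cj s r2)" by (rule dihedral_flat_cj[OF d s False])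
          interpret e: dihedral_flat W S A \<delta> ?Q "cj s r1" "cj s r2" by (rule Qd)
          have roots: "root_of (cj s r1) = simple_act s (root_of r1)" "root_of (cj s r2) = simple_act s (root_of r2)"
            using simple_act_root_of(2) d.r12 s False by metis+
          then have sup': "supported (set (s # cs')) (root_of (cj s r1))" "supported (set (s # cs')) (root_of (cj s r2))"
            using sup by (simp_all add: supported_simple_act)
          have sQ: "s \<notin> ?Q"
            using cj_image_iff[OF s d.P_carrier, of s] s S_closed False by (simp add: simple_sq)
          have invol: "cj s ` ?Q = P" "cj s (cj s r1) = r1" "cj s (cj s r2) = r2"
          proof -
            have "cj s ` ?Q = (\<lambda>t. t) ` P"
              unfolding image_image using cj_cj s d.P_carrier by (intro image_cong HOL.refl) auto
            then show "cj s ` ?Q = P" by simp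
          qed (use cj_cj s d.r12 in auto)
          have D: "inversions (s \<otimes> w) \<inter> P = cj s ` (inversions w \<inter> ?Q)"
            using inversions_cj_image[OF s sQ e.P_carrier w] invol by simp
          have Dc: "inversions w \<inter> ?Q \<subseteq> carrier W" using e.P_carrier by blast
          show ?thesis
            using al[OF rank_two_parabolic_cj[OF P s] Qd sup']
              aligned_cj[OF Qd s sQ sub dist Dc sup'] aligned_cj[OF e.sym_flat s sQ sub dist Dc sup'(2,1)]
            unfolding D invol by blast
        qed
      qed
      then have "c_sortable (cs' @ [s]) (s \<otimes> w)"
        using dist sub len Cons par' by (intro less.hyps) auto
      then show ?thesis using c_sortable_descent[OF s len par sub dist] Cons by simp
    next
      assume len: "cox_length w < cox_length (s \<otimes> w)"
      let ?K = "set cs'"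
      have K: "?K \<subseteq> S" using sub by simp
      obtain u v where u: "parab ?K u" and v: "v \<in> carrier W" "w = u \<otimes> v"
        and l: "cox_length w = cox_length u + cox_length v"
        and asc: "\<And>r. r \<in> ?K \<Longrightarrow> cox_length v < cox_length (r \<otimes> v)"
        using exists_max_parabolic_prefix[OF w K] by blast
      have uc: "u \<in> carrier W" using u by (simp add: parab_def)
      have l': "cox_length (u \<otimes> v) = cox_length u + cox_length v" using l v by simp
      have "aligned_lab cs' (inversions u \<inter> P) r1 r2 \<or> aligned_lab cs' (inversions u \<inter> P) r2 r1"
        if P: "rank_two_parabolic P" and d: "dihedral P r1 r2"
          and sup: "supported ?K (root_of r1)" "supported ?K (root_of r2)" for P r1 r2
      proof -
        interpret d: dihedral_flat W S A \<delta> P r1 r2 by fact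
        interpret e: dihedral_flat W S A \<delta> P r2 r1 by (rule d.sym_flat)
        have D: "inversions w \<inter> P = inversions u \<inter> P"
          using max_parabolic_prefix_inversions[OF u v(1) K l' asc] v(2)
          by (intro inversions_supported_cong[OF d sup]) simp
        have sup': "supported (set (s # cs')) (root_of r1)" "supported (set (s # cs')) (root_of r2)"
          using sup supported_mono[of ?K _ "set (s # cs')"] by auto
        have "omega (s # cs') (root_of r1) (root_of r2) = omega cs' (root_of r1) (root_of r2)"
          "omega (s # cs') (root_of r2) (root_of r1) = omega cs' (root_of r2) (root_of r1)"
          using omega_Cons_restrict[OF sub] sup dist by auto
        then show ?thesis
          using al[OF P d sup'] unfolding d.aligned_with_def e.aligned_with_def D by simp
      qed
      \<comment> \<open>The measure drops because \<open>cs'\<close> has one letter fewer, while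
        \<open>u\<close> is no longer than \<open>w\<close>.\<close>
      then have su: "c_sortable cs' u"
        using dist sub u l Cons by (intro less.hyps) auto
      obtain as where as: "reduced_word u as" "as \<in> lists ?K"
        "sorted_wrt (\<lambda>u v. omega cs' u v \<ge> 0) (root_seq as)"
        using sortable_root_seq[OF _ K u su] dist by auto
      obtain bs where bs: "reduced_word v bs" using exists_reduced v by blast
      have zs: "reduced_word w (as @ bs)"
        using as(1) bs l v(2) by (auto simp: reduced_word_def word_prod_append_S)
      have "nonneg (act (inv w) (act u (simple_root s)))"
        using aligned_prefix_not_inversion[OF dist sub w zs as(2,3) len al, of "length as"] as(1)
        by (simp add: reduced_word_def)
      moreover have "act (inv w) (act u (simple_root s)) = act (inv v) (simple_root s)"
        using v uc by (simp add: inv_mult_group act_mult)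
      ultimately have nn: "nonneg (act (inv v) (simple_root s))" by simp
      \<comment> \<open>A first letter of \<open>v\<close> cannot lie in \<open>set cs'\<close> by
        maximality of \<open>u\<close>, so it would have to be \<open>s\<close>; but
        \<open>inv v\<close> was just shown to keep \<alpha>_s nonnegative.\<close>
      have "v = \<one>"
      proof (rule ccontr)
        assume "v \<noteq> \<one>"
        then obtain r where r: "r \<in> S" "Suc (cox_length (r \<otimes> v)) = cox_length v"
          using cox_length_first v by blast
        have "v = inv u \<otimes> w" using v uc by simp
        then have pv: "parab (set (s # cs')) v"
          using parab_mult[OF parab_mono[OF parab_inv[OF u]] par sub] by auto
        obtain ys where "reduced_word (r \<otimes> v) ys" using exists_reduced r v S_closed by blast
        then have "reduced_word v (r # ys)" using reduced_word_Cons_iff[OF r(1) v(1) r(2)] by simp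
        then have "r \<in> set (s # cs')" using parab_reduced[OF pv sub] by fastforce
        moreover have "r \<notin> ?K" using asc r(2) by fastforce
        ultimately have "r = s" by simp
        then have "s \<in> inversions v" using simple_inversion_iff s r by simp
        then have "nonneg (- act (inv v) (simple_root s))"
          using inversions_iff[OF v(1) simple_reflection[OF s]] root_of_simple[OF s] by simp
        moreover have "is_root (act (inv v) (simple_root s))"
          using v s by (auto simp: is_root_def)
        ultimately show False using nn is_root_not_both by blast
      qed
      then have "w = u" using v uc by simp
      then show ?thesis using c_sortable_nondescent[OF s len w sub dist] u su Cons by simp
    qed
  qed
qed

lemma sortable_imp_aligned_wrt:
  assumes cs: "distinct cs" "set cs = S" and w: "w \<in> carrier W" and sort: "c_sortable cs w"
    and P: "flat P" "noncommutative P"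
  shows "aligned_wrt cs w P"
proof -
  obtain r1 r2 where d: "dihedral P r1 r2" using noncommutativeD P by blast
  interpret d: dihedral_flat W S A \<delta> P r1 r2 by fact
  show ?thesis
    using sortable_imp_aligned[OF cs(1) _ _ sort d] parab_S[OF w] root_of_supported d.r12 cs(2)
      aligned_wrt_iff[OF d, of cs w] by auto
qed

lemma c_aligned_imp_sortable:
  assumes cs: "distinct cs" "set cs = S" and w: "w \<in> carrier W" and al: "c_aligned cs w"
  shows "c_sortable cs w"
proof (rule aligned_imp_sortable)
  fix P r1 r2
  assume P: "rank_two_parabolic P" and d: "dihedral P r1 r2"
  interpret d: dihedral_flat W S A \<delta> P r1 r2 by fact
  have "noncommutative P" using d.labeling d.noncomm unfolding noncommutative_def by blast
  then have "aligned_wrt cs w P" using al P by (simp add: c_aligned_def)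
  then show "aligned_lab cs (inversions w \<inter> P) r1 r2 \<or> aligned_lab cs (inversions w \<inter> P) r2 r1"
    using aligned_wrt_iff[OF d, of cs w] cs by simp
qed (use cs parab_S[OF w] in auto)

end

theorem theorem4p3:
  fixes W :: "('a, 'b) monoid_scheme" and S :: "'a set"
    and A :: "'a \<Rightarrow> 'a \<Rightarrow> real" and \<delta> :: "'a \<Rightarrow> real"
    and c w :: 'a and cs :: "'a list"
  assumes "coxeter_root_datum W S A \<delta>"
    and "coxeter_system.coxeter_element_word W S c cs"
    and "w \<in> carrier W"
  shows "(coxeter_system.c_sortable W S cs w \<longleftrightarrow> coxeter_root_datum.c_aligned W S A \<delta> cs w) \<and>
    (coxeter_system.c_sortable W S cs w \<longrightarrow>
      (\<forall>P. coxeter_root_datum.gen_rank_two_parabolic W S A P \<and>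
           coxeter_root_datum.noncommutative W S A P
        \<longrightarrow> coxeter_root_datum.aligned_wrt W S A \<delta> cs w P))"
proof -
  interpret coxeter_root_datum W S A \<delta> by fact
  have cs: "distinct cs" "set cs = S" using assms(2) by (auto simp: coxeter_element_word_def)
  note aligned = sortable_imp_aligned_wrt[OF cs assms(3)]
  show ?thesis
    using aligned rank_two_parabolic_flat gen_rank_two_parabolic_flat
      c_aligned_imp_sortable[OF cs assms(3)] unfolding c_aligned_def by blast
qed

end
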